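(* Let $\mathbb{Q}^3_{p,\epsilon}$ be one of the six space forms $\mathbb{E}^3,\mathbb{L}^3,\mathbb{S}^3,\mathbb{H}^3,d\mathbb{S}^3,Ad\mathbb{S}^3$, and let $\Sigma$ be a connected, oriented surface of $\mathbb{Q}^3_{p,\epsilon}$, with real diagonalizable shape operator, which is free of umbilic points and such that one of its principal curvatures is constant equal to $r^{-1}$, $r>0$. Denote by $N$ its unit normal vector and set $\epsilon':=\|N\|^2$. Set $\epsilon'':=1$ (resp. $\epsilon'':=-1$) if the directions of the constant principal curvature are spacelike (resp. timelike). The critical constant of $\Sigma$ is the real number $c:=\epsilon''(\epsilon+\epsilon' r^{-2})$. Then: (1) If $c>0$, there exists a regular curve $\gamma$ in $\mathbb{Q}^3_{p,\epsilon\epsilon'\epsilon''}$ such that $\Sigma$ may be parametrized by the immersion $$\varphi(u,v):=|1+\epsilon\epsilon' r^2|^{-1/2}\Big(\gamma(u)+r\big(\cos(v)\,e_1(u)+\sin(v)\,e_2(u)\big)\Big),$$ where $(e_1,e_2)$ is an orthonormal frame of the normal space of $\gamma$ (which has definite induced metric). If $\epsilon''=\epsilon'$, $\Sigma$ is an elliptic tube, i.e. the set of points at distance $d$ from $\gamma\subset\mathbb{Q}^3_{p,\epsilon}$, where $d:=r$, $\tan^{-1}(r)$, $\tanh^{-1}(r)$ if $\epsilon\epsilon'=0$, $1$, $-1$ respectively. If $\epsilon''=-\epsilon'$ (which implies $\epsilon''=\epsilon$ and $r>1$), then $\Sigma$ is the polar of an elliptic tube of $\mathbb{Q}^3_{p,-\epsilon}$.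 (2) If $c<0$, then $\Sigma$ is a hyperbolic tube, i.e. there exists a regular curve $\gamma$ in $\mathbb{Q}^3_{p,-\epsilon\epsilon'\epsilon''}$ such that $\Sigma$ may be parametrized by the immersion $$\varphi(u,v):=|1+\epsilon\epsilon' r^2|^{-1/2}\Big(\gamma(u)+r\big(\cosh(v)\,e_1(u)+\sinh(v)\,e_2(u)\big)\Big),$$ where $(e_1,e_2)$ is an orthonormal frame of the normal space of $\gamma$ (which has indefinite induced metric) with $-\|e_1\|^2=\|e_2\|^2=\epsilon''$. (3) If $c=0$ (which implies $\epsilon=-\epsilon'$ and $r=1$), then $\Sigma$ is a parabolic tube, i.e. there exists a regular curve $\delta=(\delta_+,\delta_-)$ in $\mathbb{Q}^3_{p,\epsilon}\times\mathbb{Q}^3_{p,-\epsilon}$ satisfying $\langle\delta_\pm,\delta_\mp\rangle=\langle\delta_\pm',\delta_\mp\rangle=0$, such that $\Sigma$ may be parametrized by the immersion $$\varphi(u,v):=\Big(1-\epsilon\epsilon''\frac{v^2}{2}\Big)\delta_+(u)+v\,e_1(u)+\frac{v^2}{2}\,\delta_-(u),$$ where $\|e_1\|^2=\epsilon''$ and $\langle e_1,\delta_\pm\rangle=\langle e_1,\delta_\pm'\rangle=0$. In particular, if the curve $\delta_+$ (resp. $\delta_-$) is regular, then $(\delta_-,e_1)$ (resp. $(\delta_+,e_1)$) is an orthonormal frame of the normal space of $\delta_+$ in $\mathbb{Q}^3_{p,\epsilon}$ (resp. of $\delta_-$ in $\mathbb{Q}^3_{p,-\epsilon}$). Finally, exchanging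 the roles of $\delta_+$ and $\delta_-$ yields the polar of $\Sigma$.
   Context: For $p\in\{0,1,2\}$, $\mathbb{R}^4_p$ is $\mathbb{R}^4$ with the pseudo-Riemannian metric $\langle\cdot,\cdot\rangle=-\sum_{i=1}^p dx_i^2+\sum_{i=p+1}^4 dx_i^2$, and $\|x\|^2:=\langle x,x\rangle$ (which may be negative or zero). For $p\in\{0,1\}$, $\mathbb{Q}^3_{p,0}:=\{x\in\mathbb{R}^4_p : x_4=0\}$: Euclidean space $\mathbb{E}^3$ for $p=0$, Minkowski space $\mathbb{L}^3$ for $p=1$. For $\epsilon=\pm1$, $\mathbb{Q}^3_{p,\epsilon}:=\{x\in\mathbb{R}^4_p : \|x\|^2=\epsilon\}$ with the induced metric: $\mathbb{Q}^3_{0,1}=\mathbb{S}^3$, $\mathbb{Q}^3_{1,-1}=\mathbb{H}^3$ (hyperbolic space), $\mathbb{Q}^3_{1,1}=d\mathbb{S}^3$ (de Sitter space), $\mathbb{Q}^3_{2,-1}=Ad\mathbb{S}^3$ (anti-de Sitter space), and the auxiliary space $\mathbb{Q}^3_{2,1}$, which is anti-isometric to $Ad\mathbb{S}^3$. The number $\epsilon\in\{-1,0,1\}$ is the sectional curvature. Tangent vectors are regarded as vectors of $\mathbb{R}^4_p$. For an immersed surface with unit normal vector $N$ (tangent to $\mathbb{Q}^3_{p,\epsilon}$, $\|N\|^2=\pm1$), the shape operator is $-dN$ and the principal curvatures are its eigenvalues; a point is umbilic if the two principal curvatures coincide there. A vector $X$ is spacelike if $\|X\|^2>0$ and timelike if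 $\|X\|^2<0$. A curve is regular if its velocity never vanishes; for $\delta=(\delta_+,\delta_-)$ this means that $\delta_+'$ and $\delta_-'$ never vanish simultaneously. The normal space of a regular curve $\gamma$ in $\mathbb{Q}^3_{p,\eta}$ at $\gamma(u)$ is the orthogonal complement of $\gamma'(u)$ in $T_{\gamma(u)}\mathbb{Q}^3_{p,\eta}$. The vectors $e_1,e_2$ are $\mathbb{R}^4_p$-valued functions of $u$. Polar surface (case $\epsilon\neq0$): for an immersed surface $\varphi:\mathcal{M}\to\mathbb{Q}^3_{p,\epsilon}$ with unit normal $N$ and $\epsilon'=\|N\|^2$, the map $N:\mathcal{M}\to\mathbb{Q}^3_{p,\epsilon'}$ is an immersion if and only if no principal curvature of $\varphi$ vanishes; in this case $N$ is called the polar surface of $\varphi$ (and $\varphi$ is then the polar of $N$).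
   Formalization: Parametrizations are local, so Σ is locally an open piece of a tube (distance along normal geodesics); the polar is asserted only where no principal curvature vanishes; in (3) the exchange is (δ₊,δ₋)→(−εε''δ₋, εε''δ₊) with v→−v, as the literal exchange does not give the normal. *)

theory Defs
  imports "HOL-Analysis.Analysis"
begin

section \<open>The pseudo-Euclidean spaces and the space forms\<close>

text \<open>The sign of the \<open>i\<close>-th coordinate is negative for \<open>i = 1, ..., p\<close>; only \<open>p \<le> 2\<close> is used.\<close>

definition pinner :: "nat \<Rightarrow> real^4 \<Rightarrow> real^4 \<Rightarrow> real" where
  "pinner p x y =
     (if 1 \<le> p then - 1 else 1) * x$1 * y$1 + (if 2 \<le> p then - 1 else 1) * x$2 * y$2
     + x$3 * y$3 + x$4 * y$4"

abbreviation pnorm2 :: "nat \<Rightarrow> real^4 \<Rightarrow> real" where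
  "pnorm2 p x \<equiv> pinner p x x"

definition spacelike :: "nat \<Rightarrow> real^4 \<Rightarrow> bool" where
  "spacelike p X \<longleftrightarrow> pnorm2 p X > 0"

definition timelike :: "nat \<Rightarrow> real^4 \<Rightarrow> bool" where
  "timelike p X \<longleftrightarrow> pnorm2 p X < 0"

definition definite_metric :: "nat \<Rightarrow> (real^4) set \<Rightarrow> bool" where
  "definite_metric p V \<longleftrightarrow>
     (\<forall>X\<in>V. X \<noteq> 0 \<longrightarrow> spacelike p X) \<or> (\<forall>X\<in>V. X \<noteq> 0 \<longrightarrow> timelike p X)"

definition indefinite_metric :: "nat \<Rightarrow> (real^4) set \<Rightarrow> bool" where
  "indefinite_metric p V \<longleftrightarrow> (\<exists>X\<in>V. spacelike p X) \<and> (\<exists>X\<in>V. timelike p X)"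

definition Q3 :: "nat \<Rightarrow> real \<Rightarrow> (real^4) set" where
  "Q3 p \<epsilon> = {x. if \<epsilon> = 0 then x$4 = 0 else pnorm2 p x = \<epsilon>}"

definition tangent_Q3 :: "nat \<Rightarrow> real \<Rightarrow> real^4 \<Rightarrow> (real^4) set" where
  "tangent_Q3 p \<epsilon> x = {X. if \<epsilon> = 0 then X$4 = 0 else pinner p x X = 0}"

text \<open>In this order: \<open>E\<^sup>3\<close>, \<open>L\<^sup>3\<close>, \<open>S\<^sup>3\<close>, \<open>H\<^sup>3\<close>, \<open>dS\<^sup>3\<close>, \<open>AdS\<^sup>3\<close>.\<close>

definition space_form :: "nat \<Rightarrow> real \<Rightarrow> bool" where
  "space_form p \<epsilon> \<longleftrightarrow> (p, \<epsilon>) \<in> {(0, 0), (1, 0), (0, 1), (1, - 1), (1, 1), (2, - 1)}"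


section \<open>Smooth maps\<close>

text \<open>To be used on open sets only.\<close>

primrec Ck_on :: "nat \<Rightarrow> ('a::euclidean_space \<Rightarrow> 'b::euclidean_space) \<Rightarrow> 'a set \<Rightarrow> bool" where
  "Ck_on 0 f S \<longleftrightarrow> continuous_on S f"
| "Ck_on (Suc k) f S \<longleftrightarrow>
     (\<forall>x\<in>S. f differentiable (at x)) \<and> (\<forall>w. Ck_on k (\<lambda>x. frechet_derivative f (at x) w) S)"

definition smooth_on :: "('a::euclidean_space \<Rightarrow> 'b::euclidean_space) \<Rightarrow> 'a set \<Rightarrow> bool" where
  "smooth_on f S \<longleftrightarrow> (\<forall>k. Ck_on k f S)"


section \<open>Immersed surfaces\<close>

text \<open>
  A surface is a topological surface \<open>M\<close> (a set with its subspace topology) together with a map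
  \<open>f\<close>. There is no separate atlas: the smooth structure is the one that \<open>f\<close> induces. Indeed two
  local homeomorphisms whose composites with \<open>f\<close> are smooth immersions have a smooth transition
  map, so that there is exactly one smooth structure on \<open>M\<close> making \<open>f\<close> an immersion. An embedded
  surface is the case where \<open>f\<close> is the inclusion.
\<close>

definition surface_chart ::
    "'m::topological_space set \<Rightarrow> ('m \<Rightarrow> real^4) \<Rightarrow> (real \<times> real) set \<Rightarrow> (real \<times> real \<Rightarrow> 'm) \<Rightarrow> bool"
  where
  "surface_chart M f U \<psi> \<longleftrightarrow>
     open U \<and> openin (top_of_set M) (\<psi> ` U) \<and> (\<exists>\<psi>'. homeomorphism U (\<psi> ` U) \<psi> \<psi>') \<and>
     smooth_on (f \<circ> \<psi>) U \<and> (\<forall>u\<in>U. inj (frechet_derivative (f \<circ> \<psi>) (at u)))"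

definition immersed_surface :: "'m::topological_space set \<Rightarrow> ('m \<Rightarrow> real^4) \<Rightarrow> bool" where
  "immersed_surface M f \<longleftrightarrow> (\<forall>x\<in>M. \<exists>U \<psi>. surface_chart M f U \<psi> \<and> x \<in> \<psi> ` U)"

definition smooth_on_surface ::
    "'m::topological_space set \<Rightarrow> ('m \<Rightarrow> real^4) \<Rightarrow> ('m \<Rightarrow> real^4) \<Rightarrow> bool" where
  "smooth_on_surface M f g \<longleftrightarrow>
     (\<forall>x\<in>M. \<exists>U \<psi>. surface_chart M f U \<psi> \<and> x \<in> \<psi> ` U \<and> smooth_on (g \<circ> \<psi>) U)"

text \<open>Tangent vectors of the surface are regarded as vectors of the ambient \<open>R\<^sup>4\<close>.\<close>

definition tangent_plane :: "'m::topological_space set \<Rightarrow> ('m \<Rightarrow> real^4) \<Rightarrow> 'm \<Rightarrow> (real^4) set" where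
  "tangent_plane M f x =
     {X. \<exists>U \<psi> u w. surface_chart M f U \<psi> \<and> u \<in> U \<and> \<psi> u = x \<and>
           X = frechet_derivative (f \<circ> \<psi>) (at u) w}"

text \<open>The differential \<open>dg\<close> at \<open>x\<close>, as a map defined on the tangent plane of \<open>f\<close> at \<open>x\<close>.\<close>

definition surface_differential ::
    "'m::topological_space set \<Rightarrow> ('m \<Rightarrow> real^4) \<Rightarrow> ('m \<Rightarrow> real^4) \<Rightarrow> 'm \<Rightarrow> real^4 \<Rightarrow> real^4" where
  "surface_differential M f g x X =
     (THE Y. \<exists>U \<psi> u w. surface_chart M f U \<psi> \<and> u \<in> U \<and> \<psi> u = x \<and> (g \<circ> \<psi>) differentiable (at u) \<and>
           X = frechet_derivative (f \<circ> \<psi>) (at u) w \<and>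
           Y = frechet_derivative (g \<circ> \<psi>) (at u) w)"

definition oriented_surface ::
    "nat \<Rightarrow> real \<Rightarrow> 'm::topological_space set \<Rightarrow> ('m \<Rightarrow> real^4) \<Rightarrow> ('m \<Rightarrow> real^4) \<Rightarrow> bool" where
  "oriented_surface p \<epsilon> M f N \<longleftrightarrow>
     immersed_surface M f \<and> f ` M \<subseteq> Q3 p \<epsilon> \<and> smooth_on_surface M f N \<and>
     (\<forall>x\<in>M. N x \<in> tangent_Q3 p \<epsilon> (f x) \<and> \<bar>pnorm2 p (N x)\<bar> = 1 \<and>
            (\<forall>X\<in>tangent_plane M f x. pinner p (N x) X = 0))"

definition shape_operator ::
    "'m::topological_space set \<Rightarrow> ('m \<Rightarrow> real^4) \<Rightarrow> ('m \<Rightarrow> real^4) \<Rightarrow> 'm \<Rightarrow> real^4 \<Rightarrow> real^4" where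
  "shape_operator M f N x X = - surface_differential M f N x X"

definition diagonalizable_shape ::
    "'m::topological_space set \<Rightarrow> ('m \<Rightarrow> real^4) \<Rightarrow> ('m \<Rightarrow> real^4) \<Rightarrow> 'm \<Rightarrow> bool" where
  "diagonalizable_shape M f N x \<longleftrightarrow>
     (\<exists>B. independent B \<and> span B = tangent_plane M f x \<and>
          (\<forall>X\<in>B. \<exists>\<kappa>::real. shape_operator M f N x X = \<kappa> *\<^sub>R X))"

definition principal_direction ::
    "'m::topological_space set \<Rightarrow> ('m \<Rightarrow> real^4) \<Rightarrow> ('m \<Rightarrow> real^4) \<Rightarrow> 'm \<Rightarrow> real \<Rightarrow> real^4 \<Rightarrow> bool"
  where
  "principal_direction M f N x \<kappa> X \<longleftrightarrow>
     X \<in> tangent_plane M f x \<and> X \<noteq> 0 \<and> shape_operator M f N x X = \<kappa> *\<^sub>R X"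

definition principal_curvature ::
    "'m::topological_space set \<Rightarrow> ('m \<Rightarrow> real^4) \<Rightarrow> ('m \<Rightarrow> real^4) \<Rightarrow> 'm \<Rightarrow> real \<Rightarrow> bool" where
  "principal_curvature M f N x \<kappa> \<longleftrightarrow> (\<exists>X. principal_direction M f N x \<kappa> X)"

text \<open>The two eigenvalues coincide if and only if the set of real eigenvalues is a singleton.\<close>

definition umbilic ::
    "'m::topological_space set \<Rightarrow> ('m \<Rightarrow> real^4) \<Rightarrow> ('m \<Rightarrow> real^4) \<Rightarrow> 'm \<Rightarrow> bool" where
  "umbilic M f N x \<longleftrightarrow> (\<exists>\<kappa>. {\<kappa>'. principal_curvature M f N x \<kappa>'} = {\<kappa>})"

text \<open>\<open>g\<close> is the polar surface, in the space form of curvature \<open>\<eta>\<close>, of the surface \<open>f\<close> with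
  unit normal \<open>N\<close>.\<close>

definition polar_surface ::
    "nat \<Rightarrow> real \<Rightarrow> 'm::topological_space set \<Rightarrow> ('m \<Rightarrow> real^4) \<Rightarrow> ('m \<Rightarrow> real^4) \<Rightarrow> ('m \<Rightarrow> real^4) \<Rightarrow> bool"
  where
  "polar_surface p \<eta> M f N g \<longleftrightarrow>
     (\<forall>x\<in>M. \<not> principal_curvature M f N x 0) \<and> (\<forall>x\<in>M. g x = N x) \<and>
     immersed_surface M g \<and> g ` M \<subseteq> Q3 p \<eta>"

text \<open>The part of a surface on which no principal curvature vanishes, that is, on which the unit
  normal is an immersion and the polar surface makes sense.\<close>

definition polar_domain ::
    "'m::topological_space set \<Rightarrow> ('m \<Rightarrow> real^4) \<Rightarrow> ('m \<Rightarrow> real^4) \<Rightarrow> 'm set" where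
  "polar_domain M f N = {x\<in>M. \<not> principal_curvature M f N x 0}"


section \<open>Curves, tubes and their parametrizations\<close>

definition open_interval :: "real set \<Rightarrow> bool" where
  "open_interval I \<longleftrightarrow> open I \<and> is_interval I \<and> I \<noteq> {}"

definition regular_curve :: "real set \<Rightarrow> (real \<Rightarrow> real^4) \<Rightarrow> bool" where
  "regular_curve I \<gamma> \<longleftrightarrow> smooth_on \<gamma> I \<and> (\<forall>u\<in>I. vector_derivative \<gamma> (at u) \<noteq> 0)"

definition curve_normal_space :: "nat \<Rightarrow> real \<Rightarrow> (real \<Rightarrow> real^4) \<Rightarrow> real \<Rightarrow> (real^4) set" where
  "curve_normal_space p \<eta> \<gamma> u =
     {X \<in> tangent_Q3 p \<eta> (\<gamma> u). pinner p X (vector_derivative \<gamma> (at u)) = 0}"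

definition orthonormal_normal_frame ::
    "nat \<Rightarrow> real \<Rightarrow> real set \<Rightarrow> (real \<Rightarrow> real^4) \<Rightarrow> (real \<Rightarrow> real^4) \<Rightarrow> (real \<Rightarrow> real^4) \<Rightarrow> bool" where
  "orthonormal_normal_frame p \<eta> I \<gamma> e1 e2 \<longleftrightarrow>
     smooth_on e1 I \<and> smooth_on e2 I \<and>
     (\<forall>u\<in>I. span {e1 u, e2 u} = curve_normal_space p \<eta> \<gamma> u \<and>
        \<bar>pnorm2 p (e1 u)\<bar> = 1 \<and> \<bar>pnorm2 p (e2 u)\<bar> = 1 \<and> pinner p (e1 u) (e2 u) = 0)"

text \<open>A geodesic segment of length \<open>d\<close>, parametrized by arc length, issued from \<open>x\<close> with velocity
  \<open>w\<close> and ending at \<open>y\<close>: its acceleration is orthogonal to the space form.\<close>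

definition unit_geodesic ::
    "nat \<Rightarrow> real \<Rightarrow> real \<Rightarrow> real^4 \<Rightarrow> real^4 \<Rightarrow> real^4 \<Rightarrow> bool" where
  "unit_geodesic p \<epsilon> d x w y \<longleftrightarrow>
     (\<exists>c c' c''. c 0 = x \<and> c' 0 = w \<and> c d = y \<and>
        (\<forall>t\<in>{0..d}. c t \<in> Q3 p \<epsilon> \<and>
           (c has_vector_derivative c' t) (at t within {0..d}) \<and>
           (c' has_vector_derivative c'' t) (at t within {0..d}) \<and>
           \<bar>pnorm2 p (c' t)\<bar> = 1 \<and>
           (\<forall>X\<in>tangent_Q3 p \<epsilon> (c t). pinner p (c'' t) X = 0)))"

text \<open>Points at distance \<open>d\<close> from a curve, in the sense of normal geodesics: in the indefinite
  case an infimum of lengths makes no sense, and even in \<open>E\<^sup>3\<close> the infimum is less than \<open>d\<close> beyond the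
  focal points of the curve (for instance on the inner part of a spindle torus).\<close>

definition elliptic_tube :: "nat \<Rightarrow> real \<Rightarrow> real set \<Rightarrow> (real \<Rightarrow> real^4) \<Rightarrow> real \<Rightarrow> (real^4) set" where
  "elliptic_tube p \<epsilon> I \<gamma> d =
     {y. \<exists>u\<in>I. \<exists>w\<in>curve_normal_space p \<epsilon> \<gamma> u. unit_geodesic p \<epsilon> d (\<gamma> u) w y}"

definition tube_radius :: "real \<Rightarrow> real \<Rightarrow> real \<Rightarrow> real" where
  "tube_radius \<epsilon> \<epsilon>' r =
     (if \<epsilon> * \<epsilon>' = 0 then r else if \<epsilon> * \<epsilon>' = 1 then arctan r else artanh r)"

definition elliptic_map ::
    "real \<Rightarrow> real \<Rightarrow> real \<Rightarrow> (real \<Rightarrow> real^4) \<Rightarrow> (real \<Rightarrow> real^4) \<Rightarrow> (real \<Rightarrow> real^4) \<Rightarrow>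
     real \<times> real \<Rightarrow> real^4" where
  "elliptic_map \<epsilon> \<epsilon>' r \<gamma> e1 e2 = (\<lambda>(u, v).
     (\<bar>1 + \<epsilon> * \<epsilon>' * r\<^sup>2\<bar> powr (- 1 / 2)) *\<^sub>R (\<gamma> u + r *\<^sub>R (cos v *\<^sub>R e1 u + sin v *\<^sub>R e2 u)))"

definition hyperbolic_map ::
    "real \<Rightarrow> real \<Rightarrow> real \<Rightarrow> (real \<Rightarrow> real^4) \<Rightarrow> (real \<Rightarrow> real^4) \<Rightarrow> (real \<Rightarrow> real^4) \<Rightarrow>
     real \<times> real \<Rightarrow> real^4" where
  "hyperbolic_map \<epsilon> \<epsilon>' r \<gamma> e1 e2 = (\<lambda>(u, v).
     (\<bar>1 + \<epsilon> * \<epsilon>' * r\<^sup>2\<bar> powr (- 1 / 2)) *\<^sub>R (\<gamma> u + r *\<^sub>R (cosh v *\<^sub>R e1 u + sinh v *\<^sub>R e2 u)))"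

definition parabolic_map ::
    "real \<Rightarrow> real \<Rightarrow> (real \<Rightarrow> real^4) \<Rightarrow> (real \<Rightarrow> real^4) \<Rightarrow> (real \<Rightarrow> real^4) \<Rightarrow>
     real \<times> real \<Rightarrow> real^4" where
  "parabolic_map \<epsilon> \<epsilon>'' \<delta>p \<delta>m e1 = (\<lambda>(u, v).
     (1 - \<epsilon> * \<epsilon>'' * (v\<^sup>2 / 2)) *\<^sub>R \<delta>p u + v *\<^sub>R e1 u + (v\<^sup>2 / 2) *\<^sub>R \<delta>m u)"

text \<open>
  Exchanging \<open>\<delta>\<^sub>+\<close> and \<open>\<delta>\<^sub>-\<close> (and \<open>\<epsilon>\<close> with \<open>-\<epsilon>\<close>) produces the unit normal of the parabolic tube only
  after a change of signs: with \<open>a = \<epsilon>\<epsilon>''\<close>, the vector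
  \<open>(1 + a v\<^sup>2/2) \<delta>\<^sub>- + v e\<^sub>1 + (v\<^sup>2/2) \<delta>\<^sub>+\<close> is not orthogonal to the surface, whereas the
  same expression at \<open>-v\<close> with \<open>(\<delta>\<^sub>-, \<delta>\<^sub>+)\<close> replaced by \<open>(- a \<delta>\<^sub>-, a \<delta>\<^sub>+)\<close> is the normal for which
  the constant principal curvature is \<open>1\<close>.
\<close>

text \<open>The conditions on the curve \<open>(\<delta>\<^sub>+, \<delta>\<^sub>-)\<close> and the field \<open>e\<^sub>1\<close> of a parabolic tube.\<close>

definition parabolic_data ::
    "nat \<Rightarrow> real \<Rightarrow> real \<Rightarrow> real set \<Rightarrow> (real \<Rightarrow> real^4) \<Rightarrow> (real \<Rightarrow> real^4) \<Rightarrow> (real \<Rightarrow> real^4) \<Rightarrow> bool"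
  where
  "parabolic_data p \<epsilon> \<epsilon>'' I \<delta>p \<delta>m e1 \<longleftrightarrow>
     smooth_on \<delta>p I \<and> smooth_on \<delta>m I \<and> smooth_on e1 I \<and>
     \<delta>p ` I \<subseteq> Q3 p \<epsilon> \<and> \<delta>m ` I \<subseteq> Q3 p (- \<epsilon>) \<and>
     (\<forall>u\<in>I.
        (vector_derivative \<delta>p (at u) \<noteq> 0 \<or> vector_derivative \<delta>m (at u) \<noteq> 0) \<and>
        pinner p (\<delta>p u) (\<delta>m u) = 0 \<and>
        pinner p (vector_derivative \<delta>p (at u)) (\<delta>m u) = 0 \<and>
        pinner p (vector_derivative \<delta>m (at u)) (\<delta>p u) = 0 \<and>
        pnorm2 p (e1 u) = \<epsilon>'' \<and>
        pinner p (e1 u) (\<delta>p u) = 0 \<and> pinner p (e1 u) (\<delta>m u) = 0 \<and>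
        pinner p (e1 u) (vector_derivative \<delta>p (at u)) = 0 \<and>
        pinner p (e1 u) (vector_derivative \<delta>m (at u)) = 0)"

text \<open>
  Near \<open>x\<close>, the surface \<open>f\<close> is parametrized by the immersion \<open>\<phi>\<close> on \<open>I \<times> J\<close>. Parametrizations are
  local: a connected surface that is not complete may contain strips of two different tubes whose
  central curves coincide on an interval only, so that no single central curve serves globally.
\<close>

definition parametrized_near ::
    "'m::topological_space set \<Rightarrow> ('m \<Rightarrow> real^4) \<Rightarrow> 'm \<Rightarrow> real set \<Rightarrow> real set \<Rightarrow> (real \<times> real \<Rightarrow> 'm) \<Rightarrow>
     (real \<times> real \<Rightarrow> real^4) \<Rightarrow> bool" where
  "parametrized_near M f x I J \<psi> \<phi> \<longleftrightarrow>
     open_interval I \<and> open_interval J \<and> surface_chart M f (I \<times> J) \<psi> \<and> x \<in> \<psi> ` (I \<times> J) \<and>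
     (\<forall>q\<in>I \<times> J. f (\<psi> q) = \<phi> q)"

definition critical_constant :: "real \<Rightarrow> real \<Rightarrow> real \<Rightarrow> real \<Rightarrow> real" where
  "critical_constant \<epsilon> \<epsilon>' \<epsilon>'' r = \<epsilon>'' * (\<epsilon> + \<epsilon>' / r\<^sup>2)"

end

theory Submission
  imports Defs
begin

text \<open>
  The map \<open>f + r N\<close> kills the directions of the principal curvature \<open>1/r\<close> and, there being no umbilic
  points, has rank one. In coordinates whose first one is a component of this map it is therefore a
  curve \<open>\<Gamma>(u)\<close>, the focal curve. Differentiating the products of \<open>f\<close>, \<open>N\<close> and \<open>\<Gamma>\<close> shows that \<open>\<Gamma>'\<close> is
  orthogonal to \<open>f\<close> (if \<open>\<epsilon> \<noteq> 0\<close>), to \<open>N\<close> and to the fibre \<open>u = const\<close>, so that each fibre lies in the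
  orthogonal complement of \<open>\<Gamma>'(u)\<close>; the equations for its products with itself and with \<open>\<Gamma>(u)\<close>
  cut out a conic there. The sign of the critical constant decides whether \<open>\<Gamma>\<close> can be
  normalized to a curve of a space form whose normal planes are definite or indefinite, or is null.
\<close>

section \<open>Calculus of smooth maps\<close>

text \<open>Two obstacles shape the proof. The metric is indefinite, so it has to be proved that the
  fibres are nowhere null. In the absence of umbilic points there is a second principal direction,
  which makes \<open>\<Gamma>'\<close> independent of the fibre direction; with \<open>N\<close> and
  the position vector (a constant vector if \<open>\<epsilon> = 0\<close>) the two form an
  orthogonal basis of \<open>R^4\<close>, and an orthogonal basis of a nondegenerate form contains
  no null vector. This gives the sign \<open>\<epsilon>''\<close> a meaning and makes it constant on
  the connected surface. Secondly, charts are mere homeomorphisms whose smoothness is measured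
  through \<open>f\<close>, so chart changes must be shown to be differentiable before tangent
  planes and shape operators can be computed in a single chart. The trichotomy is governed by
  \<open>k0 = 1 + \<epsilon> \<epsilon>' r^2\<close>: for \<open>\<epsilon> \<noteq> 0\<close> the
  focal curve has square norm \<open>\<epsilon> k0\<close>, and the critical constant is
  \<open>\<epsilon>' \<epsilon>'' k0 / r^2\<close>. If \<open>k0 \<noteq> 0\<close>, any section
  transverse to the fibres supplies a frame of the normal planes; if \<open>k0 = 0\<close>, the
  section has to be corrected until it crosses the fibres orthogonally.\<close>

abbreviation Dif :: "('a::euclidean_space \<Rightarrow> 'b::euclidean_space) \<Rightarrow> 'a \<Rightarrow> 'a \<Rightarrow> 'b" where
  "Dif f x \<equiv> frechet_derivative f (at x)"

lemma Dif_eqI: "(f has_derivative f') (at x) \<Longrightarrow> Dif f x = f'"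
  using frechet_derivative_at by metis

lemma Dif_works: "f differentiable (at x) \<Longrightarrow> (f has_derivative Dif f x) (at x)"
  using frechet_derivative_works by blast

lemma has_derivative_transform_open:
  assumes "(f has_derivative f') (at x)" "open S" "x \<in> S" "\<And>y. y \<in> S \<Longrightarrow> f y = g y"
  shows "(g has_derivative f') (at x)"
  using has_derivative_transform_within_open[OF assms(1-3)] assms(4) by blast

text \<open>\<open>frechet_derivative\<close> looks at a whole neighbourhood of a point; openness of
  \<open>S\<close> is what makes agreement on \<open>S\<close> enough.\<close>

lemma Ck_on_cong:
  assumes "open S" "\<And>x. x \<in> S \<Longrightarrow> f x = g x" "Ck_on k f S"
  shows "Ck_on k g S"
  using assms(2,3)
proof (induction k arbitrary: f g)
  case 0
  then show ?case by (simp cong: continuous_on_cong)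
next
  case (Suc k)
  have d: "(g has_derivative Dif f x) (at x)" if "x \<in> S" for x
  proof (rule has_derivative_transform_open[OF Dif_works assms(1) that Suc.prems(1)])
    show "f differentiable (at x)" using Suc.prems(2) that by simp
  qed
  have "Ck_on k (\<lambda>x. Dif g x w) S" for w
  proof (rule Suc.IH)
    show "Ck_on k (\<lambda>x. Dif f x w) S" using Suc.prems(2) by simp
  qed (simp add: Dif_eqI[OF d])
  then show ?case using differentiableI[OF d] by simp
qed

text \<open>Lets a proof present the derivative in any convenient form; inductions then run on that
  form instead of on \<open>frechet_derivative\<close>.\<close>

lemma Ck_on_SucI:
  assumes "open S" "\<And>x. x \<in> S \<Longrightarrow> (f has_derivative f' x) (at x)"
    and "\<And>w. Ck_on k (\<lambda>x. f' x w) S"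
  shows "Ck_on (Suc k) f S"
proof -
  have "f differentiable (at x)" if "x \<in> S" for x
    using assms(2)[OF that] differentiable_def by blast
  moreover have "Ck_on k (\<lambda>x. Dif f x w) S" for w
    by (rule Ck_on_cong[OF assms(1) _ assms(3)[of w]]) (simp add: Dif_eqI[OF assms(2)])
  ultimately show ?thesis by simp
qed

lemma Ck_on_has_derivative:
  "Ck_on (Suc k) f S \<Longrightarrow> x \<in> S \<Longrightarrow> (f has_derivative Dif f x) (at x)"
  by (auto intro: Dif_works)

lemma Ck_on_continuous: "Ck_on k f S \<Longrightarrow> continuous_on S f"
  by (cases k)
    (auto intro!: continuous_at_imp_continuous_on differentiable_imp_continuous_within)

lemma Ck_on_SucD: "Ck_on (Suc k) f S \<Longrightarrow> Ck_on k f S"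
proof (induction k arbitrary: f)
  case 0
  then show ?case using Ck_on_continuous[of "Suc 0" f S] by simp
next
  case (Suc k)
  have "Ck_on k (\<lambda>x. Dif f x w) S" for w using Suc.prems by (intro Suc.IH) simp
  then show ?case using Suc.prems by simp
qed

lemma Ck_on_subset: "Ck_on k f S \<Longrightarrow> T \<subseteq> S \<Longrightarrow> Ck_on k f T"
  by (induction k arbitrary: f) (auto intro: continuous_on_subset)

lemma Ck_on_const: "Ck_on k (\<lambda>x. c) S"
proof (induction k arbitrary: c)
  case (Suc k)
  have "Dif (\<lambda>x::'a. c) x = (\<lambda>w. 0)" for x by (rule Dif_eqI) simp
  then show ?case using Suc.IH[of 0] by simp
qed simp

lemma Ck_on_linear:
  assumes "bounded_linear l" "open S" "Ck_on k f S"
  shows "Ck_on k (\<lambda>x. l (f x)) S"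
  using assms(3)
proof (induction k arbitrary: f)
  case 0
  then show ?case
    using bounded_linear.continuous_on[OF assms(1)] by simp
next
  case (Suc k)
  have "((\<lambda>x. l (f x)) has_derivative (\<lambda>w. l (Dif f x w))) (at x)" if "x \<in> S" for x
    using bounded_linear.has_derivative[OF assms(1) Ck_on_has_derivative[OF Suc.prems that]] .
  moreover have "Ck_on k (\<lambda>x. l (Dif f x w)) S" for w using Suc by simp
  ultimately show ?case by (rule Ck_on_SucI[OF assms(2)])
qed

lemma Ck_on_id: "open S \<Longrightarrow> Ck_on k (\<lambda>x. x) S"
proof (cases k)
  case (Suc j)
  assume "open S"
  moreover have "((\<lambda>x. x) has_derivative (\<lambda>w. w)) (at x)" for x :: 'a by simp
  ultimately show ?thesis unfolding Suc by (rule Ck_on_SucI) (rule Ck_on_const)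
qed simp

lemma Ck_on_add:
  assumes "open S" "Ck_on k f S" "Ck_on k g S"
  shows "Ck_on k (\<lambda>x. f x + g x) S"
  using assms(2,3)
proof (induction k arbitrary: f g)
  case 0
  then show ?case by (simp add: continuous_on_add)
next
  case (Suc k)
  have "((\<lambda>x. f x + g x) has_derivative (\<lambda>w. Dif f x w + Dif g x w)) (at x)" if "x \<in> S" for x
    using Ck_on_has_derivative[OF Suc.prems(1) that] Ck_on_has_derivative[OF Suc.prems(2) that]
    by (rule has_derivative_add)
  moreover have "Ck_on k (\<lambda>x. Dif f x w + Dif g x w) S" for w using Suc by simp
  ultimately show ?case by (rule Ck_on_SucI[OF assms(1)])
qed

lemma Ck_on_sum:
  "open S \<Longrightarrow> (\<And>i. i \<in> A \<Longrightarrow> Ck_on k (f i) S) \<Longrightarrow> Ck_on k (\<lambda>x. \<Sum>i\<in>A. f i x) S"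
  by (induction A rule: infinite_finite_induct) (auto intro: Ck_on_const Ck_on_add)

lemma Ck_on_bilinear:
  assumes b: "bounded_bilinear b" and "open S" "Ck_on k f S" "Ck_on k g S"
  shows "Ck_on k (\<lambda>x. b (f x) (g x)) S"
  using assms(3,4)
proof (induction k arbitrary: f g)
  case 0
  then show ?case using bounded_bilinear.continuous_on[OF b] by simp
next
  case (Suc k)
  have "((\<lambda>x. b (f x) (g x)) has_derivative (\<lambda>w. b (f x) (Dif g x w) + b (Dif f x w) (g x))) (at x)"
    if "x \<in> S" for x
    using Ck_on_has_derivative[OF Suc.prems(1) that] Ck_on_has_derivative[OF Suc.prems(2) that]
    by (rule bounded_bilinear.FDERIV[OF b])
  moreover have "Ck_on k (\<lambda>x. b (f x) (Dif g x w) + b (Dif f x w) (g x)) S" for w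
    using Suc.prems Ck_on_SucD[OF Suc.prems(1)] Ck_on_SucD[OF Suc.prems(2)]
    by (intro Ck_on_add Suc.IH assms(2)) auto
  ultimately show ?case by (rule Ck_on_SucI[OF assms(2)])
qed

text \<open>In the chain rule the direction \<open>Dif f x w\<close> varies with \<open>x\<close>,
  whereas \<open>Ck_on\<close> controls \<open>Dif g\<close> in fixed directions. Expanding the
  direction in \<open>Basis\<close> turns the derivative into a sum of products to which the
  induction hypothesis applies.\<close>

lemma Ck_on_compose:
  assumes "open S" "open T" "f ` S \<subseteq> T" "Ck_on k f S" "Ck_on k g T"
  shows "Ck_on k (\<lambda>x. g (f x)) S"
  using assms(4,5)
proof (induction k arbitrary: g)
  case 0
  then show ?case using continuous_on_compose2[of T g S f] assms(3) by auto
next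
  case (Suc k)
  have d: "((\<lambda>x. g (f x)) has_derivative (\<lambda>w. \<Sum>b\<in>Basis. (Dif f x w \<bullet> b) *\<^sub>R Dif g (f x) b)) (at x)"
    if "x \<in> S" for x
  proof -
    have 1: "(g has_derivative Dif g (f x)) (at (f x))"
      using Suc.prems(2) that assms(3) by (intro Ck_on_has_derivative) auto
    interpret bounded_linear "Dif g (f x)" using 1 by (rule has_derivative_bounded_linear)
    have "Dif g (f x) (Dif f x w) = (\<Sum>b\<in>Basis. (Dif f x w \<bullet> b) *\<^sub>R Dif g (f x) b)" for w
    proof -
      have "Dif g (f x) (Dif f x w) = Dif g (f x) (\<Sum>b\<in>Basis. (Dif f x w \<bullet> b) *\<^sub>R b)"
        by (simp only: euclidean_representation)
      then show ?thesis by (simp only: sum scaleR)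
    qed
    then show ?thesis
      using has_derivative_compose[OF Ck_on_has_derivative[OF Suc.prems(1) that] 1] by simp
  qed
  have "Ck_on k (\<lambda>x. (Dif f x w \<bullet> b) *\<^sub>R Dif g (f x) b) S" for w b
    using Suc.prems Ck_on_SucD[OF Suc.prems(1)]
    by (intro Ck_on_bilinear[OF bounded_bilinear_scaleR assms(1)] Suc.IH
          Ck_on_linear[OF bounded_linear_inner_left assms(1)]) auto
  then have "Ck_on k (\<lambda>x. \<Sum>b\<in>Basis. (Dif f x w \<bullet> b) *\<^sub>R Dif g (f x) b) S" for w
    by (intro Ck_on_sum assms(1))
  with d show ?case by (rule Ck_on_SucI[OF assms(1)])
qed

section \<open>Closure properties of smooth maps\<close>

lemma smooth_on_differentiable: "smooth_on f S \<Longrightarrow> x \<in> S \<Longrightarrow> f differentiable (at x)"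
  unfolding smooth_on_def by (metis Ck_on.simps(2))

lemma smooth_on_has_derivative: "smooth_on f S \<Longrightarrow> x \<in> S \<Longrightarrow> (f has_derivative Dif f x) (at x)"
  by (simp add: Dif_works smooth_on_differentiable)

lemma smooth_on_continuous_on: "smooth_on f S \<Longrightarrow> continuous_on S f"
  unfolding smooth_on_def using Ck_on_continuous by blast

lemma smooth_on_subset: "smooth_on f S \<Longrightarrow> T \<subseteq> S \<Longrightarrow> smooth_on f T"
  unfolding smooth_on_def using Ck_on_subset by blast

lemma smooth_on_cong:
  "smooth_on f S \<Longrightarrow> open S \<Longrightarrow> (\<And>x. x \<in> S \<Longrightarrow> f x = g x) \<Longrightarrow> smooth_on g S"
  unfolding smooth_on_def using Ck_on_cong by blast

lemma smooth_on_Dif: "smooth_on f S \<Longrightarrow> smooth_on (\<lambda>x. Dif f x w) S"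
  unfolding smooth_on_def by (metis Ck_on.simps(2))

lemma smooth_on_derivI:
  assumes "open S" "\<And>x. x \<in> S \<Longrightarrow> (f has_derivative f' x) (at x)" "\<And>w. smooth_on (\<lambda>x. f' x w) S"
  shows "smooth_on f S"
  unfolding smooth_on_def
proof
  fix k show "Ck_on k f S"
    using Ck_on_SucI[OF assms(1,2)] assms(3) Ck_on_SucD unfolding smooth_on_def by blast
qed

lemma smooth_on_const: "smooth_on (\<lambda>x. c) S"
  by (simp add: smooth_on_def Ck_on_const)

lemma smooth_on_id: "open S \<Longrightarrow> smooth_on (\<lambda>x. x) S"
  by (simp add: smooth_on_def Ck_on_id)

lemma smooth_on_linear: "bounded_linear l \<Longrightarrow> open S \<Longrightarrow> smooth_on f S \<Longrightarrow> smooth_on (\<lambda>x. l (f x)) S"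
  by (simp add: smooth_on_def Ck_on_linear)

lemma smooth_on_add: "open S \<Longrightarrow> smooth_on f S \<Longrightarrow> smooth_on g S \<Longrightarrow> smooth_on (\<lambda>x. f x + g x) S"
  by (simp add: smooth_on_def Ck_on_add)

lemma smooth_on_bilinear:
  "bounded_bilinear b \<Longrightarrow> open S \<Longrightarrow> smooth_on f S \<Longrightarrow> smooth_on g S \<Longrightarrow> smooth_on (\<lambda>x. b (f x) (g x)) S"
  by (simp add: smooth_on_def Ck_on_bilinear)

lemma smooth_on_compose:
  "smooth_on g T \<Longrightarrow> open S \<Longrightarrow> open T \<Longrightarrow> f ` S \<subseteq> T \<Longrightarrow> smooth_on f S \<Longrightarrow> smooth_on (\<lambda>x. g (f x)) S"
  unfolding smooth_on_def using Ck_on_compose by blast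

lemmas smooth_on_scaleR = smooth_on_bilinear[OF bounded_bilinear_scaleR]
lemmas smooth_on_mult = smooth_on_bilinear[OF bounded_bilinear_mult]
lemmas smooth_on_minus = smooth_on_linear[OF bounded_linear_minus[OF bounded_linear_ident]]
lemmas smooth_on_fst = smooth_on_linear[OF bounded_linear_fst]
lemmas smooth_on_snd = smooth_on_linear[OF bounded_linear_snd]

lemma smooth_on_diff: "open S \<Longrightarrow> smooth_on f S \<Longrightarrow> smooth_on g S \<Longrightarrow> smooth_on (\<lambda>x. f x - g x) S"
  using smooth_on_add[of S f "\<lambda>x. - g x"] smooth_on_minus[of S g] by simp

lemma smooth_on_Pair:
  assumes "open S" "smooth_on f S" "smooth_on g S"
  shows "smooth_on (\<lambda>x. (f x, g x)) S"
proof -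
  have "bounded_linear (\<lambda>x::'b. (x, 0::'c))" "bounded_linear (\<lambda>x::'c. (0::'b, x))"
    by (auto intro: bounded_linear_Pair bounded_linear_ident bounded_linear_zero)
  then have "smooth_on (\<lambda>x. (f x, 0) + (0, g x)) S"
    using assms by (intro smooth_on_add) (auto dest: smooth_on_linear)
  then show ?thesis by simp
qed

section \<open>Smoothness of powers, trigonometric and hyperbolic functions, and the
  reciprocal\<close>

lemma smooth_on_powr: "smooth_on (\<lambda>x::real. x powr a) {0<..}"
proof -
  \<comment> \<open>The family of all \<open>c * x powr a\<close> is closed under differentiation,
    so the induction generalizes over both constants.\<close>
  have "Ck_on k (\<lambda>x::real. c * x powr a) {0<..}" for k c
  proof (induction k arbitrary: a c)
    case 0
    then show ?case by (auto intro!: continuous_intros)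
  next
    case (Suc k)
    have "((\<lambda>x. c * x powr a) has_derivative (\<lambda>w. (w * c * a) * x powr (a - 1))) (at x)"
      if "x \<in> {0<..}" for x
      using that by (auto intro!: derivative_eq_intros simp: powr_diff field_simps fun_eq_iff)
    then show ?case by (rule Ck_on_SucI[OF open_greaterThan _ Suc.IH])
  qed
  from this[of _ 1] show ?thesis by (simp add: smooth_on_def)
qed

lemma smooth_on_sin_cos: "smooth_on (sin :: real \<Rightarrow> real) UNIV" "smooth_on (cos :: real \<Rightarrow> real) UNIV"
proof -
  \<comment> \<open>The span of \<open>sin\<close> and \<open>cos\<close> is invariant under
    differentiation, hence the two arbitrary coefficients.\<close>
  have "Ck_on k (\<lambda>x::real. a * sin x + b * cos x) UNIV" for k a b
  proof (induction k arbitrary: a b)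
    case 0
    then show ?case by (auto intro!: continuous_intros)
  next
    case (Suc k)
    have "((\<lambda>x. a * sin x + b * cos x) has_derivative (\<lambda>w. (- w * b) * sin x + (w * a) * cos x)) (at x)"
      for x by (auto intro!: derivative_eq_intros simp: field_simps fun_eq_iff)
    then show ?case by (rule Ck_on_SucI[OF open_UNIV]) (rule Suc.IH)
  qed
  from this[of _ 1 0] this[of _ 0 1] show "smooth_on (sin :: real \<Rightarrow> real) UNIV" "smooth_on (cos :: real \<Rightarrow> real) UNIV"
    by (simp_all add: smooth_on_def)
qed

lemma smooth_on_sinh_cosh: "smooth_on (sinh :: real \<Rightarrow> real) UNIV" "smooth_on (cosh :: real \<Rightarrow> real) UNIV"
proof -
  have "Ck_on k (\<lambda>x::real. a * sinh x + b * cosh x) UNIV" for k a b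
  proof (induction k arbitrary: a b)
    case 0
    then show ?case by (auto intro!: continuous_intros)
  next
    case (Suc k)
    have "((\<lambda>x. a * sinh x + b * cosh x) has_derivative (\<lambda>w. (w * b) * sinh x + (w * a) * cosh x)) (at x)"
      for x by (auto intro!: derivative_eq_intros simp: field_simps fun_eq_iff)
    then show ?case by (rule Ck_on_SucI[OF open_UNIV]) (rule Suc.IH)
  qed
  from this[of _ 1 0] this[of _ 0 1] show "smooth_on (sinh :: real \<Rightarrow> real) UNIV" "smooth_on (cosh :: real \<Rightarrow> real) UNIV"
    by (simp_all add: smooth_on_def)
qed

lemma smooth_on_inverse: "smooth_on (\<lambda>x::real. inverse x) (- {0})"
proof -
  have "Ck_on k (\<lambda>x::real. inverse x) (- {0})" for k
  proof (induction k)
    case 0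
    then show ?case by (auto intro!: continuous_intros)
  next
    case (Suc k)
    \<comment> \<open>Written with two copies of \<open>inverse x\<close>, the derivative inherits
      class C^k from the induction hypothesis.\<close>
    have "((\<lambda>x. inverse x) has_derivative (\<lambda>w. (inverse x * inverse x) * - w)) (at x)"
      if "x \<in> - {0}" for x :: real
      using that by (auto intro!: derivative_eq_intros simp: field_simps fun_eq_iff)
    moreover have "Ck_on k (\<lambda>x::real. (inverse x * inverse x) * - w) (- {0})" for w
      by (intro Ck_on_bilinear[OF bounded_bilinear_mult] Suc.IH Ck_on_const open_Compl closed_singleton)
    ultimately show ?case by (rule Ck_on_SucI[OF open_Compl[OF closed_singleton]])
  qed
  then show ?thesis by (simp add: smooth_on_def)
qed

section \<open>The inverse function theorem in the plane\<close>

lemma linear_plane_expand: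
  fixes L :: "real \<times> real \<Rightarrow> 'a::real_vector"
  assumes "linear L"
  shows "L w = fst w *\<^sub>R L (1, 0) + snd w *\<^sub>R L (0, 1)"
proof -
  have "L w = L (fst w *\<^sub>R (1, 0) + snd w *\<^sub>R (0, 1))" by (simp add: prod_eq_iff)
  also have "\<dots> = fst w *\<^sub>R L (1, 0) + snd w *\<^sub>R L (0, 1)"
    by (simp only: linear_add[OF assms] linear_scale[OF assms])
  finally show ?thesis .
qed

text \<open>Cramer's rule for the solution of \<open>L z = w\<close>. The closed form is wanted
  because it is visibly smooth in the entries of \<open>L\<close>.\<close>

definition cramer :: "(real \<times> real \<Rightarrow> real \<times> real) \<Rightarrow> real \<times> real \<Rightarrow> real \<times> real" where
  "cramer L w = inverse (fst (L (1, 0)) * snd (L (0, 1)) - snd (L (1, 0)) * fst (L (0, 1))) *\<^sub>R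
     (fst w * snd (L (0, 1)) - snd w * fst (L (0, 1)), fst (L (1, 0)) * snd w - snd (L (1, 0)) * fst w)"

lemma det_nonzero_iff_inj:
  fixes L :: "real \<times> real \<Rightarrow> real \<times> real"
  assumes "linear L"
  shows "fst (L (1, 0)) * snd (L (0, 1)) - snd (L (1, 0)) * fst (L (0, 1)) \<noteq> (0::real) \<longleftrightarrow> inj L"
    (is "?d \<noteq> 0 \<longleftrightarrow> _")
proof
  assume d: "?d \<noteq> 0"
  have "w = 0" if "L w = 0" for w
  proof -
    have "fst w *\<^sub>R L (1, 0) + snd w *\<^sub>R L (0, 1) = 0"
      using that linear_plane_expand[OF assms] by metis
    then have e: "fst w * fst (L (1, 0)) + snd w * fst (L (0, 1)) = 0"
      "fst w * snd (L (1, 0)) + snd w * snd (L (0, 1)) = 0"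
      by (simp_all add: prod_eq_iff)
    have "fst w * ?d = 0" "snd w * ?d = 0" using e by algebra+
    then show ?thesis using d by (simp add: prod_eq_iff)
  qed
  then show "inj L" using assms linear_injective_0 by blast
next
  assume i: "inj L"
  show "?d \<noteq> 0"
  proof
    assume d: "?d = 0"
    have *: "w = 0" if "L w = 0" for w using that i assms linear_injective_0 by blast
    \<comment> \<open>Up to sign, the arguments in \<open>1\<close> and \<open>2\<close> are the
      columns of the adjugate matrix, which \<open>L\<close> kills when the determinant is zero. If
      both vanish, so does \<open>L (1, 0)\<close>.\<close>
    have 1: "L (snd (L (0, 1)), - snd (L (1, 0))) = 0"
      using d by (subst linear_plane_expand[OF assms]) (simp add: prod_eq_iff algebra_simps)
    have 2: "L (fst (L (0, 1)), - fst (L (1, 0))) = 0"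
      using d by (subst linear_plane_expand[OF assms]) (simp add: prod_eq_iff algebra_simps)
    have "L (1, 0) = 0" using *[OF 1] *[OF 2] by (simp add: prod_eq_iff)
    then show False using *[of "(1, 0)"] by (simp add: prod_eq_iff)
  qed
qed

lemma cramer_inverse:
  assumes "linear L" "inj L"
  shows "L (cramer L w) = w"
proof -
  define d where "d = fst (L (1, 0)) * snd (L (0, 1)) - snd (L (1, 0)) * fst (L (0, 1))"
  have d: "d \<noteq> 0" using det_nonzero_iff_inj[OF assms(1)] assms(2) by (simp add: d_def)
  have "L (cramer L w) = inverse d *\<^sub>R
    L (fst w * snd (L (0, 1)) - snd w * fst (L (0, 1)), fst (L (1, 0)) * snd w - snd (L (1, 0)) * fst w)"
    unfolding cramer_def d_def[symmetric] by (rule linear_scale[OF assms(1)])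
  also have "\<dots> = inverse d *\<^sub>R (d *\<^sub>R w)"
    by (subst linear_plane_expand[OF assms(1)]) (simp add: prod_eq_iff d_def algebra_simps)
  finally show ?thesis using d by simp
qed

lemma linear_Dif: "f differentiable (at x) \<Longrightarrow> linear (Dif f x)"
  by (simp add: linear_frechet_derivative)

text \<open>The inverse function theorem yields a differentiable local inverse. Its smoothness
  follows by bootstrapping: the derivative of \<open>\<Phi>\<close> is
  \<open>cramer (Dif h (\<Phi> y))\<close>, a smooth expression in \<open>\<Phi> y\<close>, so class
  C^k of \<open>\<Phi>\<close> gives class C^(k+1).\<close>

lemma inverse_of_inj_derivative:
  fixes h :: "real \<times> real \<Rightarrow> real \<times> real"
  assumes "open U" "smooth_on h U" "q0 \<in> U" "inj (Dif h q0)"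
  obtains W V \<Phi> where "open W" "q0 \<in> W" "W \<subseteq> U" "open V" "homeomorphism W V h \<Phi>" "smooth_on \<Phi> V"
    "\<And>z. z \<in> V \<Longrightarrow> inj (Dif \<Phi> z)" "\<And>q. q \<in> W \<Longrightarrow> inj (Dif h q)"
proof -
  have lin: "linear (Dif h q)" if "q \<in> U" for q
    using that assms(2) linear_Dif smooth_on_differentiable by blast
  define f' where "f' q = Blinfun (Dif h q)" for q
  have f': "blinfun_apply (f' q) = Dif h q" if "q \<in> U" for q
    using lin[OF that] by (simp add: f'_def bounded_linear_Blinfun_apply linear_conv_bounded_linear)
  \<comment> \<open>In finite dimension, continuity in the operator norm is tested on fixed vectors,
    where it is part of the smoothness of \<open>h\<close>.\<close>
  have c: "continuous_on U f'"
  proof (rule continuous_on_blinfun_componentwise)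
    fix i :: "real \<times> real"
    have "continuous_on U (\<lambda>x. Dif h x i)"
      using smooth_on_Dif[OF assms(2)] smooth_on_continuous_on by blast
    then show "continuous_on U (\<lambda>x. f' x i)" by (simp add: f' cong: continuous_on_cong)
  qed
  obtain l where l: "linear l" "l \<circ> Dif h q0 = id"
    using linear_injective_left_inverse[OF lin[OF assms(3)] assms(4)] by blast
  have bl: "blinfun_apply (Blinfun l) = l"
    using l(1) by (simp add: bounded_linear_Blinfun_apply linear_conv_bounded_linear)
  have "Blinfun l o\<^sub>L f' q0 = id_blinfun"
    using l(2) by (intro blinfun_eqI) (simp add: bl f' assms(3) pointfree_idE)
  then obtain W V \<Phi> \<Phi>' where *: "open W" "W \<subseteq> U" "q0 \<in> W" "open V" "homeomorphism W V h \<Phi>"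
    "\<And>y. y \<in> V \<Longrightarrow> (\<Phi> has_derivative (\<Phi>' y)) (at y)"
    "\<And>y. y \<in> V \<Longrightarrow> \<Phi>' y = inv (blinfun_apply (f' (\<Phi> y)))"
    "\<And>y. y \<in> V \<Longrightarrow> bij (blinfun_apply (f' (\<Phi> y)))"
    using inverse_function_theorem[of U h f' q0 "Blinfun l"] c assms f' smooth_on_has_derivative
    by metis
  have im: "\<Phi> ` V = W" using *(5) by (simp add: homeomorphism_def)
  then have PU: "\<Phi> y \<in> U" if "y \<in> V" for y using that *(2) by auto
  have bij: "bij (Dif h (\<Phi> y))" if "y \<in> V" for y using *(8)[OF that] f'[OF PU[OF that]] by simp
  have ij: "inj (Dif h q)" if "q \<in> W" for q
    using bij that im by (metis bij_def imageE)
  have der: "(\<Phi> has_derivative (\<lambda>w. cramer (Dif h (\<Phi> y)) w)) (at y)" if "y \<in> V" for y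
  proof -
    have "inv (Dif h (\<Phi> y)) = cramer (Dif h (\<Phi> y))"
    proof
      fix w show "inv (Dif h (\<Phi> y)) w = cramer (Dif h (\<Phi> y)) w"
        using cramer_inverse[OF lin[OF PU[OF that]]] bij[OF that] by (metis bij_def inv_f_f)
    qed
    then show ?thesis using *(6,7)[OF that] f'[OF PU[OF that]] by simp
  qed
  have sm: "smooth_on h W" using smooth_on_subset assms(2) *(2) by blast
  have cs: "smooth_on (\<lambda>q. cramer (Dif h q) w) W" for w
  proof -
    define d where "d q = fst (Dif h q (1, 0)) * snd (Dif h q (0, 1)) - snd (Dif h q (1, 0)) * fst (Dif h q (0, 1))" for q
    have "smooth_on d W" unfolding d_def
      by (intro smooth_on_diff smooth_on_mult smooth_on_fst smooth_on_snd smooth_on_Dif sm *(1))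
    moreover have "d q \<noteq> 0" if "q \<in> W" for q
      using det_nonzero_iff_inj[OF lin, of q] ij[OF that] that *(2) by (auto simp: d_def)
    ultimately have "smooth_on (\<lambda>q. inverse (d q)) W"
      by (intro smooth_on_compose[OF smooth_on_inverse] *(1)) auto
    then show ?thesis unfolding cramer_def d_def
      by (intro smooth_on_scaleR smooth_on_Pair smooth_on_diff smooth_on_mult smooth_on_fst smooth_on_snd
           smooth_on_Dif smooth_on_const sm *(1))
  qed
  have "Ck_on k \<Phi> V" for k
  proof (induction k)
    case 0
    then show ?case using *(5) by (simp add: homeomorphism_def)
  next
    case (Suc k)
    have "Ck_on k (\<lambda>y. cramer (Dif h (\<Phi> y)) w) V" for w
      using Ck_on_compose[OF *(4,1) _ Suc] im cs unfolding smooth_on_def by blast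
    then show ?case using Ck_on_SucI[OF *(4) der] by blast
  qed
  then have "smooth_on \<Phi> V" by (simp add: smooth_on_def)
  moreover have "inj (Dif \<Phi> z)" if "z \<in> V" for z
    using *(6,7)[OF that] bij[OF that] f'[OF PU[OF that]]
    by (metis Dif_eqI bij_imp_bij_inv bij_is_inj)
  ultimately show ?thesis using that *(1-5) ij by blast
qed

lemma open_rectangle:
  fixes V :: "(real \<times> real) set"
  assumes "open V" "(a, b) \<in> V"
  obtains I J where "open_interval I" "open_interval J" "a \<in> I" "b \<in> J" "I \<times> J \<subseteq> V"
proof -
  obtain A B where AB: "open A" "open B" "(a, b) \<in> A \<times> B" "A \<times> B \<subseteq> V"
    using open_prod_elim[OF assms] by metis
  obtain d e where "d > 0" "ball a d \<subseteq> A" "e > 0" "ball b e \<subseteq> B"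
    using AB openE by (metis SigmaE2)
  then show ?thesis using AB
    by (intro that[of "ball a d" "ball b e"]) (auto simp: open_interval_def is_interval_ball_real)
qed

section \<open>Charts\<close>

lemma chart_open: "surface_chart M f U \<psi> \<Longrightarrow> open U"
  and chart_smooth: "surface_chart M f U \<psi> \<Longrightarrow> smooth_on (f \<circ> \<psi>) U"
  and chart_inj: "surface_chart M f U \<psi> \<Longrightarrow> u \<in> U \<Longrightarrow> inj (Dif (f \<circ> \<psi>) u)"
  and chart_openin: "surface_chart M f U \<psi> \<Longrightarrow> openin (top_of_set M) (\<psi> ` U)"
  by (auto simp: surface_chart_def)

lemma chart_in: "surface_chart M f U \<psi> \<Longrightarrow> u \<in> U \<Longrightarrow> \<psi> u \<in> M"
  using openin_imp_subset[OF chart_openin[of M f U \<psi>]] by blast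

lemma chart_openin_image:
  assumes "surface_chart M f U \<psi>" "open V" "V \<subseteq> U"
  shows "openin (top_of_set M) (\<psi> ` V)"
proof -
  obtain \<psi>' where "homeomorphism U (\<psi> ` U) \<psi> \<psi>'" using assms(1) by (auto simp: surface_chart_def)
  then have "openin (top_of_set (\<psi> ` U)) (\<psi> ` V)"
    using assms by (intro homeomorphism_imp_open_map open_subset) auto
  then show ?thesis using chart_openin[OF assms(1)] openin_trans by blast
qed

lemma chart_compose:
  assumes "surface_chart M f U \<psi>" "homeomorphism V W \<Phi> \<Phi>'" "open V" "open W" "W \<subseteq> U"
    and "smooth_on \<Phi> V" "\<And>z. z \<in> V \<Longrightarrow> inj (Dif \<Phi> z)"
  shows "surface_chart M f V (\<psi> \<circ> \<Phi>)"
proof -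
  have im: "\<Phi> ` V = W" using assms(2) by (simp add: homeomorphism_def)
  then have "openin (top_of_set M) ((\<psi> \<circ> \<Phi>) ` V)"
    using chart_openin_image[OF assms(1,4,5)] by (metis image_comp)
  moreover obtain \<psi>' where "homeomorphism U (\<psi> ` U) \<psi> \<psi>'" using assms(1) by (auto simp: surface_chart_def)
  then have "homeomorphism W (\<psi> ` W) \<psi> \<psi>'" using assms(5) by (rule homeomorphism_of_subsets) auto
  then have "homeomorphism V ((\<psi> \<circ> \<Phi>) ` V) (\<psi> \<circ> \<Phi>) (\<Phi>' \<circ> \<psi>')"
    using homeomorphism_compose[OF assms(2)] im by (metis image_comp)
  moreover have "smooth_on (f \<circ> (\<psi> \<circ> \<Phi>)) V"
    using smooth_on_compose[OF chart_smooth[OF assms(1)] assms(3) chart_open[OF assms(1)] _ assms(6)] im assms(5)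
    by (simp add: comp_def)
  moreover have "inj (Dif (f \<circ> (\<psi> \<circ> \<Phi>)) z)" if "z \<in> V" for z
  proof -
    have U: "\<Phi> z \<in> U" using that im assms(5) by auto
    have "((\<lambda>z. (f \<circ> \<psi>) (\<Phi> z)) has_derivative (\<lambda>w. Dif (f \<circ> \<psi>) (\<Phi> z) (Dif \<Phi> z w))) (at z)"
      using has_derivative_compose[OF smooth_on_has_derivative[OF assms(6) that]
          smooth_on_has_derivative[OF chart_smooth[OF assms(1)] U]] .
    then have "Dif (f \<circ> (\<psi> \<circ> \<Phi>)) z = (\<lambda>w. Dif (f \<circ> \<psi>) (\<Phi> z) (Dif \<Phi> z w))"
      by (intro Dif_eqI) (simp add: comp_def)
    then show ?thesis
      using inj_compose[OF chart_inj[OF assms(1) U] assms(7)[OF that]] by (simp add: comp_def)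
  qed
  ultimately show ?thesis using assms(3) by (auto simp: surface_chart_def)
qed

lemma chart_subset:
  assumes "surface_chart M f U \<psi>" "open V" "V \<subseteq> U"
  shows "surface_chart M f V \<psi>"
proof -
  have "Dif (\<lambda>x::real \<times> real. x) z = (\<lambda>w. w)" for z by (rule Dif_eqI) simp
  then have "surface_chart M f V (\<psi> \<circ> (\<lambda>x. x))"
    using assms by (intro chart_compose[OF assms(1) homeomorphism_ident]) (auto intro: smooth_on_id)
  then show ?thesis by (simp add: comp_def)
qed

text \<open>Invertibility of the derivative at the single point \<open>q0\<close> suffices, since
  the chart may be shrunk around it.\<close>

lemma chart_reparametrize:
  assumes "surface_chart M f U \<psi>" "open V" "smooth_on \<Phi> V" "q0 \<in> V" "\<Phi> q0 \<in> U" "inj (Dif \<Phi> q0)"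
  obtains V' where "open V'" "q0 \<in> V'" "V' \<subseteq> V" "\<Phi> ` V' \<subseteq> U" "surface_chart M f V' (\<psi> \<circ> \<Phi>)"
proof -
  have o: "open (V \<inter> \<Phi> -` U)"
    using continuous_open_preimage[OF smooth_on_continuous_on[OF assms(3)] assms(2) chart_open[OF assms(1)]] .
  obtain V' W \<Phi>' where *: "open V'" "q0 \<in> V'" "V' \<subseteq> V \<inter> \<Phi> -` U" "open W" "homeomorphism V' W \<Phi> \<Phi>'"
    "\<And>q. q \<in> V' \<Longrightarrow> inj (Dif \<Phi> q)"
    using inverse_of_inj_derivative[OF o smooth_on_subset[OF assms(3)], of q0] assms(4-6)
    by (metis IntI Int_lower1 vimageI)
  have sub: "\<Phi> ` V' \<subseteq> U" using *(3) by auto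
  have "W = \<Phi> ` V'" using *(5) by (simp add: homeomorphism_def)
  then have "surface_chart M f V' (\<psi> \<circ> \<Phi>)"
    using chart_compose[OF assms(1) *(5,1,4)] smooth_on_subset[OF assms(3)] * sub by blast
  then show ?thesis using that[of V'] * sub by blast
qed

text \<open>The transition \<open>\<tau>\<close> is at first only continuous. Let
  \<open>\<pi>\<close> be a left inverse of the derivative of \<open>f \<circ> \<phi>\<close> at
  \<open>v\<close>. Then \<open>k = \<pi> \<circ> f \<circ> \<phi>\<close> has derivative
  \<open>id\<close> at \<open>v\<close> and a smooth local inverse \<open>\<theta>\<close>, so near
  \<open>u\<close> the transition is \<open>\<theta> \<circ> \<pi> \<circ> f \<circ> \<psi>\<close>,
  which is differentiable.\<close>

lemma chart_transition:
  assumes "surface_chart M f U \<psi>" "surface_chart M f V \<phi>" "u \<in> U" "v \<in> V" "\<psi> u = \<phi> v"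
  obtains \<tau> L B where "(\<tau> has_derivative L) (at u)" "\<tau> u = v" "open B" "u \<in> B" "B \<subseteq> U"
    "\<And>q. q \<in> B \<Longrightarrow> \<tau> q \<in> V \<and> \<phi> (\<tau> q) = \<psi> q"
proof -
  obtain \<phi>' where hom: "homeomorphism V (\<phi> ` V) \<phi> \<phi>'" using assms(2) by (auto simp: surface_chart_def)
  have c\<psi>: "continuous_on U \<psi>" using assms(1) by (auto simp: surface_chart_def homeomorphism_def)
  define A where "A = U \<inter> \<psi> -` (\<phi> ` V)"
  have "openin (top_of_set U) A" unfolding A_def
    using chart_in[OF assms(1)] by (intro continuous_openin_preimage[OF c\<psi> _ chart_openin[OF assms(2)]]) auto
  then have oA: "open A" using chart_open[OF assms(1)] openin_open_trans by blast
  define \<tau> where "\<tau> = \<phi>' \<circ> \<psi>"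
  have c\<tau>: "continuous_on A \<tau>" unfolding \<tau>_def
  proof (rule continuous_on_compose)
    show "continuous_on A \<psi>" using c\<psi> continuous_on_subset A_def by blast
    show "continuous_on (\<psi> ` A) \<phi>'"
      using hom continuous_on_subset[of "\<phi> ` V" \<phi>' "\<psi> ` A"] by (auto simp: A_def homeomorphism_def)
  qed
  have \<tau>V: "\<tau> q \<in> V \<and> \<phi> (\<tau> q) = \<psi> q" if "q \<in> A" for q
    using that hom by (auto simp: A_def \<tau>_def homeomorphism_def)
  have uA: "u \<in> A" using assms by (auto simp: A_def)
  have \<tau>u: "\<tau> u = v" using hom assms by (auto simp: \<tau>_def homeomorphism_def)
  have lin: "linear (Dif (f \<circ> \<phi>) v)"
    using linear_Dif[OF smooth_on_differentiable[OF chart_smooth[OF assms(2)] assms(4)]] .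
  obtain \<pi> where \<pi>: "linear \<pi>" "\<pi> \<circ> Dif (f \<circ> \<phi>) v = id"
    using linear_injective_left_inverse[OF lin chart_inj[OF assms(2,4)]] by blast
  have b\<pi>: "bounded_linear \<pi>" using \<pi>(1) by (simp add: linear_conv_bounded_linear)
  define k where "k = (\<lambda>z. \<pi> ((f \<circ> \<phi>) z))"
  have sk: "smooth_on k V" unfolding k_def
    by (intro smooth_on_linear[OF b\<pi>] chart_open[OF assms(2)] chart_smooth[OF assms(2)])
  have "(k has_derivative (\<lambda>w. \<pi> (Dif (f \<circ> \<phi>) v w))) (at v)" unfolding k_def
    by (intro bounded_linear.has_derivative[OF b\<pi>] smooth_on_has_derivative[OF chart_smooth[OF assms(2)] assms(4)])
  then have "Dif k v = id" using Dif_eqI \<pi>(2) by (auto simp: comp_def)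
  then obtain W K \<theta> where W: "open W" "v \<in> W" "W \<subseteq> V" "open K" "homeomorphism W K k \<theta>" "smooth_on \<theta> K"
    using inverse_of_inj_derivative[OF chart_open[OF assms(2)] sk assms(4)] by (metis inj_on_id)
  \<comment> \<open>\<open>\<theta>\<close> inverts \<open>k\<close> on \<open>W\<close>; the
    continuity of \<open>\<tau>\<close>, known from the homeomorphisms, keeps \<open>\<tau>\<close>
    in \<open>W\<close> near \<open>u\<close>.\<close>
  define B where "B = A \<inter> \<tau> -` W"
  have oB: "open B" unfolding B_def using continuous_open_preimage[OF c\<tau> oA W(1)] .
  have uB: "u \<in> B" using uA \<tau>u W(2) by (auto simp: B_def)
  have eq: "\<theta> (\<pi> ((f \<circ> \<psi>) q)) = \<tau> q" if "q \<in> B" for q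
    using that \<tau>V[of q] W(5) by (auto simp: B_def k_def homeomorphism_def comp_def)
  have fu: "(f \<circ> \<psi>) u = (f \<circ> \<phi>) v" using assms(5) by simp
  have K: "\<pi> ((f \<circ> \<psi>) u) \<in> K" unfolding fu using W(2,5) by (auto simp: homeomorphism_def k_def)
  have "((\<lambda>q. \<theta> (\<pi> ((f \<circ> \<psi>) q))) has_derivative (\<lambda>w. Dif \<theta> (\<pi> ((f \<circ> \<psi>) u)) (\<pi> (Dif (f \<circ> \<psi>) u w)))) (at u)"
    by (rule has_derivative_compose[OF bounded_linear.has_derivative[OF b\<pi>
          smooth_on_has_derivative[OF chart_smooth[OF assms(1)] assms(3)]] smooth_on_has_derivative[OF W(6) K]])
  then have "(\<tau> has_derivative (\<lambda>w. Dif \<theta> (\<pi> ((f \<circ> \<psi>) u)) (\<pi> (Dif (f \<circ> \<psi>) u w)))) (at u)"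
    by (rule has_derivative_transform_open[OF _ oB uB eq])
  then show ?thesis using that[of \<tau> _ B] \<tau>u oB uB \<tau>V by (auto simp: B_def A_def)
qed

lemma Dif_transition:
  assumes "open B" "u \<in> B" "\<And>q. q \<in> B \<Longrightarrow> \<phi> (\<tau> q) = \<psi> q" "(\<tau> has_derivative L) (at u)"
    and "(g \<circ> \<phi>) differentiable (at (\<tau> u))"
  shows "Dif (g \<circ> \<psi>) u w = Dif (g \<circ> \<phi>) (\<tau> u) (L w)"
proof -
  have "((\<lambda>q. (g \<circ> \<phi>) (\<tau> q)) has_derivative (\<lambda>w. Dif (g \<circ> \<phi>) (\<tau> u) (L w))) (at u)"
    by (rule has_derivative_compose[OF assms(4) Dif_works[OF assms(5)]])
  then have "((g \<circ> \<psi>) has_derivative (\<lambda>w. Dif (g \<circ> \<phi>) (\<tau> u) (L w))) (at u)"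
    by (rule has_derivative_transform_open[OF _ assms(1,2)]) (simp add: assms(3))
  then show ?thesis by (simp add: Dif_eqI)
qed

section \<open>Tangent plane, differentials and principal directions in one chart\<close>

lemma tangent_plane_chart:
  assumes "surface_chart M f U \<psi>" "u \<in> U"
  shows "tangent_plane M f (\<psi> u) = range (Dif (f \<circ> \<psi>) u)"
proof
  show "range (Dif (f \<circ> \<psi>) u) \<subseteq> tangent_plane M f (\<psi> u)"
    using assms unfolding tangent_plane_def by blast
  show "tangent_plane M f (\<psi> u) \<subseteq> range (Dif (f \<circ> \<psi>) u)"
  proof
    fix X assume "X \<in> tangent_plane M f (\<psi> u)"
    then obtain V \<phi> v w where V: "surface_chart M f V \<phi>" "v \<in> V" "\<phi> v = \<psi> u" "X = Dif (f \<circ> \<phi>) v w"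
      by (auto simp: tangent_plane_def)
    obtain \<tau> L B where t: "(\<tau> has_derivative L) (at v)" "\<tau> v = u" "open B" "v \<in> B"
      "\<And>q. q \<in> B \<Longrightarrow> \<tau> q \<in> U \<and> \<psi> (\<tau> q) = \<phi> q"
      using chart_transition[OF V(1) assms(1) V(2) assms(2) V(3)] by metis
    have "X = Dif (f \<circ> \<psi>) u (L w)" unfolding V(4)
      using Dif_transition[OF t(3,4) _ t(1), of \<psi> \<phi> f w] t(2,5)
        smooth_on_differentiable[OF chart_smooth[OF assms(1)] assms(2)] by auto
    then show "X \<in> range (Dif (f \<circ> \<psi>) u)" by simp
  qed
qed

text \<open>The definite description ranges over all charts. It is well defined because a second
  chart turns \<open>w\<close> into \<open>L w\<close>, and injectivity of the differential of
  \<open>f\<close> in that chart forces \<open>L w = w'\<close>.\<close>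

lemma surface_differential_chart:
  assumes "surface_chart M f U \<psi>" "u \<in> U" "(g \<circ> \<psi>) differentiable (at u)"
  shows "surface_differential M f g (\<psi> u) (Dif (f \<circ> \<psi>) u w) = Dif (g \<circ> \<psi>) u w"
  unfolding surface_differential_def
proof (rule the_equality)
  show "\<exists>U' \<psi>' u' w'. surface_chart M f U' \<psi>' \<and> u' \<in> U' \<and> \<psi>' u' = \<psi> u \<and> (g \<circ> \<psi>') differentiable at u' \<and>
      Dif (f \<circ> \<psi>) u w = Dif (f \<circ> \<psi>') u' w' \<and> Dif (g \<circ> \<psi>) u w = Dif (g \<circ> \<psi>') u' w'"
    using assms by blast
next
  fix Y
  assume "\<exists>U' \<psi>' u' w'. surface_chart M f U' \<psi>' \<and> u' \<in> U' \<and> \<psi>' u' = \<psi> u \<and> (g \<circ> \<psi>') differentiable at u' \<and>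
      Dif (f \<circ> \<psi>) u w = Dif (f \<circ> \<psi>') u' w' \<and> Y = Dif (g \<circ> \<psi>') u' w'"
  then obtain V \<phi> v w' where V: "surface_chart M f V \<phi>" "v \<in> V" "\<phi> v = \<psi> u" "(g \<circ> \<phi>) differentiable at v"
    "Dif (f \<circ> \<psi>) u w = Dif (f \<circ> \<phi>) v w'" "Y = Dif (g \<circ> \<phi>) v w'" by blast
  obtain \<tau> L B where t: "(\<tau> has_derivative L) (at u)" "\<tau> u = v" "open B" "u \<in> B"
    "\<And>q. q \<in> B \<Longrightarrow> \<tau> q \<in> V \<and> \<phi> (\<tau> q) = \<psi> q"
    using chart_transition[OF assms(1) V(1) assms(2) V(2) V(3)[symmetric]] by metis
  have "Dif (f \<circ> \<psi>) u w = Dif (f \<circ> \<phi>) v (L w)"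
    using Dif_transition[OF t(3,4) _ t(1), of \<phi> \<psi> f w] t(2,5)
      smooth_on_differentiable[OF chart_smooth[OF V(1)] V(2)] by auto
  then have "L w = w'" using V(5) chart_inj[OF V(1,2)] by (metis injD)
  moreover have "Dif (g \<circ> \<psi>) u w = Dif (g \<circ> \<phi>) v (L w)"
    using Dif_transition[OF t(3,4) _ t(1), of \<phi> \<psi> g w] t(2,5) V(4) by auto
  ultimately show "Y = Dif (g \<circ> \<psi>) u w" using V(6) by simp
qed

lemma principal_direction_chart:
  assumes "surface_chart M f U \<psi>" "u \<in> U" "(N \<circ> \<psi>) differentiable (at u)"
  shows "principal_direction M f N (\<psi> u) \<kappa> X \<longleftrightarrow>
    (\<exists>w. w \<noteq> 0 \<and> X = Dif (f \<circ> \<psi>) u w \<and> - Dif (N \<circ> \<psi>) u w = \<kappa> *\<^sub>R X)"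
proof -
  have lin: "linear (Dif (f \<circ> \<psi>) u)"
    using linear_Dif[OF smooth_on_differentiable[OF chart_smooth[OF assms(1)] assms(2)]] .
  have nz: "Dif (f \<circ> \<psi>) u w \<noteq> 0 \<longleftrightarrow> w \<noteq> 0" for w
    using chart_inj[OF assms(1,2)] lin linear_0 linear_injective_0 by metis
  show ?thesis
    unfolding principal_direction_def tangent_plane_chart[OF assms(1,2)] shape_operator_def image_iff
  proof (intro iffI)
    assume *: "(\<exists>x\<in>UNIV. X = Dif (f \<circ> \<psi>) u x) \<and> X \<noteq> 0 \<and> - surface_differential M f N (\<psi> u) X = \<kappa> *\<^sub>R X"
    then obtain w where "X = Dif (f \<circ> \<psi>) u w" by blast
    with * show "\<exists>w. w \<noteq> 0 \<and> X = Dif (f \<circ> \<psi>) u w \<and> - Dif (N \<circ> \<psi>) u w = \<kappa> *\<^sub>R X"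
      using nz[of w] surface_differential_chart[OF assms, of w] by (intro exI[of _ w]) simp
  next
    assume "\<exists>w. w \<noteq> 0 \<and> X = Dif (f \<circ> \<psi>) u w \<and> - Dif (N \<circ> \<psi>) u w = \<kappa> *\<^sub>R X"
    then obtain w where "w \<noteq> 0" "X = Dif (f \<circ> \<psi>) u w" "- Dif (N \<circ> \<psi>) u w = \<kappa> *\<^sub>R X" by blast
    moreover from this have "\<exists>x\<in>UNIV. X = Dif (f \<circ> \<psi>) u x" by blast
    ultimately show "(\<exists>x\<in>UNIV. X = Dif (f \<circ> \<psi>) u x) \<and> X \<noteq> 0 \<and> - surface_differential M f N (\<psi> u) X = \<kappa> *\<^sub>R X"
      using nz[of w] surface_differential_chart[OF assms, of w] by simp
  qed
qed

lemma principal_curvature_chart: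
  assumes "surface_chart M f U \<psi>" "u \<in> U" "(N \<circ> \<psi>) differentiable (at u)"
  shows "principal_curvature M f N (\<psi> u) \<kappa> \<longleftrightarrow>
    (\<exists>w. w \<noteq> 0 \<and> - Dif (N \<circ> \<psi>) u w = \<kappa> *\<^sub>R Dif (f \<circ> \<psi>) u w)"
  unfolding principal_curvature_def principal_direction_chart[OF assms] by blast

lemma chart_Dif_nonzero:
  assumes "surface_chart M f U \<psi>" "u \<in> U" "w \<noteq> 0"
  shows "Dif (f \<circ> \<psi>) u w \<noteq> 0"
  using chart_inj[OF assms(1,2)] assms(3)
    linear_injective_0[OF linear_Dif[OF smooth_on_differentiable[OF chart_smooth[OF assms(1)] assms(2)]]]
  by blast

section \<open>Pseudo-Euclidean linear algebra\<close>

lemma bounded_bilinear_pinner: "bounded_bilinear (pinner p)"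
proof -
  have "bilinear (pinner p)"
    unfolding bilinear_def by (auto intro!: linearI simp: pinner_def algebra_simps)
  then show ?thesis by (simp add: bilinear_conv_bounded_bilinear)
qed

interpretation pinner: bounded_bilinear "pinner p" for p
  by (rule bounded_bilinear_pinner)

lemmas pinner_simps = pinner.add_left pinner.add_right pinner.diff_left pinner.diff_right
  pinner.scaleR_left pinner.scaleR_right pinner.minus_left pinner.minus_right

lemmas smooth_on_pinner = smooth_on_bilinear[OF bounded_bilinear_pinner]

lemma pinner_commute: "pinner p x y = pinner p y x"
  by (simp add: pinner_def mult.commute mult.assoc)

lemma pinner_nondegenerate:
  assumes "\<And>X. pinner p V X = 0"
  shows "V = 0"
proof -
  have "V $ i = 0" for i
    using assms[of "axis 1 1"] assms[of "axis 2 1"] assms[of "axis 3 1"] assms[of "axis 4 1"] exhaust_4[of i]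
    by (auto simp: pinner_def axis_def split: if_splits)
  then show ?thesis by (simp add: vec_eq_iff)
qed

lemma pinner_axis_4: "pinner p (axis 4 1) X = X $ 4" "pinner p X (axis 4 1) = X $ 4"
  by (simp_all add: pinner_def axis_def)

text \<open>An injective endomorphism of \<open>R^4\<close> is surjective; here it sends the
  coordinates of \<open>x\<close> to a combination of the four vectors.\<close>

lemma spanning_of_independent:
  fixes V1 V2 V3 V4 X :: "real^4"
  assumes "\<And>a b c d. a *\<^sub>R V1 + b *\<^sub>R V2 + c *\<^sub>R V3 + d *\<^sub>R V4 = 0 \<Longrightarrow> a = 0 \<and> b = 0 \<and> c = 0 \<and> d = 0"
  obtains a b c d where "X = a *\<^sub>R V1 + b *\<^sub>R V2 + c *\<^sub>R V3 + d *\<^sub>R V4"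
proof -
  define L where "L x = x$1 *\<^sub>R V1 + x$2 *\<^sub>R V2 + x$3 *\<^sub>R V3 + x$4 *\<^sub>R V4" for x :: "real^4"
  have lin: "linear L" unfolding L_def by (auto intro!: linearI simp: algebra_simps)
  have "inj L"
    unfolding linear_injective_0[OF lin]
  proof (intro allI impI)
    fix x assume "L x = 0"
    then show "x = 0" using assms[of "x$1" "x$2" "x$3" "x$4"] by (simp add: L_def vec_eq_iff forall_4)
  qed
  then have "surj L" using lin linear_injective_imp_surjective by blast
  then obtain x where "X = L x" by (metis surjD)
  then show ?thesis using that unfolding L_def by blast
qed

text \<open>If \<open>V3\<close> were null, it would be orthogonal to all four vectors. These form a
  basis: pairing a linear relation with \<open>V1\<close> and \<open>V2\<close> removes the first
  two coefficients, and \<open>ind\<close> the others. So \<open>V3\<close> would lie in the radical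
  of the metric, which is zero.\<close>

lemma nonnull_of_orthogonal_independent:
  assumes nn: "pnorm2 p V1 \<noteq> 0" "pnorm2 p V2 \<noteq> 0"
    and o: "pinner p V1 V2 = 0" "pinner p V1 V3 = 0" "pinner p V1 V4 = 0" "pinner p V2 V3 = 0"
      "pinner p V2 V4 = 0" "pinner p V3 V4 = 0"
    and ind: "\<And>a b. a *\<^sub>R V3 + b *\<^sub>R V4 = 0 \<Longrightarrow> a = 0 \<and> b = 0"
  shows "pnorm2 p V3 \<noteq> 0"
proof
  assume n: "pnorm2 p V3 = 0"
  have "a = 0 \<and> b = 0 \<and> c = 0 \<and> d = 0" if e: "a *\<^sub>R V1 + b *\<^sub>R V2 + c *\<^sub>R V3 + d *\<^sub>R V4 = 0" for a b c d
  proof -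
    have "pinner p V1 (a *\<^sub>R V1 + b *\<^sub>R V2 + c *\<^sub>R V3 + d *\<^sub>R V4) = 0"
      "pinner p V2 (a *\<^sub>R V1 + b *\<^sub>R V2 + c *\<^sub>R V3 + d *\<^sub>R V4) = 0"
      unfolding e by (simp_all add: pinner.zero_right)
    then have "a = 0" "b = 0" using nn o pinner_commute[of p V2 V1] by (simp_all add: pinner_simps)
    then show ?thesis using ind[of c d] e by simp
  qed
  note sp = spanning_of_independent[OF this]
  have "pinner p V3 X = 0" for X
  proof -
    obtain a b c d where "X = a *\<^sub>R V1 + b *\<^sub>R V2 + c *\<^sub>R V3 + d *\<^sub>R V4" using sp .
    then show ?thesis using n o pinner_commute[of p V3 V1] pinner_commute[of p V3 V2] by (simp add: pinner_simps)
  qed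
  then have "V3 = 0" by (rule pinner_nondegenerate)
  then show False using ind[of 1 0] by simp
qed

lemma orthogonal_expansion:
  assumes nn: "pnorm2 p V1 \<noteq> 0" "pnorm2 p V2 \<noteq> 0" "pnorm2 p V3 \<noteq> 0" "pnorm2 p V4 \<noteq> 0"
    and o: "pinner p V1 V2 = 0" "pinner p V1 V3 = 0" "pinner p V1 V4 = 0" "pinner p V2 V3 = 0"
      "pinner p V2 V4 = 0" "pinner p V3 V4 = 0"
  shows "X = (pinner p X V1 / pnorm2 p V1) *\<^sub>R V1 + (pinner p X V2 / pnorm2 p V2) *\<^sub>R V2 +
    (pinner p X V3 / pnorm2 p V3) *\<^sub>R V3 + (pinner p X V4 / pnorm2 p V4) *\<^sub>R V4"
proof -
  have "a = 0 \<and> b = 0 \<and> c = 0 \<and> d = 0" if e: "a *\<^sub>R V1 + b *\<^sub>R V2 + c *\<^sub>R V3 + d *\<^sub>R V4 = 0" for a b c d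
  proof -
    have "pinner p V (a *\<^sub>R V1 + b *\<^sub>R V2 + c *\<^sub>R V3 + d *\<^sub>R V4) = 0" for V
      unfolding e by (simp add: pinner.zero_right)
    from this[of V1] this[of V2] this[of V3] this[of V4] show ?thesis
      using nn o pinner_commute[of p V2 V1] pinner_commute[of p V3 V1] pinner_commute[of p V4 V1]
        pinner_commute[of p V3 V2] pinner_commute[of p V4 V2] pinner_commute[of p V4 V3]
      by (simp add: pinner_simps)
  qed
  from spanning_of_independent[OF this] obtain a b c d
    where X: "X = a *\<^sub>R V1 + b *\<^sub>R V2 + c *\<^sub>R V3 + d *\<^sub>R V4" .
  show ?thesis
    using nn o pinner_commute[of p V2 V1] pinner_commute[of p V3 V1] pinner_commute[of p V4 V1]
      pinner_commute[of p V3 V2] pinner_commute[of p V4 V2] pinner_commute[of p V4 V3]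
    unfolding X by (simp add: pinner_simps)
qed

lemma span_pair: "(X::'a::real_vector) \<in> span {a, b} \<longleftrightarrow> (\<exists>s t. X = s *\<^sub>R a + t *\<^sub>R b)"
proof -
  have "X \<in> span {a, b} \<longleftrightarrow> (\<exists>s t. X - s *\<^sub>R a = t *\<^sub>R b)" by (simp add: span_breakdown_eq)
  also have "\<dots> \<longleftrightarrow> (\<exists>s t. X = s *\<^sub>R a + t *\<^sub>R b)" by (metis add_diff_cancel_left' diff_add_cancel add.commute)
  finally show ?thesis .
qed

text \<open>For \<open>\<eta> = 0\<close> the constant vector \<open>(0, 0, 0, 1)\<close> plays the role of the position vector.\<close>

definition Q3_normal :: "real \<Rightarrow> real^4 \<Rightarrow> real^4" where
  "Q3_normal \<eta> x = (if \<eta> = 0 then axis 4 1 else x)"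

lemma tangent_Q3_iff: "X \<in> tangent_Q3 p \<eta> x \<longleftrightarrow> pinner p (Q3_normal \<eta> x) X = 0"
  by (simp add: tangent_Q3_def Q3_normal_def pinner_axis_4)

lemma pnorm2_Q3_normal: "x \<in> Q3 p \<eta> \<Longrightarrow> pnorm2 p (Q3_normal \<eta> x) = (if \<eta> = 0 then 1 else \<eta>)"
  by (simp add: Q3_def Q3_normal_def pinner_axis_4)

text \<open>The normal of the space form, \<open>T\<close>, \<open>a\<close> and \<open>b\<close>
  form an orthogonal basis of \<open>R^4\<close>. The velocity enters as a multiple of
  \<open>T\<close> because the lemma is applied to several curves whose velocities are all
  proportional to that of the focal curve.\<close>

lemma curve_normal_space_eq_span:
  assumes "\<gamma> u \<in> Q3 p \<eta>" "pnorm2 p T \<noteq> 0" "pnorm2 p a \<noteq> 0" "pnorm2 p b \<noteq> 0" "pinner p a b = 0"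
    and "pinner p (Q3_normal \<eta> (\<gamma> u)) T = 0" "pinner p (Q3_normal \<eta> (\<gamma> u)) a = 0"
      "pinner p (Q3_normal \<eta> (\<gamma> u)) b = 0" "pinner p T a = 0" "pinner p T b = 0"
    and "vector_derivative \<gamma> (at u) = c *\<^sub>R T" "c \<noteq> 0"
  shows "curve_normal_space p \<eta> \<gamma> u = span {a, b}"
proof -
  have n: "pnorm2 p (Q3_normal \<eta> (\<gamma> u)) \<noteq> 0" using pnorm2_Q3_normal[OF assms(1)] by simp
  have "X \<in> curve_normal_space p \<eta> \<gamma> u \<longleftrightarrow> X \<in> span {a, b}" for X
  proof
    assume "X \<in> curve_normal_space p \<eta> \<gamma> u"
    then have "pinner p X (Q3_normal \<eta> (\<gamma> u)) = 0" "pinner p X T = 0"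
      using assms(11,12) pinner_commute[of p X]
      by (auto simp: curve_normal_space_def tangent_Q3_iff pinner_simps)
    with orthogonal_expansion[OF n assms(2-4) assms(6-10,5), of X]
    have "X = (pinner p X a / pnorm2 p a) *\<^sub>R a + (pinner p X b / pnorm2 p b) *\<^sub>R b" by simp
    then show "X \<in> span {a, b}" unfolding span_pair by blast
  next
    assume "X \<in> span {a, b}"
    then obtain s t where "X = s *\<^sub>R a + t *\<^sub>R b" unfolding span_pair by blast
    then show "X \<in> curve_normal_space p \<eta> \<gamma> u"
      using assms(7-11) pinner_commute[of p _ T]
      by (simp add: curve_normal_space_def tangent_Q3_iff pinner_simps)
  qed
  then show ?thesis by blast
qed

lemma pnorm2_orthogonal_combination:
  "pinner p a b = 0 \<Longrightarrow> pnorm2 p (s *\<^sub>R a + t *\<^sub>R b) = s\<^sup>2 * pnorm2 p a + t\<^sup>2 * pnorm2 p b"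
  by (simp add: pinner_simps pinner_commute[of p b a] power2_eq_square)

lemma definite_metric_span:
  assumes "pinner p a b = 0" "pnorm2 p a = s" "pnorm2 p b = s" "s = 1 \<or> s = - 1"
  shows "definite_metric p (span {a, b})"
proof -
  have *: "\<exists>c>0. pnorm2 p X = c * s" if in_span: "X \<in> span {a, b}" "X \<noteq> 0" for X
  proof -
    obtain x y where X: "X = x *\<^sub>R a + y *\<^sub>R b" using in_span(1) unfolding span_pair by blast
    with in_span(2) have "x \<noteq> 0 \<or> y \<noteq> 0" by auto
    then have "x\<^sup>2 + y\<^sup>2 > 0" by (simp add: sum_power2_gt_zero_iff)
    moreover have "pnorm2 p X = (x\<^sup>2 + y\<^sup>2) * s"
      unfolding X pnorm2_orthogonal_combination[OF assms(1)] assms by (simp add: algebra_simps)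
    ultimately show ?thesis by blast
  qed
  show ?thesis using assms(4)
  proof
    assume "s = 1" then show ?thesis using * by (fastforce simp: definite_metric_def spacelike_def)
  next
    assume "s = - 1" then show ?thesis using * by (fastforce simp: definite_metric_def timelike_def)
  qed
qed

section \<open>Elliptic tubes\<close>

lemma pinner_has_real_derivative:
  assumes "(f has_vector_derivative f') (at t within S)" "(g has_vector_derivative g') (at t within S)"
  shows "((\<lambda>t. pinner p (f t) (g t)) has_real_derivative (pinner p (f t) g' + pinner p f' (g t))) (at t within S)"
  using bounded_bilinear.has_vector_derivative[OF bounded_bilinear_pinner assms]
  by (simp add: has_real_derivative_iff_has_vector_derivative)

text \<open>At the end points of the segment the derivative is one-sided; it is still unique because
  \<open>0 < d\<close>.\<close>

lemma has_vector_derivative_const_eq: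
  assumes "(f has_vector_derivative f') (at t within {0..d})" "\<forall>t\<in>{0..d}. f t = c" "t \<in> {0..d}" "0 < d"
  shows "f' = 0"
proof -
  have "((\<lambda>t. c) has_vector_derivative f') (at t within {0..d})"
    using assms(1-3) has_vector_derivative_transform by metis
  then show ?thesis
    using vector_derivative_unique_within_closed_interval[of 0 d t "\<lambda>t. c" f' 0] assms(3,4) by simp
qed

text \<open>\<open>unit_geodesic\<close> prescribes the absolute value of the square norm of the
  velocity. A continuous function on an interval with values in \<open>{-1, 1}\<close> is constant,
  so the causal character cannot change.\<close>

lemma geodesic_norm:
  assumes "\<forall>t\<in>{0..d}. (c' has_vector_derivative c'' t) (at t within {0..d})"
    "\<forall>t\<in>{0..d}. \<bar>pnorm2 p (c' t)\<bar> = 1" "t \<in> {0..d}"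
  shows "pnorm2 p (c' t) = pnorm2 p (c' 0)"
proof -
  have "continuous_on {0..d} c'"
    using assms(1) by (auto simp: continuous_on_eq_continuous_within intro: has_vector_derivative_continuous)
  then have "continuous_on {0..d} (\<lambda>t. pnorm2 p (c' t))" by (intro pinner.continuous_on)
  then have "connected ((\<lambda>t. pnorm2 p (c' t)) ` {0..d})" by (intro connected_continuous_image) auto
  moreover have "pnorm2 p (c' t) \<in> (\<lambda>t. pnorm2 p (c' t)) ` {0..d}" "pnorm2 p (c' 0) \<in> (\<lambda>t. pnorm2 p (c' t)) ` {0..d}"
    "0 \<notin> (\<lambda>t. pnorm2 p (c' t)) ` {0..d}"
    using assms by auto
  ultimately have "\<not> (pnorm2 p (c' t) < 0 \<and> pnorm2 p (c' 0) > 0)" "\<not> (pnorm2 p (c' t) > 0 \<and> pnorm2 p (c' 0) < 0)"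
    by (meson connectedD_interval less_imp_le)+
  moreover have "\<bar>pnorm2 p (c' t)\<bar> = 1" "\<bar>pnorm2 p (c' 0)\<bar> = 1" using assms by auto
  ultimately show ?thesis by linarith
qed

text \<open>The acceleration is orthogonal to the tangent space, hence a multiple of the normal
  \<open>\<nu>\<close> of the space form. In the curved case the coefficient comes from
  differentiating \<open>pinner p (c t) (c' t) = 0\<close>; in the flat case the fourth coordinate
  of \<open>c\<close> is constant and the acceleration vanishes.\<close>

lemma geodesic_equation:
  assumes "0 < d" "\<eta> \<in> {-1, 0, 1}" "t \<in> {0..d}"
    "\<forall>t\<in>{0..d}. c t \<in> Q3 p \<eta> \<and>
           (c has_vector_derivative c' t) (at t within {0..d}) \<and>
           (c' has_vector_derivative c'' t) (at t within {0..d}) \<and>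
           pnorm2 p (c' t) = s \<and> (\<forall>X\<in>tangent_Q3 p \<eta> (c t). pinner p (c'' t) X = 0)"
  shows "c'' t = - (\<eta> * s) *\<^sub>R c t"
proof -
  have tan: "pinner p (c'' t) X = 0" if "X \<in> tangent_Q3 p \<eta> (c t)" for X using assms(3,4) that by blast
  define \<nu> where "\<nu> = Q3_normal \<eta> (c t)"
  have \<nu>: "pnorm2 p \<nu> \<noteq> 0" using pnorm2_Q3_normal assms(3,4) by (auto simp: \<nu>_def)
  have n: "c'' t = (pinner p (c'' t) \<nu> / pnorm2 p \<nu>) *\<^sub>R \<nu>"
  proof -
    have "pinner p (c'' t - (pinner p (c'' t) \<nu> / pnorm2 p \<nu>) *\<^sub>R \<nu>) X = 0" for X
    proof -
      \<comment> \<open>Every \<open>X\<close> is a tangent vector plus a multiple of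
        \<open>\<nu>\<close>, so the part of \<open>c'' t\<close> orthogonal to \<open>\<nu>\<close>
        pairs to zero with everything.\<close>
      have "X - (pinner p X \<nu> / pnorm2 p \<nu>) *\<^sub>R \<nu> \<in> tangent_Q3 p \<eta> (c t)"
        using \<nu> by (simp add: tangent_Q3_iff \<nu>_def[symmetric] pinner_simps pinner_commute[of p \<nu> X])
      from tan[OF this] show ?thesis
        by (simp add: pinner_simps pinner_commute[of p \<nu> X] algebra_simps)
    qed
    then have "c'' t - (pinner p (c'' t) \<nu> / pnorm2 p \<nu>) *\<^sub>R \<nu> = 0" by (rule pinner_nondegenerate)
    then show ?thesis by simp
  qed
  show ?thesis
  proof (cases "\<eta> = 0")
    case True
    have l: "bounded_linear (\<lambda>x::real^4. x $ 4)" by (rule bounded_linear_vec_nth)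
    have 1: "c' t $ 4 = 0" if "t \<in> {0..d}" for t
      using assms(4) True that bounded_linear.has_vector_derivative[OF l] assms(1)
      by (intro has_vector_derivative_const_eq[of "\<lambda>t. c t $ 4" _ t d 0]) (auto simp: Q3_def)
    have "c'' t $ 4 = 0"
      using assms(3,4) 1 bounded_linear.has_vector_derivative[OF l] assms(1)
      by (intro has_vector_derivative_const_eq[of "\<lambda>t. c' t $ 4" _ t d 0]) auto
    then have "pinner p (c'' t) \<nu> = 0" using True by (simp add: \<nu>_def Q3_normal_def pinner_axis_4)
    then show ?thesis using n True by simp
  next
    case False
    have cc: "pinner p (c t) (c' t) = 0" if "t \<in> {0..d}" for t
    proof -
      have "((\<lambda>t. pnorm2 p (c t)) has_vector_derivative 2 * pinner p (c t) (c' t)) (at t within {0..d})"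
        using pinner_has_real_derivative[of c "c' t" t "{0..d}" c "c' t" p] assms(4) that
        by (simp add: has_real_derivative_iff_has_vector_derivative pinner_commute[of p "c' t"])
      then have "2 * pinner p (c t) (c' t) = 0"
        using assms(1,4) False that by (intro has_vector_derivative_const_eq[of _ _ t d \<eta>]) (auto simp: Q3_def)
      then show ?thesis by simp
    qed
    have "((\<lambda>t. pinner p (c t) (c' t)) has_vector_derivative (pinner p (c t) (c'' t) + pinner p (c' t) (c' t))) (at t within {0..d})"
      using pinner_has_real_derivative[of c "c' t" t "{0..d}" c' "c'' t" p] assms(3,4)
      by (simp add: has_real_derivative_iff_has_vector_derivative)
    then have "pinner p (c t) (c'' t) + pinner p (c' t) (c' t) = 0"
      using assms(1,3) cc by (intro has_vector_derivative_const_eq[of _ _ t d 0]) auto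
    then have "pinner p (c'' t) (c t) = - s" using assms(3,4) by (auto simp: pinner_commute[of p "c'' t"])
    moreover have "\<nu> = c t" "pnorm2 p \<nu> = \<eta>" using assms(3,4) False by (auto simp: \<nu>_def Q3_normal_def Q3_def)
    moreover have "\<eta> = 1 \<or> \<eta> = - 1" using assms(2) False by auto
    ultimately show ?thesis using n by auto
  qed
qed

text \<open>With \<open>k = \<eta> * s\<close>, a normal geodesic from \<open>\<gamma> u\<close>
  solves the linear equation \<open>c'' = - k c\<close>, so it is \<open>C t\<close> times
  \<open>\<gamma> u\<close> plus \<open>S t\<close> times the initial velocity \<open>w\<close>. The
  tube radius \<open>d\<close> satisfies \<open>S d = r * C d\<close>, and \<open>C d\<close> is
  then the normalizing factor of \<open>elliptic_map\<close>. For \<open>k = - 1\<close> the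
  condition \<open>1 + \<eta> * s * r\<^sup>2 > 0\<close> says that \<open>r < 1\<close>, as a
  hyperbolic tangent has to be.\<close>

lemma elliptic_tube_eq:
  assumes \<eta>: "\<eta> \<in> {-1, 0, 1}" and s: "s = 1 \<or> s = - 1" and r: "r > 0" "1 + \<eta> * s * r\<^sup>2 > 0"
    and \<gamma>: "\<And>u. u \<in> I \<Longrightarrow> \<gamma> u \<in> Q3 p \<eta>"
    and sp: "\<And>u. u \<in> I \<Longrightarrow> curve_normal_space p \<eta> \<gamma> u = span {e1 u, e2 u}"
    and e: "\<And>u. u \<in> I \<Longrightarrow> pnorm2 p (e1 u) = s" "\<And>u. u \<in> I \<Longrightarrow> pnorm2 p (e2 u) = s"
      "\<And>u. u \<in> I \<Longrightarrow> pinner p (e1 u) (e2 u) = 0"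
  shows "elliptic_map \<eta> s r \<gamma> e1 e2 ` (I \<times> UNIV) = elliptic_tube p \<eta> I \<gamma> (tube_radius \<eta> s r)"
proof -
  define k where "k = \<eta> * s"
  have k: "k = - 1 \<or> k = 0 \<or> k = 1" using \<eta> s by (auto simp: k_def)
  have kk: "k = 0 \<longleftrightarrow> \<eta> = 0" "\<eta> \<noteq> 0 \<Longrightarrow> \<eta> * k = s" using \<eta> s by (auto simp: k_def)
  \<comment> \<open>\<open>C\<close> and \<open>S\<close> are the generalized cosine and sine: the
    solutions of \<open>c'' = - k c\<close> with initial data \<open>(1, 0)\<close> and
    \<open>(0, 1)\<close>.\<close>
  define C where "C t = (if k = 0 then 1 else if k = 1 then cos t else cosh t)" for t :: real
  define S where "S t = (if k = 0 then t else if k = 1 then sin t else sinh t)" for t :: real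
  have CS0: "C 0 = 1" "S 0 = 0" by (auto simp: C_def S_def)
  have CS: "(C t)\<^sup>2 + k * (S t)\<^sup>2 = 1" for t
    using k by (auto simp: C_def S_def cosh_square_eq)
  have dC: "(C has_real_derivative (- k * S t)) (at t within A)" for t A
    using k unfolding C_def[abs_def] S_def[abs_def] by (auto intro!: derivative_eq_intros)
  have dS: "(S has_real_derivative C t) (at t within A)" for t A
    using k unfolding C_def[abs_def] S_def[abs_def] by (auto intro!: derivative_eq_intros)
  define d where "d = tube_radius \<eta> s r"
  have d: "d > 0 \<and> S d = r * C d \<and> C d > 0"
  proof -
    consider "k = 0" | "k = 1" | "k = - 1" using k by blast
    then show ?thesis
    proof cases
      case 1
      then show ?thesis using r by (simp add: d_def tube_radius_def C_def S_def k_def)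
    next
      case 2
      then show ?thesis using r by (simp add: d_def tube_radius_def C_def S_def k_def[symmetric] cos_arctan sin_arctan
            add_pos_nonneg)
    next
      case 3
      then have r1: "r < 1" using r by (simp add: k_def[symmetric] power_less_one_iff abs_square_less_1)
      \<comment> \<open>\<open>q\<close> is \<open>exp (2 * artanh r)\<close>, from which
        \<open>tanh d = r\<close> is read off.\<close>
      define q where "q = (1 + r) / (1 - r)"
      have q: "q > 1" using r1 r by (simp add: q_def)
      have a: "d = ln q / 2" using 3 by (simp add: d_def tube_radius_def k_def[symmetric] artanh_def q_def)
      have "exp d = sqrt q" using q by (simp add: a ln_sqrt[symmetric])
      then have "sinh d = (sqrt q - 1 / sqrt q) / 2" "cosh d = (sqrt q + 1 / sqrt q) / 2"
        by (simp_all add: sinh_def cosh_def exp_minus inverse_eq_divide)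
      moreover have "(sqrt q - 1 / sqrt q) / 2 = (q - 1) / (2 * sqrt q)" "(sqrt q + 1 / sqrt q) / 2 = (q + 1) / (2 * sqrt q)"
        using q by (simp_all add: field_simps)
      moreover have "q - 1 = r * (q + 1)" using r1 by (simp add: q_def field_simps)
      ultimately have "sinh d = r * cosh d" by simp
      moreover have "d > 0" using q by (simp add: a)
      ultimately show ?thesis using 3 by (simp add: C_def S_def)
    qed
  qed
  have Cd: "\<bar>1 + \<eta> * s * r\<^sup>2\<bar> powr (- 1 / 2) = C d"
  proof -
    have "(C d)\<^sup>2 * (1 + \<eta> * s * r\<^sup>2) = 1" using CS[of d] d by (simp add: k_def power_mult_distrib algebra_simps)
    then have "1 + \<eta> * s * r\<^sup>2 = 1 / (C d)\<^sup>2" using d by (simp add: field_simps)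
    then have "\<bar>1 + \<eta> * s * r\<^sup>2\<bar> = C d powr (- 2)" using d by (simp add: powr_minus_divide powr_numeral)
    then show ?thesis using d by (simp add: powr_powr)
  qed
  have emap: "elliptic_map \<eta> s r \<gamma> e1 e2 (u, v) = C d *\<^sub>R \<gamma> u + S d *\<^sub>R (cos v *\<^sub>R e1 u + sin v *\<^sub>R e2 u)" for u v
    using d by (simp only: elliptic_map_def Cd prod.case) (simp add: scaleR_add_right mult_ac)
  have fwd: "unit_geodesic p \<eta> d (\<gamma> u) w (C d *\<^sub>R \<gamma> u + S d *\<^sub>R w)"
    if "u \<in> I" "w \<in> curve_normal_space p \<eta> \<gamma> u" "pnorm2 p w = s" for u w
  proof -
    have wt: "pinner p (Q3_normal \<eta> (\<gamma> u)) w = 0" using that by (simp add: curve_normal_space_def tangent_Q3_iff)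
    have ct: "C t *\<^sub>R \<gamma> u + S t *\<^sub>R w \<in> Q3 p \<eta>" for t
    proof (cases "\<eta> = 0")
      case True
      then show ?thesis using wt \<gamma>[OF that(1)] by (simp add: Q3_def Q3_normal_def pinner_axis_4)
    next
      case False
      then have "pnorm2 p (C t *\<^sub>R \<gamma> u + S t *\<^sub>R w) = (C t)\<^sup>2 * \<eta> + (S t)\<^sup>2 * s"
        using wt \<gamma>[OF that(1)] that(3)
        by (subst pnorm2_orthogonal_combination) (auto simp: Q3_def Q3_normal_def)
      also have "\<dots> = \<eta> * ((C t)\<^sup>2 + k * (S t)\<^sup>2)" using kk(2)[OF False] by (simp add: algebra_simps)
      finally show ?thesis using CS False by (simp add: Q3_def)
    qed
    have "pnorm2 p ((- k * S t) *\<^sub>R \<gamma> u + C t *\<^sub>R w) = s" for t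
    proof (cases "\<eta> = 0")
      case True
      then have "k = 0" using kk(1) by simp
      then show ?thesis using that(3) by (simp add: C_def)
    next
      case False
      then have "pnorm2 p ((- k * S t) *\<^sub>R \<gamma> u + C t *\<^sub>R w) = (- k * S t)\<^sup>2 * \<eta> + (C t)\<^sup>2 * s"
        using wt \<gamma>[OF that(1)] that(3)
        by (subst pnorm2_orthogonal_combination) (auto simp: Q3_def Q3_normal_def)
      also have "\<dots> = s * ((C t)\<^sup>2 + k * (S t)\<^sup>2)"
        unfolding kk(2)[OF False, symmetric] by (simp add: power2_eq_square algebra_simps)
      finally show ?thesis using CS by simp
    qed
    then have "\<bar>pnorm2 p ((- k * S t) *\<^sub>R \<gamma> u + C t *\<^sub>R w)\<bar> = 1" for t using s by auto
    moreover have "((\<lambda>t. C t *\<^sub>R \<gamma> u + S t *\<^sub>R w) has_vector_derivative ((- k * S t) *\<^sub>R \<gamma> u + C t *\<^sub>R w)) (at t within A)" for t A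
      by (auto intro!: derivative_eq_intros has_vector_derivative_scaleR dC dS)
    moreover have "((\<lambda>t. (- k * S t) *\<^sub>R \<gamma> u + C t *\<^sub>R w) has_vector_derivative ((- k) *\<^sub>R (C t *\<^sub>R \<gamma> u + S t *\<^sub>R w))) (at t within A)" for t A
    proof -
      have "((\<lambda>t. (- k * S t) *\<^sub>R \<gamma> u + C t *\<^sub>R w) has_vector_derivative ((- k * C t) *\<^sub>R \<gamma> u + (- k * S t) *\<^sub>R w)) (at t within A)"
        by (auto intro!: derivative_eq_intros has_vector_derivative_scaleR dC dS)
      then show ?thesis by (simp add: scaleR_add_right scaleR_diff_right)
    qed
    moreover have "pinner p ((- k) *\<^sub>R (C t *\<^sub>R \<gamma> u + S t *\<^sub>R w)) X = 0"
      if "X \<in> tangent_Q3 p \<eta> (C t *\<^sub>R \<gamma> u + S t *\<^sub>R w)" for X t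
      using that kk(1) by (cases "\<eta> = 0") (auto simp: tangent_Q3_def pinner.scaleR_left pinner.minus_left pinner.zero_left)
    ultimately show ?thesis unfolding unit_geodesic_def using ct CS0
      by (intro exI[of _ "\<lambda>t. C t *\<^sub>R \<gamma> u + S t *\<^sub>R w"] exI[of _ "\<lambda>t. (- k * S t) *\<^sub>R \<gamma> u + C t *\<^sub>R w"]
          exI[of _ "\<lambda>t. (- k) *\<^sub>R (C t *\<^sub>R \<gamma> u + S t *\<^sub>R w)"]) simp
  qed
  have bwd: "y = C d *\<^sub>R \<gamma> u + S d *\<^sub>R w \<and> pnorm2 p w = s"
    if u: "u \<in> I" and w: "w \<in> curve_normal_space p \<eta> \<gamma> u" and g: "unit_geodesic p \<eta> d (\<gamma> u) w y" for u w y
  proof -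
    obtain c c' c'' where c0: "c 0 = \<gamma> u" "c' 0 = w" "c d = y" and
      c: "\<forall>t\<in>{0..d}. c t \<in> Q3 p \<eta> \<and> (c has_vector_derivative c' t) (at t within {0..d}) \<and>
           (c' has_vector_derivative c'' t) (at t within {0..d}) \<and> \<bar>pnorm2 p (c' t)\<bar> = 1 \<and>
           (\<forall>X\<in>tangent_Q3 p \<eta> (c t). pinner p (c'' t) X = 0)"
      using g unfolding unit_geodesic_def by blast
    have cv: "convex {0..d}" by simp
    \<comment> \<open>The normal plane is definite of sign \<open>s\<close>, so a vector in it with
      square norm \<open>1\<close> or \<open>- 1\<close> has square norm \<open>s\<close>.\<close>
    have "\<bar>pnorm2 p w\<bar> = 1" using c c0 d by force
    moreover obtain x y where xy: "w = x *\<^sub>R e1 u + y *\<^sub>R e2 u" using w unfolding sp[OF u] span_pair by blast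
    moreover have pw: "pnorm2 p w = (x\<^sup>2 + y\<^sup>2) * s"
      unfolding xy pnorm2_orthogonal_combination[OF e(3)[OF u]] e(1,2)[OF u] by (simp add: algebra_simps)
    ultimately have "x\<^sup>2 + y\<^sup>2 = 1" using s by (auto simp: abs_mult)
    then have ws: "pnorm2 p w = s" using pw by simp
    have "\<forall>t\<in>{0..d}. pnorm2 p (c' t) = s" using geodesic_norm[of d c' c'' p] c c0 ws by auto
    then have geq: "c'' t = - k *\<^sub>R c t" if "t \<in> {0..d}" for t
      unfolding k_def using c d that by (intro geodesic_equation[of d \<eta> t c p c' c'' s] \<eta>) auto
    \<comment> \<open>Variation of constants: the combinations in \<open>zA\<close> and
      \<open>zB\<close> are constant along every solution of \<open>c'' = - k c\<close>, and their
      values at \<open>0\<close> are \<open>\<gamma> u\<close> and \<open>w\<close>.\<close>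
    have zA: "((\<lambda>t. C t *\<^sub>R c t - S t *\<^sub>R c' t) has_vector_derivative 0) (at t within {0..d})" if "t \<in> {0..d}" for t
    proof -
      have "((\<lambda>t. C t *\<^sub>R c t - S t *\<^sub>R c' t) has_vector_derivative
          (C t *\<^sub>R c' t + (- k * S t) *\<^sub>R c t) - (S t *\<^sub>R c'' t + C t *\<^sub>R c' t)) (at t within {0..d})"
        using c that by (intro has_vector_derivative_diff has_vector_derivative_scaleR dC dS) auto
      then show ?thesis by (simp add: geq[OF that] mult.commute)
    qed
    obtain A where A: "\<forall>t\<in>{0..d}. C t *\<^sub>R c t - S t *\<^sub>R c' t = A"
      using has_vector_derivative_zero_constant[OF cv zA] by metis
    have zB: "((\<lambda>t. (k * S t) *\<^sub>R c t + C t *\<^sub>R c' t) has_vector_derivative 0) (at t within {0..d})" if "t \<in> {0..d}" for t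
    proof -
      have "((\<lambda>t. (k * S t) *\<^sub>R c t + C t *\<^sub>R c' t) has_vector_derivative
          ((k * S t) *\<^sub>R c' t + (k * C t) *\<^sub>R c t) + (C t *\<^sub>R c'' t + (- k * S t) *\<^sub>R c' t)) (at t within {0..d})"
        using c that by (intro has_vector_derivative_add has_vector_derivative_scaleR dC DERIV_cmult[OF dS]) auto
      then show ?thesis by (simp add: geq[OF that] mult.commute)
    qed
    obtain B where B: "\<forall>t\<in>{0..d}. (k * S t) *\<^sub>R c t + C t *\<^sub>R c' t = B"
      using has_vector_derivative_zero_constant[OF cv zB] by metis
    have AB: "A = \<gamma> u" "B = w" using A B d CS0 c0 by force+
    \<comment> \<open>The two relations at \<open>d\<close> can be solved for \<open>c d\<close>
      because \<open>(C d)\<^sup>2 + k * (S d)\<^sup>2 = 1\<close>.\<close>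
    have "C d *\<^sub>R (C d *\<^sub>R c d - S d *\<^sub>R c' d) + S d *\<^sub>R ((k * S d) *\<^sub>R c d + C d *\<^sub>R c' d) = ((C d)\<^sup>2 + k * (S d)\<^sup>2) *\<^sub>R c d"
      by (simp add: algebra_simps power2_eq_square)
    moreover have "C d *\<^sub>R c d - S d *\<^sub>R c' d = \<gamma> u" "(k * S d) *\<^sub>R c d + C d *\<^sub>R c' d = w"
      using A[rule_format, of d] B[rule_format, of d] AB d less_imp_le by simp_all
    ultimately show ?thesis using CS[of d] c0 ws by (metis scaleR_one)
  qed
  show ?thesis
  proof (intro equalityI subsetI)
    fix y assume "y \<in> elliptic_map \<eta> s r \<gamma> e1 e2 ` (I \<times> UNIV)"
    then obtain u v where u: "u \<in> I" and y: "y = elliptic_map \<eta> s r \<gamma> e1 e2 (u, v)" by auto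
    define w where "w = cos v *\<^sub>R e1 u + sin v *\<^sub>R e2 u"
    have "w \<in> curve_normal_space p \<eta> \<gamma> u" unfolding sp[OF u] w_def span_pair by blast
    moreover have "pnorm2 p w = s"
      unfolding w_def pnorm2_orthogonal_combination[OF e(3)[OF u]] e(1,2)[OF u]
      by (simp add: distrib_right[symmetric])
    ultimately show "y \<in> elliptic_tube p \<eta> I \<gamma> (tube_radius \<eta> s r)"
      using fwd[OF u] u y unfolding elliptic_tube_def d_def[symmetric] emap w_def[symmetric] by blast
  next
    fix y assume "y \<in> elliptic_tube p \<eta> I \<gamma> (tube_radius \<eta> s r)"
    then obtain u w where u: "u \<in> I" and w: "w \<in> curve_normal_space p \<eta> \<gamma> u" and "unit_geodesic p \<eta> d (\<gamma> u) w y"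
      unfolding elliptic_tube_def d_def[symmetric] by blast
    then have y: "y = C d *\<^sub>R \<gamma> u + S d *\<^sub>R w" "pnorm2 p w = s" using bwd by auto
    obtain a b where ab: "w = a *\<^sub>R e1 u + b *\<^sub>R e2 u" using w unfolding sp[OF u] span_pair by blast
    have "pnorm2 p w = (a\<^sup>2 + b\<^sup>2) * s"
      unfolding ab pnorm2_orthogonal_combination[OF e(3)[OF u]] e(1,2)[OF u] by (simp add: algebra_simps)
    then have "a\<^sup>2 + b\<^sup>2 = 1" using y(2) s by auto
    then obtain v where "a = cos v" "b = sin v" using sincos_total_2pi by metis
    then have "y = elliptic_map \<eta> s r \<gamma> e1 e2 (u, v)" using y ab by (simp add: emap)
    then show "y \<in> elliptic_map \<eta> s r \<gamma> e1 e2 ` (I \<times> UNIV)" using u by blast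
  qed
qed

section \<open>Charts adapted to a constant principal curvature\<close>

lemma vector_derivative_eq_Dif: "f differentiable (at u) \<Longrightarrow> vector_derivative f (at u) = Dif f u 1"
  by (simp add: frechet_derivative_eq_vector_derivative)

lemma smooth_on_has_vector_derivative:
  "smooth_on g I \<Longrightarrow> u \<in> I \<Longrightarrow> (g has_vector_derivative vector_derivative g (at u)) (at u)"
  using smooth_on_differentiable vector_derivative_works by blast

lemma smooth_on_vector_derivative:
  assumes "smooth_on g I" "open I"
  shows "smooth_on (\<lambda>u. vector_derivative g (at u)) I"
proof (rule smooth_on_cong[OF smooth_on_Dif[OF assms(1)] assms(2)])
  show "Dif g u 1 = vector_derivative g (at u)" if "u \<in> I" for u
    using vector_derivative_eq_Dif smooth_on_differentiable assms(1) that by metis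
qed

lemma Dif_const_on:
  assumes "open S" "x \<in> S" "\<And>y. y \<in> S \<Longrightarrow> f y = c"
  shows "Dif f x w = 0"
proof -
  have "(f has_derivative (\<lambda>w. 0)) (at x)"
    by (rule has_derivative_transform_open[OF has_derivative_const assms(1,2)]) (simp add: assms(3))
  then show ?thesis by (simp add: Dif_eqI)
qed

lemma Dif_pinner:
  assumes "(f has_derivative f') (at x)" "(g has_derivative g') (at x)"
  shows "Dif (\<lambda>x. pinner p (f x) (g x)) x w = pinner p (f x) (g' w) + pinner p (f' w) (g x)"
  using Dif_eqI[OF bounded_bilinear.FDERIV[OF bounded_bilinear_pinner assms, of p]] by simp

lemma pinner_const_Dif:
  fixes f g :: "'a::euclidean_space \<Rightarrow> real^4"
  assumes "open S" "x \<in> S" "\<And>y. y \<in> S \<Longrightarrow> pinner p (f y) (g y) = c"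
    and "(f has_derivative f') (at x)" "(g has_derivative g') (at x)"
  shows "pinner p (f x) (g' w) + pinner p (f' w) (g x) = 0"
  using Dif_const_on[OF assms(1,2), of "\<lambda>y. pinner p (f y) (g y)" c w] assms(3) Dif_pinner[OF assms(4,5), of p w] by simp

lemma pinner_const_vector_derivative:
  assumes "open I" "u \<in> I" "\<And>u. u \<in> I \<Longrightarrow> pinner p (a u) (b u) = c"
    and "(a has_vector_derivative a') (at u)" "(b has_vector_derivative b') (at u)"
  shows "pinner p (a u) b' + pinner p a' (b u) = 0"
  using pinner_const_Dif[OF assms(1-3) assms(4,5)[unfolded has_vector_derivative_def], of 1] by simp

lemma has_derivative_comp_fst:
  assumes "smooth_on g I" "u \<in> I"
  shows "((\<lambda>q. g (fst q)) has_derivative (\<lambda>w. fst w *\<^sub>R vector_derivative g (at u))) (at (u, t))"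
proof -
  have "(g has_derivative (\<lambda>h. h *\<^sub>R vector_derivative g (at u))) (at (fst (u, t)))"
    using smooth_on_has_vector_derivative[OF assms] by (simp add: has_vector_derivative_def)
  then show ?thesis by (rule has_derivative_compose[OF bounded_linear_imp_has_derivative[OF bounded_linear_fst]])
qed

lemma smooth_on_comp_fst:
  assumes "smooth_on g I" "open I" "open J"
  shows "smooth_on (\<lambda>q. g (fst q)) (I \<times> J)"
  using assms by (intro smooth_on_compose[OF assms(1)] smooth_on_fst smooth_on_id open_Times) auto

lemma smooth_on_slice:
  fixes g :: "real \<times> real \<Rightarrow> 'b::euclidean_space"
  assumes "smooth_on g (I \<times> J)" "open I" "open J" "t \<in> J"
  shows "smooth_on (\<lambda>u. g (u, t)) I"
  using assms by (intro smooth_on_compose[OF assms(1)] smooth_on_Pair smooth_on_id smooth_on_const open_Times) auto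

lemma slice_has_vector_derivative:
  fixes g :: "real \<times> real \<Rightarrow> 'b::euclidean_space"
  assumes "(g has_derivative g') (at (u, t))"
  shows "((\<lambda>u. g (u, t)) has_vector_derivative g' (1, 0)) (at u)"
    and "((\<lambda>t. g (u, t)) has_vector_derivative g' (0, 1)) (at t)"
proof -
  have l: "linear g'" using assms has_derivative_linear by blast
  have *: "h *\<^sub>R g' (a, b) = g' (h * a, h * b)" for h a b
    using linear_scale[OF l, of h "(a, b)"] by simp
  have "((\<lambda>u. g (u, t)) has_derivative (\<lambda>h. g' (h, 0))) (at u)"
    by (rule has_derivative_compose[of "\<lambda>u. (u, t)" "\<lambda>h. (h, 0)" u UNIV g g'])
      (auto intro!: derivative_eq_intros assms)
  then show "((\<lambda>u. g (u, t)) has_vector_derivative g' (1, 0)) (at u)"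
    by (simp add: has_vector_derivative_def *)
  have "((\<lambda>t. g (u, t)) has_derivative (\<lambda>h. g' (0, h))) (at t)"
    by (rule has_derivative_compose[of "\<lambda>t. (u, t)" "\<lambda>h. (0, h)" t UNIV g g'])
      (auto intro!: derivative_eq_intros assms)
  then show "((\<lambda>t. g (u, t)) has_vector_derivative g' (0, 1)) (at t)"
    by (simp add: has_vector_derivative_def *)
qed

lemma open_intervalD: "open_interval I \<Longrightarrow> open I" "open_interval I \<Longrightarrow> convex I" "open_interval I \<Longrightarrow> connected I"
  by (auto simp: open_interval_def is_interval_convex_1 intro: convex_connected)

lemma constant_along_second_coordinate:
  fixes K :: "real \<times> real \<Rightarrow> 'b::euclidean_space"
  assumes J: "open_interval J" and "t \<in> J" "t0 \<in> J"
    and "\<And>t. t \<in> J \<Longrightarrow> (K has_derivative K' t) (at (u, t))" "\<And>t. t \<in> J \<Longrightarrow> K' t (0, 1) = 0"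
  shows "K (u, t) = K (u, t0)"
proof -
  have "((\<lambda>t. K (u, t)) has_vector_derivative 0) (at t within J)" if "t \<in> J" for t
    using slice_has_vector_derivative(2)[OF assms(4)[OF that]] assms(5)[OF that] has_vector_derivative_at_within by metis
  then obtain c where "\<forall>t\<in>J. K (u, t) = c"
    using has_vector_derivative_zero_constant[OF open_intervalD(2)[OF J]] by metis
  then show ?thesis using assms(2,3) by simp
qed

lemma sgn_constant_on_connected:
  fixes g :: "'a::topological_space \<Rightarrow> real"
  assumes "connected S" "continuous_on S g" "\<And>x. x \<in> S \<Longrightarrow> g x \<noteq> 0" "a \<in> S" "b \<in> S"
  shows "sgn (g a) = sgn (g b)"
proof -
  have "connected (g ` S)" using assms by (intro connected_continuous_image)
  moreover have "g a \<in> g ` S" "g b \<in> g ` S" "0 \<notin> g ` S" using assms by auto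
  ultimately have "\<not> (g a < 0 \<and> g b > 0)" "\<not> (g a > 0 \<and> g b < 0)"
    by (meson connectedD_interval less_imp_le)+
  moreover have "g a \<noteq> 0" "g b \<noteq> 0" using assms by auto
  ultimately show ?thesis by (auto simp: sgn_if)
qed

text \<open>Applied to \<open>A = df(w)\<close> and \<open>B = dN(w)\<close>: in a principal
  direction the derivative of \<open>f + r N\<close> is \<open>1 - r \<kappa>\<close> times that of
  \<open>f\<close>, hence zero for \<open>\<kappa> = 1 / r\<close> and nonzero for the other
  principal curvature.\<close>

lemma eigen_combination:
  fixes A B :: "'a::real_vector"
  assumes "- B = \<kappa> *\<^sub>R A"
  shows "A + r *\<^sub>R B = (1 - r * \<kappa>) *\<^sub>R A"
proof -
  have "B = - (\<kappa> *\<^sub>R A)" using assms by (metis minus_minus)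
  then show ?thesis by (simp add: scaleR_diff_left)
qed

lemma adapted_chart_exists:
  fixes M :: "'m::topological_space set"
  assumes sm: "smooth_on_surface M f N" and x: "x \<in> M" and r: "r > 0"
    and nu: "\<not> umbilic M f N x" and pc: "\<And>y. y \<in> M \<Longrightarrow> principal_curvature M f N y (1 / r)"
  obtains I J \<psi> \<Gamma> where "open_interval I" "open_interval J" "surface_chart M f (I \<times> J) \<psi>"
    "x \<in> \<psi> ` (I \<times> J)" "smooth_on (N \<circ> \<psi>) (I \<times> J)" "smooth_on \<Gamma> I"
    "\<And>u t. u \<in> I \<Longrightarrow> t \<in> J \<Longrightarrow> f (\<psi> (u, t)) + r *\<^sub>R N (\<psi> (u, t)) = \<Gamma> u"
    "\<And>u. u \<in> I \<Longrightarrow> vector_derivative \<Gamma> (at u) \<noteq> 0"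
proof -
  obtain U \<psi> where U: "surface_chart M f U \<psi>" "x \<in> \<psi> ` U" "smooth_on (N \<circ> \<psi>) U"
    using sm x unfolding smooth_on_surface_def by blast
  obtain q0 where q0: "q0 \<in> U" "\<psi> q0 = x" using U(2) by blast
  note oU = chart_open[OF U(1)]
  define G where "G q = (f \<circ> \<psi>) q + r *\<^sub>R (N \<circ> \<psi>) q" for q
  have sG: "smooth_on G U" unfolding G_def
    by (intro smooth_on_add smooth_on_scaleR smooth_on_const oU chart_smooth[OF U(1)] U(3))
  \<comment> \<open>\<open>1 / r\<close> is a principal curvature, so a point that is not umbilic
    has a second one.\<close>
  obtain \<kappa> where \<kappa>: "principal_curvature M f N x \<kappa>" "\<kappa> \<noteq> 1 / r"
    using nu pc[OF x] unfolding umbilic_def by blast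
  then obtain w where w: "w \<noteq> 0" "- Dif (N \<circ> \<psi>) q0 w = \<kappa> *\<^sub>R Dif (f \<circ> \<psi>) q0 w"
    using principal_curvature_chart[OF U(1) q0(1) smooth_on_differentiable[OF U(3) q0(1)], of \<kappa>] q0(2) by auto
  have dG: "(G has_derivative (\<lambda>w. Dif (f \<circ> \<psi>) q0 w + r *\<^sub>R Dif (N \<circ> \<psi>) q0 w)) (at q0)" unfolding G_def[abs_def]
    by (intro has_derivative_add has_derivative_scaleR_right smooth_on_has_derivative[OF chart_smooth[OF U(1)] q0(1)]
        smooth_on_has_derivative[OF U(3) q0(1)])
  have "Dif G q0 w = (1 - r * \<kappa>) *\<^sub>R Dif (f \<circ> \<psi>) q0 w"
    unfolding Dif_eqI[OF dG] by (rule eigen_combination[OF w(2)])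
  moreover have "1 - r * \<kappa> \<noteq> 0" using \<kappa>(2) r by (auto simp: field_simps)
  ultimately have "Dif G q0 w \<noteq> 0" using chart_Dif_nonzero[OF U(1) q0(1) w(1)] by simp
  then obtain i where i: "Dif G q0 w $ i \<noteq> 0" by (auto simp: vec_eq_iff)
  define h where "h q = G q $ i" for q
  have lv: "bounded_linear (\<lambda>x::real^4. x $ i)" by (rule bounded_linear_vec_nth)
  have sh: "smooth_on h U" unfolding h_def by (intro smooth_on_linear[OF lv] oU sG)
  have dh: "(h has_derivative (\<lambda>w. Dif G q0 w $ i)) (at q0)" unfolding h_def[abs_def]
    by (rule bounded_linear.has_derivative[OF lv smooth_on_has_derivative[OF sG q0(1)]])
  have hl: "linear (\<lambda>w. Dif G q0 w $ i)" using dh has_derivative_linear by blast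
  define a where "a = Dif G q0 (1, 0) $ i"
  define b where "b = Dif G q0 (0, 1) $ i"
  have hab: "Dif G q0 z $ i = a * fst z + b * snd z" for z
    using linear_plane_expand[OF hl, of z] by (simp add: a_def b_def)
  have ab: "a\<^sup>2 + b\<^sup>2 \<noteq> 0" using i hab[of w] by (auto simp: sum_power2_eq_zero_iff)
  \<comment> \<open>The second component is the linear form \<open>Dif G q0 z $ i\<close> after a
    quarter turn, so the Jacobian of \<open>H\<close> at \<open>q0\<close> is
    \<open>a\<^sup>2 + b\<^sup>2\<close>.\<close>
  define H where "H q = (h q, a * snd q - b * fst q)" for q
  have sH: "smooth_on H U" unfolding H_def
    by (intro smooth_on_Pair sh smooth_on_diff smooth_on_mult smooth_on_const smooth_on_fst smooth_on_snd smooth_on_id oU)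
  have dH: "(H has_derivative (\<lambda>w. (Dif G q0 w $ i, a * snd w - b * fst w))) (at q0)" unfolding H_def[abs_def]
    by (auto intro!: derivative_eq_intros dh)
  have "inj (Dif H q0)"
    unfolding Dif_eqI[OF dH]
    unfolding linear_injective_0[OF has_derivative_linear[OF dH]]
  proof (intro allI impI)
    fix z assume "(Dif G q0 z $ i, a * snd z - b * fst z) = 0"
    then have e: "a * fst z + b * snd z = 0" "a * snd z - b * fst z = 0" by (auto simp: hab prod_eq_iff)
    have "(a\<^sup>2 + b\<^sup>2) * fst z = 0" "(a\<^sup>2 + b\<^sup>2) * snd z = 0" using e by algebra+
    then show "z = 0" using ab by (auto simp: prod_eq_iff)
  qed
  then obtain W V \<Phi> where W: "open W" "q0 \<in> W" "W \<subseteq> U" "open V" "homeomorphism W V H \<Phi>" "smooth_on \<Phi> V"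
    "\<And>z. z \<in> V \<Longrightarrow> inj (Dif \<Phi> z)"
    using inverse_of_inj_derivative[OF oU sH q0(1)] by metis
  have HV: "H q0 \<in> V" using W(2,5) by (auto simp: homeomorphism_def)
  have \<Phi>W: "\<Phi> z \<in> W" "H (\<Phi> z) = z" if "z \<in> V" for z using that W(5) by (auto simp: homeomorphism_def)
  obtain I J where IJ: "open_interval I" "open_interval J" "fst (H q0) \<in> I" "snd (H q0) \<in> J" "I \<times> J \<subseteq> V"
    using open_rectangle[OF W(4), of "fst (H q0)" "snd (H q0)"] HV by auto
  have oIJ: "open (I \<times> J)" using IJ by (intro open_Times open_intervalD)
  define \<psi>' where "\<psi>' = \<psi> \<circ> \<Phi>"
  have ch: "surface_chart M f (I \<times> J) \<psi>'" unfolding \<psi>'_def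
    using chart_subset[OF chart_compose[OF U(1) _ W(4,1,3,6,7)] oIJ IJ(5)] homeomorphism_symD[OF W(5)] by blast
  have "\<psi>' (H q0) = x" using q0(2) W(2,5) by (simp add: \<psi>'_def homeomorphism_def)
  then have xin: "x \<in> \<psi>' ` (I \<times> J)" using IJ(3,4) by (metis image_eqI mem_Times_iff)
  have sN: "smooth_on (N \<circ> \<psi>') (I \<times> J)"
    using smooth_on_compose[OF U(3) oIJ oU _ smooth_on_subset[OF W(6) IJ(5)]] \<Phi>W(1) W(3) IJ(5)
    by (fastforce simp: \<psi>'_def comp_def)
  define K where "K q = (f \<circ> \<psi>') q + r *\<^sub>R (N \<circ> \<psi>') q" for q
  have sK: "smooth_on K (I \<times> J)" unfolding K_def
    by (intro smooth_on_add smooth_on_scaleR smooth_on_const oIJ chart_smooth[OF ch] sN)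
  have Ki: "K q $ i = fst q" if "q \<in> I \<times> J" for q
  proof -
    have "fst (H (\<Phi> q)) = fst q" using \<Phi>W(2) that IJ(5) by auto
    then show ?thesis by (simp add: H_def h_def G_def K_def \<psi>'_def)
  qed
  have dK: "(K has_derivative Dif K q) (at q)" if "q \<in> I \<times> J" for q
    using smooth_on_has_derivative[OF sK that] .
  have dKi: "Dif K q w $ i = fst w" if "q \<in> I \<times> J" for q w
  proof -
    have "((\<lambda>q. K q $ i) has_derivative (\<lambda>w. Dif K q w $ i)) (at q)"
      by (rule bounded_linear.has_derivative[OF lv dK[OF that]])
    then have "(fst has_derivative (\<lambda>w. Dif K q w $ i)) (at q)"
      by (rule has_derivative_transform_open[OF _ oIJ that Ki])
    then show ?thesis
      using has_derivative_unique[OF _ bounded_linear_imp_has_derivative[OF bounded_linear_fst]] by metis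
  qed
  \<comment> \<open>The derivative of \<open>K\<close> kills a principal direction \<open>w\<close>
    for \<open>1 / r\<close>. As the \<open>i\<close>-th component of \<open>K\<close> is the first
    coordinate itself, \<open>fst w = 0\<close>, so what is killed is the second coordinate
    direction.\<close>
  have Kt: "Dif K q (0, 1) = 0" if q: "q \<in> I \<times> J" for q
  proof -
    have "principal_curvature M f N (\<psi>' q) (1 / r)" using pc chart_in[OF ch q] by blast
    then obtain w where w: "w \<noteq> 0" "- Dif (N \<circ> \<psi>') q w = (1 / r) *\<^sub>R Dif (f \<circ> \<psi>') q w"
      using principal_curvature_chart[OF ch q smooth_on_differentiable[OF sN q]] by blast
    have "(K has_derivative (\<lambda>w. Dif (f \<circ> \<psi>') q w + r *\<^sub>R Dif (N \<circ> \<psi>') q w)) (at q)" unfolding K_def[abs_def]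
      by (intro has_derivative_add has_derivative_scaleR_right smooth_on_has_derivative[OF chart_smooth[OF ch] q]
          smooth_on_has_derivative[OF sN q])
    then have "Dif K q w = Dif (f \<circ> \<psi>') q w + r *\<^sub>R Dif (N \<circ> \<psi>') q w" by (simp add: Dif_eqI)
    then have z: "Dif K q w = 0" unfolding eigen_combination[OF w(2)] using r by simp
    then have fw: "fst w = 0" using dKi[OF q, of w] by simp
    then have "snd w \<noteq> 0" using w(1) by (auto simp: prod_eq_iff)
    moreover have "Dif K q w = snd w *\<^sub>R Dif K q (0, 1)"
      using linear_plane_expand[OF has_derivative_linear[OF dK[OF q]], of w] fw by simp
    ultimately show ?thesis using z by simp
  qed
  define \<Gamma> where "\<Gamma> u = K (u, snd (H q0))" for u
  have s\<Gamma>: "smooth_on \<Gamma> I" unfolding \<Gamma>_def using smooth_on_slice[OF sK] IJ open_intervalD by blast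
  have K\<Gamma>: "K (u, t) = \<Gamma> u" if "u \<in> I" "t \<in> J" for u t
    unfolding \<Gamma>_def using that IJ(4) by (intro constant_along_second_coordinate[OF IJ(2), where K' = "\<lambda>t. Dif K (u, t)"] dK Kt) auto
  \<comment> \<open>The \<open>i\<close>-th component of \<open>\<Gamma> u\<close> is
    \<open>u\<close>, so that of its velocity is \<open>1\<close>.\<close>
  have "vector_derivative \<Gamma> (at u) \<noteq> 0" if "u \<in> I" for u
  proof -
    have "(\<Gamma> has_vector_derivative Dif K (u, snd (H q0)) (1, 0)) (at u)" unfolding \<Gamma>_def
      using slice_has_vector_derivative(1)[OF dK] that IJ(4) by blast
    then have "vector_derivative \<Gamma> (at u) $ i = 1" using dKi[of "(u, snd (H q0))" "(1, 0)"] that IJ(4)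
      by (simp add: vector_derivative_at)
    then show ?thesis by auto
  qed
  then show ?thesis using that[OF IJ(1,2) ch xin sN s\<Gamma>] K\<Gamma> by (simp add: K_def)
qed

text \<open>In a chart the square norm is continuous with values in \<open>{-1, 1}\<close>, hence
  locally constant; connectedness does the rest. For empty \<open>M\<close> either sign
  serves.\<close>

lemma normal_norm_constant:
  fixes M :: "'m::topological_space set"
  assumes "connected M" "smooth_on_surface M f N" "\<And>x. x \<in> M \<Longrightarrow> \<bar>pnorm2 p (N x)\<bar> = 1"
  obtains \<epsilon>' where "\<epsilon>' = 1 \<or> \<epsilon>' = - 1" "\<And>x. x \<in> M \<Longrightarrow> pnorm2 p (N x) = \<epsilon>'"
proof -
  have "(\<lambda>x. pnorm2 p (N x)) constant_on M"
  proof (rule locally_constant_imp_constant[OF assms(1)])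
    fix x assume "x \<in> M"
    then obtain U \<psi> where U: "surface_chart M f U \<psi>" "x \<in> \<psi> ` U" "smooth_on (N \<circ> \<psi>) U"
      using assms(2) unfolding smooth_on_surface_def by blast
    obtain q0 where q0: "q0 \<in> U" "\<psi> q0 = x" using U(2) by blast
    obtain d where d: "d > 0" "ball q0 d \<subseteq> U" using chart_open[OF U(1)] q0(1) openE by blast
    have "pnorm2 p (N (\<psi> q)) = pnorm2 p (N x)" if q: "q \<in> ball q0 d" for q
    proof -
      have *: "\<bar>pnorm2 p (N (\<psi> q))\<bar> = 1" if "q \<in> ball q0 d" for q using assms(3) chart_in[OF U(1)] d that by blast
      have "continuous_on (ball q0 d) (\<lambda>q. pnorm2 p ((N \<circ> \<psi>) q))"
        by (intro pinner.continuous_on continuous_on_subset[OF smooth_on_continuous_on[OF U(3)] d(2)])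
      then have "sgn (pnorm2 p ((N \<circ> \<psi>) q)) = sgn (pnorm2 p ((N \<circ> \<psi>) q0))"
        using * q d(1) by (intro sgn_constant_on_connected[of "ball q0 d"]) force+
      then show ?thesis using *[OF q] *[of q0] d(1) q0(2) by (auto simp: sgn_if split: if_splits)
    qed
    moreover have "openin (top_of_set M) (\<psi> ` ball q0 d)" using chart_openin_image[OF U(1) open_ball d(2)] .
    ultimately show "\<exists>T. openin (top_of_set M) T \<and> x \<in> T \<and> (\<forall>y\<in>T. pnorm2 p (N y) = pnorm2 p (N x))"
      using q0 d by (intro exI[of _ "\<psi> ` ball q0 d"]) auto
  qed
  then obtain c where c: "\<And>x. x \<in> M \<Longrightarrow> pnorm2 p (N x) = c" unfolding constant_on_def by blast
  show ?thesis
  proof (cases "M = {}")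
    case False
    then have "c = 1 \<or> c = - 1" using assms(3) c by fastforce
    then show ?thesis using that c by blast
  qed (use that in blast)
qed

text \<open>
  In an adapted chart the fibres \<open>u = const\<close> are the lines of curvature of the constant principal
  curvature; \<open>F\<close>, \<open>n\<close> and \<open>\<Gamma>\<close> are the surface, its unit normal and its focal curve.
\<close>

locale tube_chart =
  fixes p :: nat and \<epsilon> r \<epsilon>' :: real and I J :: "real set"
    and F n :: "real \<times> real \<Rightarrow> real^4" and \<Gamma> :: "real \<Rightarrow> real^4"
  assumes space: "space_form p \<epsilon>" and r_pos: "r > 0" and eps': "\<epsilon>' = 1 \<or> \<epsilon>' = - 1"
    and I: "open_interval I" and J: "open_interval J"
    and smooth_F: "smooth_on F (I \<times> J)" and smooth_n: "smooth_on n (I \<times> J)" and smooth_\<Gamma>: "smooth_on \<Gamma> I"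
    and focal: "\<And>u t. u \<in> I \<Longrightarrow> t \<in> J \<Longrightarrow> F (u, t) + r *\<^sub>R n (u, t) = \<Gamma> u"
    and \<Gamma>'_nonzero: "\<And>u. u \<in> I \<Longrightarrow> vector_derivative \<Gamma> (at u) \<noteq> 0"
    and inj_F: "\<And>q. q \<in> I \<times> J \<Longrightarrow> inj (Dif F q)"
    and F_in: "\<And>q. q \<in> I \<times> J \<Longrightarrow> F q \<in> Q3 p \<epsilon>"
    and n_tangent: "\<And>q. q \<in> I \<times> J \<Longrightarrow> n q \<in> tangent_Q3 p \<epsilon> (F q)"
    and n_norm: "\<And>q. q \<in> I \<times> J \<Longrightarrow> pnorm2 p (n q) = \<epsilon>'"
    and n_normal: "\<And>q w. q \<in> I \<times> J \<Longrightarrow> pinner p (n q) (Dif F q w) = 0"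
    and second_direction: "\<And>q. q \<in> I \<times> J \<Longrightarrow> \<exists>w \<kappa>. w \<noteq> 0 \<and> \<kappa> \<noteq> 1 / r \<and> - Dif n q w = \<kappa> *\<^sub>R Dif F q w"
begin

abbreviation "\<Gamma>' u \<equiv> vector_derivative \<Gamma> (at u)"
abbreviation "Ft q \<equiv> Dif F q (0, 1)"
abbreviation "\<nu> q \<equiv> Q3_normal \<epsilon> (F q)"

lemma open_I: "open I" and open_J: "open J" and open_IJ: "open (I \<times> J)"
  using I J open_intervalD by (auto intro: open_Times)

lemma eps: "\<epsilon> = 0 \<or> \<epsilon> = 1 \<or> \<epsilon> = - 1"
  using space by (auto simp: space_form_def)

lemma dF: "q \<in> I \<times> J \<Longrightarrow> (F has_derivative Dif F q) (at q)"
  and dn: "q \<in> I \<times> J \<Longrightarrow> (n has_derivative Dif n q) (at q)"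
  using smooth_on_has_derivative smooth_F smooth_n by blast+

text \<open>The derivative of the focal relation. Along the fibre it reads
  \<open>r n_t = - F_t\<close>, across it \<open>\<Gamma>' = F_u + r n_u\<close>.\<close>

lemma Dif_n:
  assumes "u \<in> I" "t \<in> J"
  shows "r *\<^sub>R Dif n (u, t) w = fst w *\<^sub>R \<Gamma>' u - Dif F (u, t) w"
proof -
  have q: "(u, t) \<in> I \<times> J" using assms by simp
  have "((\<lambda>q. F q + r *\<^sub>R n q) has_derivative (\<lambda>w. Dif F (u, t) w + r *\<^sub>R Dif n (u, t) w)) (at (u, t))"
    by (intro has_derivative_add has_derivative_scaleR_right dF dn q)
  then have "((\<lambda>q. \<Gamma> (fst q)) has_derivative (\<lambda>w. Dif F (u, t) w + r *\<^sub>R Dif n (u, t) w)) (at (u, t))"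
    by (rule has_derivative_transform_open[OF _ open_IJ q]) (auto simp: focal)
  then have "(\<lambda>w. Dif F (u, t) w + r *\<^sub>R Dif n (u, t) w) = (\<lambda>w. fst w *\<^sub>R \<Gamma>' u)"
    using has_derivative_unique[OF _ has_derivative_comp_fst[OF smooth_\<Gamma> assms(1)]] by blast
  then have "Dif F (u, t) w + r *\<^sub>R Dif n (u, t) w = fst w *\<^sub>R \<Gamma>' u" by metis
  then show ?thesis by (simp add: algebra_simps eq_diff_eq)
qed

section \<open>Orthogonality relations in an adapted chart\<close>

lemma n_Dif_n: "q \<in> I \<times> J \<Longrightarrow> pinner p (n q) (Dif n q w) = 0"
  using pinner_const_Dif[OF open_IJ _ n_norm dn dn, of q w] by (simp add: pinner_commute[of p "Dif n q w"])

lemma n_orth_\<Gamma>':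
  assumes "u \<in> I" "t \<in> J"
  shows "pinner p (n (u, t)) (\<Gamma>' u) = 0"
proof -
  have "\<Gamma>' u = Dif F (u, t) (1, 0) + r *\<^sub>R Dif n (u, t) (1, 0)" using Dif_n[OF assms, of "(1, 0)"] by simp
  then show ?thesis using n_Dif_n[of "(u, t)" "(1, 0)"] n_normal[of "(u, t)" "(1, 0)"] assms
    by (simp add: pinner_simps)
qed

text \<open>Differentiate the product of \<open>n\<close> and \<open>\<Gamma>'\<close> along the
  fibre: \<open>\<Gamma>'\<close> does not change there, and \<open>r n_t = - F_t\<close>.\<close>

lemma Ft_orth_\<Gamma>':
  assumes "u \<in> I" "t \<in> J"
  shows "pinner p (Ft (u, t)) (\<Gamma>' u) = 0"
proof -
  have q: "(u, t) \<in> I \<times> J" using assms by simp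
  have "pinner p (n (u, t)) (fst (0::real, 1::real) *\<^sub>R vector_derivative (\<lambda>u. \<Gamma>' u) (at u))
      + pinner p (Dif n (u, t) (0, 1)) (\<Gamma>' (fst (u, t))) = 0"
    by (rule pinner_const_Dif[OF open_IJ q _ dn[OF q] has_derivative_comp_fst[OF smooth_on_vector_derivative[OF smooth_\<Gamma> open_I] assms(1)], of p 0])
      (auto simp: n_orth_\<Gamma>')
  then have "pinner p (r *\<^sub>R Dif n (u, t) (0, 1)) (\<Gamma>' u) = 0" by (simp add: pinner_simps pinner.zero_right)
  then show ?thesis using Dif_n[OF assms, of "(0, 1)"] by (simp add: pinner_simps)
qed

lemma \<nu>_norm: "q \<in> I \<times> J \<Longrightarrow> pnorm2 p (\<nu> q) \<noteq> 0"
  using pnorm2_Q3_normal[OF F_in] by simp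

lemma \<nu>_n: "q \<in> I \<times> J \<Longrightarrow> pinner p (\<nu> q) (n q) = 0"
  using n_tangent tangent_Q3_iff by blast

lemma \<nu>_Dif_F:
  assumes q: "q \<in> I \<times> J"
  shows "pinner p (\<nu> q) (Dif F q w) = 0"
proof (cases "\<epsilon> = 0")
  case True
  have "pinner p (axis 4 1) (Dif F q w) + pinner p 0 (F q) = 0"
    by (rule pinner_const_Dif[OF open_IJ q _ has_derivative_const dF[OF q], of p _ 0])
      (use F_in True in \<open>auto simp: pinner_axis_4 Q3_def\<close>)
  then show ?thesis using True by (simp add: Q3_normal_def pinner.zero_left)
next
  case False
  have "pinner p (F q) (Dif F q w) + pinner p (Dif F q w) (F q) = 0"
    by (rule pinner_const_Dif[OF open_IJ q _ dF[OF q] dF[OF q], of p \<epsilon>])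
      (use F_in False in \<open>auto simp: Q3_def\<close>)
  then show ?thesis using False by (simp add: Q3_normal_def pinner_commute[of p "Dif F q w"])
qed

lemma \<nu>_Dif_n:
  assumes q: "q \<in> I \<times> J"
  shows "pinner p (\<nu> q) (Dif n q w) = 0"
proof (cases "\<epsilon> = 0")
  case True
  have "pinner p (axis 4 1) (Dif n q w) + pinner p 0 (n q) = 0"
    by (rule pinner_const_Dif[OF open_IJ q _ has_derivative_const dn[OF q], of p _ 0])
      (use \<nu>_n True in \<open>auto simp: Q3_normal_def\<close>)
  then show ?thesis using True by (simp add: Q3_normal_def pinner.zero_left)
next
  case False
  have "pinner p (F q) (Dif n q w) + pinner p (Dif F q w) (n q) = 0"
    by (rule pinner_const_Dif[OF open_IJ q _ dF[OF q] dn[OF q], of p 0])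
      (use \<nu>_n False in \<open>auto simp: Q3_normal_def\<close>)
  then show ?thesis using False n_normal[OF q, of w] by (simp add: Q3_normal_def pinner_commute[of p "Dif F q w"])
qed

lemma \<nu>_\<Gamma>':
  assumes "u \<in> I" "t \<in> J"
  shows "pinner p (\<nu> (u, t)) (\<Gamma>' u) = 0"
proof -
  have "\<Gamma>' u = Dif F (u, t) (1, 0) + r *\<^sub>R Dif n (u, t) (1, 0)" using Dif_n[OF assms, of "(1, 0)"] by simp
  then show ?thesis using \<nu>_Dif_F[of "(u, t)" "(1, 0)"] \<nu>_Dif_n[of "(u, t)" "(1, 0)"] assms
    by (simp add: pinner_simps)
qed

text \<open>For the second principal direction \<open>w\<close>, the vector \<open>fst w\<close>
  times \<open>\<Gamma>'\<close> equals \<open>1 - r * \<kappa>\<close> times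
  \<open>Dif F (u, t) w\<close>, and both factors are nonzero. So \<open>\<Gamma>'\<close> is
  tangent to the surface and transverse to the fibre.\<close>

lemma Ft_\<Gamma>'_independent:
  assumes "u \<in> I" "t \<in> J" "a *\<^sub>R Ft (u, t) + b *\<^sub>R \<Gamma>' u = 0"
  shows "a = 0 \<and> b = 0"
proof -
  have q: "(u, t) \<in> I \<times> J" using assms by simp
  obtain w \<kappa> where w: "w \<noteq> 0" "\<kappa> \<noteq> 1 / r" "- Dif n (u, t) w = \<kappa> *\<^sub>R Dif F (u, t) w"
    using second_direction[OF q] by blast
  have lin: "linear (Dif F (u, t))" using has_derivative_linear[OF dF[OF q]] .
  have nz: "Dif F (u, t) z = 0 \<Longrightarrow> z = 0" for z using inj_F[OF q] linear_injective_0[OF lin] by blast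
  have "fst w *\<^sub>R \<Gamma>' u = Dif F (u, t) w + r *\<^sub>R Dif n (u, t) w" using Dif_n[OF assms(1,2), of w] by simp
  also have "\<dots> = (1 - r * \<kappa>) *\<^sub>R Dif F (u, t) w" by (rule eigen_combination[OF w(3)])
  finally have e: "fst w *\<^sub>R \<Gamma>' u = (1 - r * \<kappa>) *\<^sub>R Dif F (u, t) w" .
  have k: "1 - r * \<kappa> \<noteq> 0" using w(2) r_pos by (auto simp: field_simps)
  have f: "fst w \<noteq> 0" using e k w(1) nz[of w] by auto
  have "Dif F (u, t) (fst w *\<^sub>R a *\<^sub>R (0, 1) + (b * (1 - r * \<kappa>)) *\<^sub>R w)
      = fst w *\<^sub>R a *\<^sub>R Ft (u, t) + b *\<^sub>R ((1 - r * \<kappa>) *\<^sub>R Dif F (u, t) w)"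
    by (simp only: linear_add[OF lin] linear_scale[OF lin] scaleR_scaleR)
  also have "\<dots> = fst w *\<^sub>R (a *\<^sub>R Ft (u, t) + b *\<^sub>R \<Gamma>' u)"
    unfolding e[symmetric] by (simp add: scaleR_add_right mult.commute)
  finally have "fst w *\<^sub>R a *\<^sub>R (0, 1) + (b * (1 - r * \<kappa>)) *\<^sub>R w = 0"
    using nz assms(3) by simp
  then have "b * (1 - r * \<kappa>) * fst w = 0" "fst w * a + b * (1 - r * \<kappa>) * snd w = 0" by (auto simp: prod_eq_iff)
  then show ?thesis using f k by auto
qed

text \<open>The vectors \<open>\<nu>\<close>, \<open>n\<close>, \<open>Ft\<close> and
  \<open>\<Gamma>'\<close> are pairwise orthogonal, the first two are not null and the last two are
  independent. This is what gives the fibre direction a causal character.\<close>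

lemma Ft_nonnull:
  assumes "u \<in> I" "t \<in> J"
  shows "pnorm2 p (Ft (u, t)) \<noteq> 0"
  using assms eps' n_norm[of "(u, t)"] n_normal[of "(u, t)"] Ft_\<Gamma>'_independent
  by (intro nonnull_of_orthogonal_independent[of p "\<nu> (u, t)" "n (u, t)" "Ft (u, t)" "\<Gamma>' u"])
    (auto simp: \<nu>_norm \<nu>_n \<nu>_Dif_F \<nu>_\<Gamma>' n_orth_\<Gamma>' Ft_orth_\<Gamma>')

lemma \<Gamma>'_nonnull:
  assumes "u \<in> I" "t \<in> J"
  shows "pnorm2 p (\<Gamma>' u) \<noteq> 0"
  using assms eps' n_norm[of "(u, t)"] n_normal[of "(u, t)"] Ft_\<Gamma>'_independent[of u t]
  by (intro nonnull_of_orthogonal_independent[of p "\<nu> (u, t)" "n (u, t)" "\<Gamma>' u" "Ft (u, t)"])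
    (auto simp: \<nu>_norm \<nu>_n \<nu>_Dif_F \<nu>_\<Gamma>' n_orth_\<Gamma>' Ft_orth_\<Gamma>' pinner_commute[of p "\<Gamma>' u" "Ft (u, t)"] add.commute[of "_ *\<^sub>R \<Gamma>' u"])

lemma sgn_Ft: "q \<in> I \<times> J \<Longrightarrow> q' \<in> I \<times> J \<Longrightarrow> sgn (pnorm2 p (Ft q)) = sgn (pnorm2 p (Ft q'))"
  using Ft_nonnull I J
  by (intro sgn_constant_on_connected[of "I \<times> J"] pinner.continuous_on smooth_on_continuous_on smooth_on_Dif smooth_F
      connected_Times open_intervalD) auto

end

section \<open>Elliptic and hyperbolic tubes\<close>

text \<open>The fibres are reparametrized so that \<open>y\<close> becomes \<open>S v\<close>: the
  pair \<open>(u, y)\<close> is a local coordinate system since \<open>y\<close> has nonzero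
  derivative along the fibre, and the map from \<open>(u, v)\<close> to \<open>(u, S v)\<close> has
  derivative the identity at \<open>(u0, 0)\<close>. The functions used for \<open>S\<close> are
  \<open>sin\<close>, \<open>sinh\<close> and the identity.\<close>

lemma fibre_coordinate:
  fixes y :: "real \<times> real \<Rightarrow> real"
  assumes ch: "surface_chart M f (I \<times> J) \<psi>"
    and "open A" "A \<subseteq> I \<times> J" "(u0, t0) \<in> A" and y: "smooth_on y (I \<times> J)" "y (u0, t0) = 0"
    and dy: "(y has_derivative y') (at (u0, t0))" "y' (0, 1) \<noteq> 0"
    and S: "smooth_on S UNIV" "S 0 = 0" "(S has_real_derivative 1) (at (0::real))"
  obtains I' J' \<Phi> where "open_interval I'" "open_interval J'" "u0 \<in> I'" "0 \<in> J'" "J' \<subseteq> {-1<..<1}"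
    "\<Phi> (u0, 0) = (u0, t0)"
    "\<And>u v. u \<in> I' \<Longrightarrow> v \<in> J' \<Longrightarrow> \<Phi> (u, v) \<in> A \<and> fst (\<Phi> (u, v)) = u \<and> y (\<Phi> (u, v)) = S v"
    "surface_chart M f (I' \<times> J') (\<psi> \<circ> \<Phi>)"
proof -
  define H where "H q = (fst q, y q)" for q
  have yA: "smooth_on y A" using smooth_on_subset[OF y(1) assms(3)] .
  have sH: "smooth_on H A" unfolding H_def
    by (intro smooth_on_Pair smooth_on_fst smooth_on_id yA assms(2))
  have dH: "(H has_derivative (\<lambda>w. (fst w, y' w))) (at (u0, t0))" unfolding H_def[abs_def]
    by (auto intro!: derivative_eq_intros dy)
  have "inj (Dif H (u0, t0))"
    unfolding Dif_eqI[OF dH] linear_injective_0[OF has_derivative_linear[OF dH]]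
  proof (intro allI impI)
    fix z assume "(fst z, y' z) = 0"
    then have z: "fst z = 0" "y' z = 0" by (auto simp: prod_eq_iff)
    then have "snd z * y' (0, 1) = 0"
      using linear_plane_expand[OF has_derivative_linear[OF dy(1)], of z] by simp
    then show "z = 0" using z dy(2) by (simp add: prod_eq_iff)
  qed
  then obtain W V \<Theta> where W: "open W" "(u0, t0) \<in> W" "W \<subseteq> A" "open V" "homeomorphism W V H \<Theta>" "smooth_on \<Theta> V"
    "\<And>z. z \<in> V \<Longrightarrow> inj (Dif \<Theta> z)"
    using inverse_of_inj_derivative[OF assms(2) sH assms(4)] by metis
  define Z where "Z q = (fst q, S (snd q))" for q :: "real \<times> real"
  have sZ: "smooth_on Z UNIV" unfolding Z_def
    by (intro smooth_on_Pair smooth_on_fst smooth_on_id smooth_on_compose[OF S(1)] smooth_on_snd open_UNIV) auto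
  define V1 where "V1 = UNIV \<inter> Z -` V"
  have oV1: "open V1" unfolding V1_def
    by (rule continuous_open_preimage[OF smooth_on_continuous_on[OF sZ] open_UNIV W(4)])
  define \<Phi> where "\<Phi> q = \<Theta> (Z q)" for q
  have Z0: "Z (u0, 0) = H (u0, t0)" using S(2) y(2) by (simp add: Z_def H_def)
  have HV: "H (u0, t0) \<in> V" using W(2,5) by (auto simp: homeomorphism_def)
  have in1: "(u0, 0) \<in> V1" using Z0 HV by (simp add: V1_def)
  have s\<Phi>: "smooth_on \<Phi> V1" unfolding \<Phi>_def
    by (rule smooth_on_compose[OF W(6) oV1 W(4) _ smooth_on_subset[OF sZ]]) (auto simp: V1_def)
  have \<Phi>0: "\<Phi> (u0, 0) = (u0, t0)" using W(2,5) by (simp add: \<Phi>_def Z0 homeomorphism_def)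
  have "(S has_derivative (*) 1) (at (snd (u0, 0::real)))" using S(3) by (simp add: has_field_derivative_def)
  then have "((\<lambda>q. S (snd q)) has_derivative (\<lambda>w. 1 * snd w)) (at (u0, 0::real))"
    by (rule has_derivative_compose[OF bounded_linear_imp_has_derivative[OF bounded_linear_snd]])
  then have dZ: "(Z has_derivative (\<lambda>w. w)) (at (u0, 0))" unfolding Z_def[abs_def]
    by (auto intro!: derivative_eq_intros)
  have "(\<Theta> has_derivative Dif \<Theta> (Z (u0, 0))) (at (Z (u0, 0)))"
    using smooth_on_has_derivative[OF W(6)] HV Z0 by simp
  from has_derivative_compose[OF dZ this] have "Dif \<Phi> (u0, 0) = Dif \<Theta> (Z (u0, 0))"
    unfolding \<Phi>_def[abs_def] by (intro Dif_eqI) simp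
  then have "inj (Dif \<Phi> (u0, 0))" using W(7) HV Z0 by simp
  then obtain V2 where V2: "open V2" "(u0, 0) \<in> V2" "V2 \<subseteq> V1" "surface_chart M f V2 (\<psi> \<circ> \<Phi>)"
    using chart_reparametrize[OF ch oV1 s\<Phi> in1] \<Phi>0 assms(3,4) by (metis subsetD)
  \<comment> \<open>The bound \<open>1\<close> lies below \<open>pi / 2\<close>, so
    \<open>cos\<close> will be positive on \<open>J'\<close>.\<close>
  have "open (V2 \<inter> UNIV \<times> {-1<..<1})" using V2(1) by (intro open_Int open_Times) auto
  then obtain I' J' where IJ: "open_interval I'" "open_interval J'" "u0 \<in> I'" "0 \<in> J'"
    "I' \<times> J' \<subseteq> V2 \<inter> UNIV \<times> {-1<..<1}"
    using open_rectangle[of "V2 \<inter> UNIV \<times> {-1<..<1}" u0 0] V2(2) by auto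
  have 1: "\<Phi> (u, v) \<in> A \<and> fst (\<Phi> (u, v)) = u \<and> y (\<Phi> (u, v)) = S v" if "u \<in> I'" "v \<in> J'" for u v
  proof -
    have "(u, v) \<in> V1" using that IJ(5) V2(3) by auto
    then have "Z (u, v) \<in> V" by (simp add: V1_def)
    then have "\<Phi> (u, v) \<in> W" "H (\<Phi> (u, v)) = Z (u, v)" using W(5) by (auto simp: \<Phi>_def homeomorphism_def)
    then show ?thesis using W(3) by (auto simp: H_def Z_def)
  qed
  have "open (I' \<times> J')" using IJ by (intro open_Times open_intervalD)
  then have 2: "surface_chart M f (I' \<times> J') (\<psi> \<circ> \<Phi>)" using chart_subset[OF V2(4)] IJ(5) by blast
  have 3: "J' \<subseteq> {-1<..<1}" using IJ(3,5) by auto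
  show ?thesis by (rule that[OF IJ(1-4) 3 \<Phi>0 1 2])
qed

lemma powr_minus_half_sq: "x > 0 \<Longrightarrow> (x powr - (1 / 2))\<^sup>2 = 1 / (x::real)"
  by (simp add: power2_eq_square powr_add[symmetric] powr_minus_divide)

locale signed_tube_chart = tube_chart +
  fixes \<epsilon>'' :: real
  assumes eps'': "\<epsilon>'' = 1 \<or> \<epsilon>'' = - 1"
    and sgn_fibre: "\<And>q. q \<in> I \<times> J \<Longrightarrow> sgn (pnorm2 p (Dif F q (0, 1))) = \<epsilon>''"
begin

lemma unit_fibre_field:
  assumes "t0 \<in> J"
  obtains E where "smooth_on E I" "\<And>u. u \<in> I \<Longrightarrow> pnorm2 p (E u) = \<epsilon>''"
    "\<And>u. u \<in> I \<Longrightarrow> \<exists>c>0. E u = c *\<^sub>R Ft (u, t0)"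
proof -
  define X where "X u = Ft (u, t0)" for u
  \<comment> \<open>Multiplication by \<open>\<epsilon>''\<close> makes the square norm positive, so
    that its powers are smooth.\<close>
  define P where "P u = \<epsilon>'' * pnorm2 p (X u)" for u
  define E where "E u = (P u powr (- 1 / 2)) *\<^sub>R X u" for u
  have P: "P u > 0" "pnorm2 p (X u) = \<epsilon>'' * P u" if "u \<in> I" for u
    using sgn_fibre[of "(u, t0)"] eps'' that assms by (auto simp: P_def X_def sgn_if split: if_splits)
  have sX: "smooth_on X I" unfolding X_def
    by (rule smooth_on_slice[OF smooth_on_Dif[OF smooth_F] open_I open_J assms])
  have "smooth_on P I" unfolding P_def
    by (intro smooth_on_mult smooth_on_const smooth_on_pinner sX open_I)
  then have "smooth_on (\<lambda>u. P u powr (- 1 / 2)) I"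
    using P(1) by (intro smooth_on_compose[OF smooth_on_powr] open_I open_greaterThan) auto
  then have "smooth_on E I" unfolding E_def by (intro smooth_on_scaleR sX open_I)
  moreover have "pnorm2 p (E u) = \<epsilon>''" if "u \<in> I" for u
  proof -
    have "pnorm2 p (E u) = (P u powr (- 1 / 2))\<^sup>2 * (\<epsilon>'' * P u)"
      using P(2)[OF that] by (simp add: E_def pinner_simps power2_eq_square)
    then show ?thesis using P(1)[OF that] by (simp add: powr_minus_half_sq)
  qed
  moreover have "\<exists>c>0. E u = c *\<^sub>R Ft (u, t0)" if "u \<in> I" for u
    using P(1)[OF that] by (intro exI[of _ "P u powr (- 1 / 2)"]) (simp add: E_def X_def)
  ultimately show ?thesis using that by blast
qed

end

text \<open>
  The vector \<open>W\<close> is the component of \<open>F\<close> normal to the focal curve, rescaled so that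
  \<open>F = s (\<gamma> + r W)\<close>; its norm \<open>\<sigma> \<epsilon>'\<close> and that of the fibre direction have the same sign exactly
  when the critical constant is positive.
\<close>

locale nonparabolic_tube_chart = signed_tube_chart +
  fixes k0 \<sigma> s :: real and \<gamma> :: "real \<Rightarrow> real^4" and W :: "real \<times> real \<Rightarrow> real^4"
  assumes k0: "k0 = 1 + \<epsilon> * \<epsilon>' * r\<^sup>2" "k0 \<noteq> 0" and \<sigma>: "\<sigma> = sgn k0" and s: "s = \<bar>k0\<bar> powr (- 1 / 2)"
    and \<gamma>_eq: "\<And>u. \<gamma> u = (\<sigma> * s) *\<^sub>R \<Gamma> u"
    and W_eq: "\<And>q. W q = (\<sigma> * s) *\<^sub>R ((\<epsilon> * \<epsilon>' * r) *\<^sub>R F q - n q)"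
begin

lemma s_pos: "s > 0" and s_sq: "s\<^sup>2 * (\<sigma> * k0) = 1" and \<sigma>_cases: "\<sigma> = 1 \<or> \<sigma> = - 1" and \<sigma>_sq: "\<sigma> * \<sigma> = 1"
proof -
  show "s > 0" "\<sigma> = 1 \<or> \<sigma> = - 1" "\<sigma> * \<sigma> = 1" using k0(2) by (auto simp: s \<sigma> sgn_if)
  have "\<sigma> * k0 = \<bar>k0\<bar>" by (simp add: \<sigma> sgn_if)
  then show "s\<^sup>2 * (\<sigma> * k0) = 1" using k0(2) by (simp add: s powr_minus_half_sq)
qed

lemma \<gamma>_F: "u \<in> I \<Longrightarrow> t \<in> J \<Longrightarrow> \<gamma> u = (\<sigma> * s) *\<^sub>R (F (u, t) + r *\<^sub>R n (u, t))"
  by (simp add: \<gamma>_eq focal)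

text \<open>The multiples of \<open>n\<close> cancel, and \<open>F\<close> is left with the
  coefficient \<open>s\<^sup>2 * (\<sigma> * k0) = 1\<close>. In \<open>n_decomposition\<close> it
  is the multiples of \<open>F\<close> that cancel.\<close>

lemma F_decomposition:
  assumes "u \<in> I" "t \<in> J"
  shows "F (u, t) = s *\<^sub>R (\<gamma> u + r *\<^sub>R W (u, t))"
proof -
  have "s *\<^sub>R (\<gamma> u + r *\<^sub>R W (u, t)) = (s\<^sup>2 * (\<sigma> * k0)) *\<^sub>R F (u, t)"
    by (simp add: \<gamma>_F[OF assms] W_eq k0 algebra_simps power2_eq_square)
  then show ?thesis by (simp add: s_sq)
qed

lemma n_decomposition:
  assumes "u \<in> I" "t \<in> J"
  shows "n (u, t) = s *\<^sub>R ((\<epsilon> * \<epsilon>' * r) *\<^sub>R \<gamma> u - W (u, t))"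
proof -
  have "s *\<^sub>R ((\<epsilon> * \<epsilon>' * r) *\<^sub>R \<gamma> u - W (u, t)) = (s\<^sup>2 * (\<sigma> * k0)) *\<^sub>R n (u, t)"
    by (simp add: \<gamma>_F[OF assms] W_eq k0 algebra_simps power2_eq_square)
  then show ?thesis by (simp add: s_sq)
qed

lemma F_products:
  assumes "q \<in> I \<times> J" "\<epsilon> \<noteq> 0"
  shows "pnorm2 p (F q) = \<epsilon>" "pinner p (F q) (n q) = 0" "pinner p (n q) (F q) = 0" "pinner p (F q) (Dif F q w) = 0"
  using F_in[OF assms(1)] \<nu>_n[OF assms(1)] \<nu>_Dif_F[OF assms(1)] assms(2)
  by (auto simp: Q3_def Q3_normal_def pinner_commute[of p "n q" "F q"])

text \<open>For \<open>\<epsilon> \<noteq> 0\<close>,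
  \<open>(\<epsilon> * \<epsilon>' * r) F - n\<close> has square norm
  \<open>r\<^sup>2 * \<epsilon> + \<epsilon>' = \<epsilon>' * k0\<close>, which the factor
  \<open>s\<close> normalizes.\<close>

lemma W_norm:
  assumes "q \<in> I \<times> J"
  shows "pnorm2 p (W q) = \<sigma> * \<epsilon>'"
proof (cases "\<epsilon> = 0")
  case True
  then show ?thesis using n_norm[OF assms] s_sq \<sigma>_sq k0(1)
    by (simp add: W_eq pinner_simps) (metis mult.assoc mult.commute mult.right_neutral power2_eq_square)
next
  case False
  have "pnorm2 p (W q) = (\<sigma> * s)\<^sup>2 * ((\<epsilon> * \<epsilon>' * r)\<^sup>2 * \<epsilon> + \<epsilon>')"
    using F_products[OF assms False] n_norm[OF assms] by (simp add: W_eq pinner_simps power2_eq_square algebra_simps)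
  also have "\<dots> = \<sigma> * \<epsilon>' * (s\<^sup>2 * (\<sigma> * k0))"
    using eps eps' False \<sigma>_cases by (auto simp: k0 power2_eq_square algebra_simps)
  finally show ?thesis by (simp add: s_sq)
qed

text \<open>For \<open>\<epsilon> \<noteq> 0\<close>, the square norm of \<open>F + r n\<close> is
  \<open>\<epsilon> + r\<^sup>2 * \<epsilon>' = \<epsilon> * k0\<close>; after normalization only
  the sign of \<open>k0\<close> survives.\<close>

lemma \<gamma>_in: "u \<in> I \<Longrightarrow> t \<in> J \<Longrightarrow> \<gamma> u \<in> Q3 p (\<epsilon> * \<sigma>)"
proof (cases "\<epsilon> = 0")
  case True
  assume "u \<in> I" "t \<in> J"
  then show ?thesis using True F_in[of "(u, t)"] \<nu>_n[of "(u, t)"]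
    by (simp add: \<gamma>_F[of u t] Q3_def Q3_normal_def pinner_axis_4)
next
  case False
  assume ut: "u \<in> I" "t \<in> J"
  then have q: "(u, t) \<in> I \<times> J" by simp
  have "pnorm2 p (\<gamma> u) = (\<sigma> * s)\<^sup>2 * (\<epsilon> + r\<^sup>2 * \<epsilon>')"
    using F_products[OF q False] n_norm[OF q] by (simp add: \<gamma>_F[OF ut] pinner_simps power2_eq_square algebra_simps)
  also have "\<dots> = \<epsilon> * \<sigma> * (s\<^sup>2 * (\<sigma> * k0))"
    using eps False \<sigma>_cases by (auto simp: k0 power2_eq_square algebra_simps)
  finally show ?thesis using False \<sigma>_cases by (auto simp: Q3_def s_sq)
qed

abbreviation "\<mu> u \<equiv> Q3_normal (\<epsilon> * \<sigma>) (\<gamma> u)"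

lemma \<mu>_eq:
  assumes "u \<in> I" "t \<in> J"
  shows "\<mu> u = (if \<epsilon> = 0 then \<nu> (u, t) else (\<sigma> * s) *\<^sub>R (\<nu> (u, t) + r *\<^sub>R n (u, t)))"
  using \<sigma>_cases by (auto simp: Q3_normal_def \<gamma>_F[OF assms])

lemma \<mu>_Ft: "u \<in> I \<Longrightarrow> t \<in> J \<Longrightarrow> pinner p (\<mu> u) (Ft (u, t)) = 0"
  using \<nu>_Dif_F[of "(u, t)" "(0, 1)"] n_normal[of "(u, t)" "(0, 1)"] by (auto simp: \<mu>_eq[of u t] pinner_simps)

lemma \<mu>_\<Gamma>': "u \<in> I \<Longrightarrow> t \<in> J \<Longrightarrow> pinner p (\<mu> u) (\<Gamma>' u) = 0"
  using \<nu>_\<Gamma>'[of u t] n_orth_\<Gamma>'[of u t] by (auto simp: \<mu>_eq[of u t] pinner_simps)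

text \<open>For \<open>\<epsilon> \<noteq> 0\<close>, the coefficient of \<open>F\<close> in
  \<open>W\<close> is chosen for this: the product of \<open>F + r n\<close> with
  \<open>(\<epsilon> * \<epsilon>' * r) F - n\<close> is
  \<open>\<epsilon>' * r * (\<epsilon>\<^sup>2 - 1) = 0\<close>.\<close>

lemma \<mu>_W:
  assumes "u \<in> I" "t \<in> J"
  shows "pinner p (\<mu> u) (W (u, t)) = 0"
proof (cases "\<epsilon> = 0")
  case True
  then have "\<mu> u = Q3_normal 0 (F (u, t))" using \<mu>_eq[OF assms] by simp
  then show ?thesis using True assms \<nu>_n[of "(u, t)"] by (simp add: W_eq pinner_simps)
next
  case False
  have q: "(u, t) \<in> I \<times> J" using assms by simp
  have "\<epsilon> * \<epsilon> = 1" using eps False by auto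
  then show ?thesis using False F_products[OF q False] n_norm[OF q]
    by (simp add: \<gamma>_F[OF assms] W_eq pinner_simps Q3_normal_def algebra_simps)
qed

lemma W_\<Gamma>':
  assumes "u \<in> I" "t \<in> J"
  shows "pinner p (W (u, t)) (\<Gamma>' u) = 0"
  using \<nu>_\<Gamma>'[OF assms] n_orth_\<Gamma>'[OF assms] by (cases "\<epsilon> = 0") (auto simp: W_eq pinner_simps Q3_normal_def)

lemma W_Ft:
  assumes "q \<in> I \<times> J"
  shows "pinner p (W q) (Ft q) = 0"
  using \<nu>_Dif_F[OF assms, of "(0, 1)"] n_normal[OF assms, of "(0, 1)"]
  by (cases "\<epsilon> = 0") (auto simp: W_eq pinner_simps Q3_normal_def)

lemma smooth_W: "smooth_on W (I \<times> J)"
  unfolding W_eq[abs_def]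
  by (intro smooth_on_scaleR smooth_on_diff smooth_on_const smooth_F smooth_n open_IJ)

text \<open>Along the fibre \<open>n_t\<close> is a multiple of \<open>F_t\<close>, so
  \<open>W\<close> moves in the fibre direction. The nonzero coefficient will make a frame
  coordinate of \<open>W\<close> a coordinate on the fibre.\<close>

lemma dW:
  assumes "u \<in> I" "t \<in> J"
  shows "Dif W (u, t) (0, 1) = (1 / (s * r)) *\<^sub>R Ft (u, t)"
proof -
  have q: "(u, t) \<in> I \<times> J" using assms by simp
  have "(W has_derivative (\<lambda>w. (\<sigma> * s) *\<^sub>R ((\<epsilon> * \<epsilon>' * r) *\<^sub>R Dif F (u, t) w - Dif n (u, t) w))) (at (u, t))"
    unfolding W_eq[abs_def]
    by (intro has_derivative_scaleR_right has_derivative_diff dF dn q)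
  then have "Dif W (u, t) (0, 1) = (\<sigma> * s) *\<^sub>R ((\<epsilon> * \<epsilon>' * r) *\<^sub>R Ft (u, t) - Dif n (u, t) (0, 1))"
    by (simp add: Dif_eqI)
  also have "Dif n (u, t) (0, 1) = - (1 / r) *\<^sub>R Ft (u, t)"
  proof -
    have "Dif n (u, t) (0, 1) = (1 / r) *\<^sub>R (r *\<^sub>R Dif n (u, t) (0, 1))" using r_pos by simp
    also have "r *\<^sub>R Dif n (u, t) (0, 1) = - Ft (u, t)" using Dif_n[OF assms, of "(0, 1)"] by simp
    finally show ?thesis by simp
  qed
  also have "(\<sigma> * s) *\<^sub>R ((\<epsilon> * \<epsilon>' * r) *\<^sub>R Ft (u, t) - - (1 / r) *\<^sub>R Ft (u, t))
      = (\<sigma> * s * (\<epsilon> * \<epsilon>' * r + 1 / r)) *\<^sub>R Ft (u, t)"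
    by (simp add: algebra_simps)
  also have "\<sigma> * s * (\<epsilon> * \<epsilon>' * r + 1 / r) = (s\<^sup>2 * (\<sigma> * k0)) / (s * r)"
    using r_pos s_pos by (simp add: k0 field_simps power2_eq_square)
  finally show ?thesis by (simp add: s_sq)
qed

lemma \<gamma>_has_vector_derivative: "u \<in> I \<Longrightarrow> vector_derivative \<gamma> (at u) = (\<sigma> * s) *\<^sub>R \<Gamma>' u"
  unfolding \<gamma>_eq[abs_def]
  using smooth_on_has_vector_derivative[OF smooth_\<Gamma>]
  by (intro vector_derivative_at) (auto intro!: derivative_eq_intros)

lemma regular_\<gamma>: "regular_curve I \<gamma>"
  unfolding regular_curve_def
proof
  show "smooth_on \<gamma> I" unfolding \<gamma>_eq[abs_def] by (intro smooth_on_scaleR smooth_on_const smooth_\<Gamma> open_I)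
  show "\<forall>u\<in>I. vector_derivative \<gamma> (at u) \<noteq> 0"
    using \<gamma>_has_vector_derivative \<Gamma>'_nonzero s_pos \<sigma>_cases by auto
qed

text \<open>For every \<open>t\<close> the vector \<open>W (u, t)\<close> lies in the normal plane
  of \<open>\<gamma>\<close> at \<open>u\<close>. Its value at \<open>t0\<close> and the unit fibre
  direction there are orthogonal and not null, hence span that plane, and the fibre is described by
  two coordinates.\<close>

lemma normal_frame:
  assumes t0: "t0 \<in> J"
  obtains e1 e2 where "smooth_on e1 I" "smooth_on e2 I"
    "\<And>u. u \<in> I \<Longrightarrow> e1 u = W (u, t0)" "\<And>u. u \<in> I \<Longrightarrow> \<exists>c>0. e2 u = c *\<^sub>R Ft (u, t0)"
    "\<And>u. u \<in> I \<Longrightarrow> pnorm2 p (e1 u) = \<sigma> * \<epsilon>'" "\<And>u. u \<in> I \<Longrightarrow> pnorm2 p (e2 u) = \<epsilon>''"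
    "\<And>u. u \<in> I \<Longrightarrow> pinner p (e1 u) (e2 u) = 0"
    "\<And>u. u \<in> I \<Longrightarrow> curve_normal_space p (\<epsilon> * \<sigma>) \<gamma> u = span {e1 u, e2 u}"
    "\<And>u t. u \<in> I \<Longrightarrow> t \<in> J \<Longrightarrow>
      W (u, t) = (\<sigma> * \<epsilon>' * pinner p (W (u, t)) (e1 u)) *\<^sub>R e1 u + (\<epsilon>'' * pinner p (W (u, t)) (e2 u)) *\<^sub>R e2 u"
proof -
  obtain e2 where e2: "smooth_on e2 I" "\<And>u. u \<in> I \<Longrightarrow> pnorm2 p (e2 u) = \<epsilon>''"
    "\<And>u. u \<in> I \<Longrightarrow> \<exists>c>0. e2 u = c *\<^sub>R Ft (u, t0)"
    using unit_fibre_field[OF t0] by blast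
  define e1 where "e1 u = W (u, t0)" for u
  have s1: "smooth_on e1 I" unfolding e1_def by (rule smooth_on_slice[OF smooth_W open_I open_J t0])
  have n1: "pnorm2 p (e1 u) = \<sigma> * \<epsilon>'" if "u \<in> I" for u using W_norm that t0 by (simp add: e1_def)
  have o: "pinner p (e1 u) (e2 u) = 0" "pinner p (\<mu> u) (e1 u) = 0" "pinner p (\<mu> u) (e2 u) = 0"
    "pinner p (\<Gamma>' u) (e1 u) = 0" "pinner p (\<Gamma>' u) (e2 u) = 0" if uI: "u \<in> I" for u
  proof -
    obtain c where c: "e2 u = c *\<^sub>R Ft (u, t0)" using e2(3)[OF uI] by blast
    show "pinner p (e1 u) (e2 u) = 0" "pinner p (\<mu> u) (e1 u) = 0" "pinner p (\<mu> u) (e2 u) = 0"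
      "pinner p (\<Gamma>' u) (e1 u) = 0" "pinner p (\<Gamma>' u) (e2 u) = 0"
      using uI t0 by (simp_all add: c e1_def pinner_simps W_Ft \<mu>_W \<mu>_Ft W_\<Gamma>' Ft_orth_\<Gamma>' pinner_commute[of p "\<Gamma>' u"])
  qed
  have nz: "pnorm2 p (e1 u) \<noteq> 0" "pnorm2 p (e2 u) \<noteq> 0" if "u \<in> I" for u
    using n1[OF that] e2(2)[OF that] eps' eps'' \<sigma>_cases by auto
  have sp: "curve_normal_space p (\<epsilon> * \<sigma>) \<gamma> u = span {e1 u, e2 u}" if "u \<in> I" for u
    using that o[OF that] nz[OF that] t0 s_pos \<sigma>_cases \<Gamma>'_nonnull[OF that t0] \<mu>_\<Gamma>'[OF that t0]
    by (intro curve_normal_space_eq_span[of \<gamma> u p "\<epsilon> * \<sigma>" "\<Gamma>' u" "e1 u" "e2 u" "\<sigma> * s"])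
      (auto simp: \<gamma>_in \<gamma>_has_vector_derivative)
  have ex: "W (u, t) = (\<sigma> * \<epsilon>' * pinner p (W (u, t)) (e1 u)) *\<^sub>R e1 u + (\<epsilon>'' * pinner p (W (u, t)) (e2 u)) *\<^sub>R e2 u"
    if ut: "u \<in> I" "t \<in> J" for u t
  proof -
    have "W (u, t) \<in> curve_normal_space p (\<epsilon> * \<sigma>) \<gamma> u"
      using \<mu>_W[OF ut] W_\<Gamma>'[OF ut] ut
      by (simp add: curve_normal_space_def tangent_Q3_iff \<gamma>_has_vector_derivative pinner_simps)
    then obtain x y where xy: "W (u, t) = x *\<^sub>R e1 u + y *\<^sub>R e2 u" unfolding sp[OF ut(1)] span_pair by blast
    have "pinner p (W (u, t)) (e1 u) = x * (\<sigma> * \<epsilon>')" "pinner p (W (u, t)) (e2 u) = y * \<epsilon>''"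
      using n1[OF ut(1)] e2(2)[OF ut(1)] o(1)[OF ut(1)]
      unfolding xy by (simp_all add: pinner_simps pinner_commute[of p "e2 u" "e1 u"])
    then have "\<sigma> * \<epsilon>' * pinner p (W (u, t)) (e1 u) = x" "\<epsilon>'' * pinner p (W (u, t)) (e2 u) = y"
      using eps' eps'' \<sigma>_cases by auto
    then show ?thesis using xy by simp
  qed
  show ?thesis using that[OF s1 e2(1) _ e2(3) n1 e2(2) o(1) sp ex] by (simp add: e1_def)
qed

text \<open>Here \<open>(C, S)\<close> is \<open>(cos, sin)\<close> or \<open>(cosh, sinh)\<close>.\<close>

lemma tube_parametrization:
  fixes M :: "'m::topological_space set"
  assumes ch: "surface_chart M f (I \<times> J) \<psi>" and q0: "(u0, t0) \<in> I \<times> J"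
    and S: "smooth_on S UNIV" "S 0 = 0" "(S has_real_derivative 1) (at (0::real))"
    and CS: "\<And>v. (C v)\<^sup>2 + \<sigma> * \<epsilon>' * \<epsilon>'' * (S v)\<^sup>2 = 1" "\<And>v. v \<in> {-1<..<1} \<Longrightarrow> C v > 0"
  obtains I' J' \<Phi> e1 e2 where "open_interval I'" "open_interval J'" "I' \<subseteq> I" "u0 \<in> I'" "0 \<in> J'"
    "\<Phi> (u0, 0) = (u0, t0)" "surface_chart M f (I' \<times> J') (\<psi> \<circ> \<Phi>)"
    "smooth_on e1 I'" "smooth_on e2 I'"
    "\<And>u. u \<in> I' \<Longrightarrow> pnorm2 p (e1 u) = \<sigma> * \<epsilon>'" "\<And>u. u \<in> I' \<Longrightarrow> pnorm2 p (e2 u) = \<epsilon>''"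
    "\<And>u. u \<in> I' \<Longrightarrow> pinner p (e1 u) (e2 u) = 0"
    "\<And>u. u \<in> I' \<Longrightarrow> curve_normal_space p (\<epsilon> * \<sigma>) \<gamma> u = span {e1 u, e2 u}"
    "\<And>u v. u \<in> I' \<Longrightarrow> v \<in> J' \<Longrightarrow> F (\<Phi> (u, v)) = s *\<^sub>R (\<gamma> u + r *\<^sub>R (C v *\<^sub>R e1 u + S v *\<^sub>R e2 u))"
    "\<And>u v. u \<in> I' \<Longrightarrow> v \<in> J' \<Longrightarrow>
      n (\<Phi> (u, v)) = s *\<^sub>R ((\<epsilon> * \<epsilon>' * r) *\<^sub>R \<gamma> u - (C v *\<^sub>R e1 u + S v *\<^sub>R e2 u))"
proof -
  have u0: "u0 \<in> I" "t0 \<in> J" using q0 by auto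
  obtain e1 e2 where e: "smooth_on e1 I" "smooth_on e2 I"
    "\<And>u. u \<in> I \<Longrightarrow> e1 u = W (u, t0)" "\<And>u. u \<in> I \<Longrightarrow> \<exists>c>0. e2 u = c *\<^sub>R Ft (u, t0)"
    "\<And>u. u \<in> I \<Longrightarrow> pnorm2 p (e1 u) = \<sigma> * \<epsilon>'" "\<And>u. u \<in> I \<Longrightarrow> pnorm2 p (e2 u) = \<epsilon>''"
    "\<And>u. u \<in> I \<Longrightarrow> pinner p (e1 u) (e2 u) = 0"
    "\<And>u. u \<in> I \<Longrightarrow> curve_normal_space p (\<epsilon> * \<sigma>) \<gamma> u = span {e1 u, e2 u}"
    "\<And>u t. u \<in> I \<Longrightarrow> t \<in> J \<Longrightarrow>
      W (u, t) = (\<sigma> * \<epsilon>' * pinner p (W (u, t)) (e1 u)) *\<^sub>R e1 u + (\<epsilon>'' * pinner p (W (u, t)) (e2 u)) *\<^sub>R e2 u"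
    by (rule normal_frame[OF u0(2)]) blast
  define x where "x q = \<sigma> * \<epsilon>' * pinner p (W q) (e1 (fst q))" for q
  define y where "y q = \<epsilon>'' * pinner p (W q) (e2 (fst q))" for q
  have sx: "smooth_on x (I \<times> J)" unfolding x_def
    by (intro smooth_on_mult smooth_on_const smooth_on_pinner smooth_W smooth_on_comp_fst e open_I open_J open_IJ)
  have sy: "smooth_on y (I \<times> J)" unfolding y_def
    by (intro smooth_on_mult smooth_on_const smooth_on_pinner smooth_W smooth_on_comp_fst e open_I open_J open_IJ)
  have Wxy: "W (u, t) = x (u, t) *\<^sub>R e1 u + y (u, t) *\<^sub>R e2 u" if "u \<in> I" "t \<in> J" for u t
    using e(9)[OF that] by (simp add: x_def y_def)
  \<comment> \<open>Along each fibre \<open>x\<^sup>2 + \<sigma> * \<epsilon>' * \<epsilon>'' *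
    y\<^sup>2 = 1\<close>. The set \<open>A\<close> isolates the part of this conic with
    \<open>x > 0\<close>; at the base point \<open>x = 1\<close>.\<close>
  define A where "A = (I \<times> J) \<inter> x -` {0<..}"
  have oA: "open A" unfolding A_def
    by (rule continuous_open_preimage[OF smooth_on_continuous_on[OF sx] open_IJ open_greaterThan])
  have "x (u0, t0) = (\<sigma> * \<epsilon>')\<^sup>2" using e(3,5)[OF u0(1)] by (simp add: x_def power2_eq_square)
  then have A0: "(u0, t0) \<in> A" using q0 eps' \<sigma>_cases by (auto simp: A_def)
  have y0: "y (u0, t0) = 0" using e(3,7)[OF u0(1)] by (simp add: y_def)
  obtain c where c: "c > 0" "e2 u0 = c *\<^sub>R Ft (u0, t0)" using e(4)[OF u0(1)] by blast
  define y' where "y' w = \<epsilon>'' * (pinner p (W (u0, t0)) (fst w *\<^sub>R vector_derivative e2 (at u0)) + pinner p (Dif W (u0, t0) w) (e2 u0))" for w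
  have dy: "(y has_derivative y') (at (u0, t0))"
  proof -
    have "((\<lambda>q. pinner p (W q) (e2 (fst q))) has_derivative
        (\<lambda>w. pinner p (W (u0, t0)) (fst w *\<^sub>R vector_derivative e2 (at u0)) + pinner p (Dif W (u0, t0) w) (e2 (fst (u0, t0))))) (at (u0, t0))"
      by (rule bounded_bilinear.FDERIV[OF bounded_bilinear_pinner smooth_on_has_derivative[OF smooth_W q0] has_derivative_comp_fst[OF e(2) u0(1)]])
    then show ?thesis unfolding y_def[abs_def] y'_def[abs_def]
      using has_derivative_mult_right by fastforce
  qed
  \<comment> \<open>The term with the derivative of \<open>e2\<close> carries the factor
    \<open>fst (0, 1) = 0\<close>; what remains pairs two nonzero multiples of \<open>Ft\<close>,
    which is not null.\<close>
  have "y' (0, 1) = \<epsilon>'' * ((1 / (s * r)) * c * pnorm2 p (Ft (u0, t0)))"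
    by (simp add: y'_def dW[OF u0] c(2) pinner_simps pinner.zero_right)
  then have y'0: "y' (0, 1) \<noteq> 0" using eps'' s_pos r_pos c(1) Ft_nonnull[OF u0] by auto
  obtain I' J' \<Phi> where IJ: "open_interval I'" "open_interval J'" "u0 \<in> I'" "0 \<in> J'" "J' \<subseteq> {-1<..<1}"
    "\<Phi> (u0, 0) = (u0, t0)"
    "\<And>u v. u \<in> I' \<Longrightarrow> v \<in> J' \<Longrightarrow> \<Phi> (u, v) \<in> A \<and> fst (\<Phi> (u, v)) = u \<and> y (\<Phi> (u, v)) = S v"
    "surface_chart M f (I' \<times> J') (\<psi> \<circ> \<Phi>)"
    using fibre_coordinate[OF ch oA _ A0 sy y0 dy y'0 S] unfolding A_def by blast
  have II: "I' \<subseteq> I"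
  proof
    fix u assume "u \<in> I'"
    then have "\<Phi> (u, 0) \<in> I \<times> J" "fst (\<Phi> (u, 0)) = u" using IJ(7)[of u 0] IJ(4) by (auto simp: A_def)
    then show "u \<in> I" by auto
  qed
  have \<Phi>: "\<exists>t\<in>J. \<Phi> (u, v) = (u, t) \<and> W (u, t) = C v *\<^sub>R e1 u + S v *\<^sub>R e2 u" if uv: "u \<in> I'" "v \<in> J'" for u v
  proof -
    obtain t where t: "\<Phi> (u, v) = (u, t)" using IJ(7)[OF uv] by (cases "\<Phi> (u, v)") auto
    then have tJ: "u \<in> I" "t \<in> J" "x (u, t) > 0" "y (u, t) = S v" using IJ(7)[OF uv] by (auto simp: A_def)
    \<comment> \<open>The constant norm of \<open>W\<close> turns \<open>y = S v\<close> into
      \<open>x\<^sup>2 = (C v)\<^sup>2\<close>, and positivity of \<open>x\<close> and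
      \<open>C v\<close> removes the squares.\<close>
    have "pnorm2 p (W (u, t)) = (x (u, t))\<^sup>2 * (\<sigma> * \<epsilon>') + (y (u, t))\<^sup>2 * \<epsilon>''"
      unfolding Wxy[OF tJ(1,2)] using pnorm2_orthogonal_combination[OF e(7)[OF tJ(1)]] e(5,6)[OF tJ(1)] by simp
    then have "(x (u, t))\<^sup>2 * (\<sigma> * \<epsilon>') + (S v)\<^sup>2 * \<epsilon>'' = \<sigma> * \<epsilon>'" using W_norm[of "(u, t)"] tJ by simp
    then have "(x (u, t))\<^sup>2 + \<sigma> * \<epsilon>' * \<epsilon>'' * (S v)\<^sup>2 = 1" using eps' \<sigma>_cases by (auto simp: algebra_simps)
    then have "(x (u, t))\<^sup>2 = (C v)\<^sup>2" using CS(1)[of v] by simp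
    moreover have "C v > 0" using CS(2) IJ(5) uv(2) by blast
    ultimately have "x (u, t) = C v" using tJ(3) by (simp add: power2_eq_iff_nonneg)
    then show ?thesis using t tJ Wxy by auto
  qed
  have FN: "F (\<Phi> (u, v)) = s *\<^sub>R (\<gamma> u + r *\<^sub>R (C v *\<^sub>R e1 u + S v *\<^sub>R e2 u))"
    "n (\<Phi> (u, v)) = s *\<^sub>R ((\<epsilon> * \<epsilon>' * r) *\<^sub>R \<gamma> u - (C v *\<^sub>R e1 u + S v *\<^sub>R e2 u))" if uv: "u \<in> I'" "v \<in> J'" for u v
    using \<Phi>[OF uv] F_decomposition[of u] n_decomposition[of u] II uv(1) by auto
  have fr: "pnorm2 p (e1 u) = \<sigma> * \<epsilon>'" "pnorm2 p (e2 u) = \<epsilon>''" "pinner p (e1 u) (e2 u) = 0"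
    "curve_normal_space p (\<epsilon> * \<sigma>) \<gamma> u = span {e1 u, e2 u}" if "u \<in> I'" for u
    using e(5-8)[of u] subsetD[OF II that] by simp_all
  show ?thesis
    by (rule that[OF IJ(1,2) II IJ(3,4,6,8) smooth_on_subset[OF e(1) II] smooth_on_subset[OF e(2) II] fr FN])
qed

end

section \<open>Parabolic tubes\<close>

lemma smooth_antiderivative:
  fixes \<omega> :: "real \<Rightarrow> real"
  assumes "open I" "u0 \<in> I" "smooth_on \<omega> I"
  obtains I' v0 where "open_interval I'" "u0 \<in> I'" "I' \<subseteq> I" "smooth_on v0 I'" "v0 u0 = 0"
    "\<And>u. u \<in> I' \<Longrightarrow> (v0 has_vector_derivative \<omega> u) (at u)"
proof -
  obtain d where d: "d > 0" "cball u0 d \<subseteq> I" using assms(1,2) open_contains_cball by blast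
  then have sub: "{u0 - d..u0 + d} \<subseteq> I" by (simp add: cball_eq_atLeastAtMost)
  obtain g where g: "\<And>x. x \<in> {u0 - d..u0 + d} \<Longrightarrow> (g has_vector_derivative \<omega> x) (at x within {u0 - d..u0 + d})"
    using antiderivative_continuous[of "u0 - d" "u0 + d" \<omega>]
      continuous_on_subset[OF smooth_on_continuous_on[OF assms(3)] sub] by blast
  define I' where "I' = {u0 - d<..<u0 + d}"
  have II: "I' \<subseteq> I" using sub by (auto simp: I'_def)
  have oI: "open_interval I'" using d(1) by (auto simp: I'_def open_interval_def is_interval_oo)
  define v0 where "v0 u = g u - g u0" for u
  have dv: "(v0 has_vector_derivative \<omega> u) (at u)" if "u \<in> I'" for u
  proof -
    have "(g has_vector_derivative \<omega> u) (at u)"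
      using g[of u] that by (simp add: I'_def at_within_Icc_at)
    then show ?thesis unfolding v0_def[abs_def] by (auto intro!: derivative_eq_intros)
  qed
  have "smooth_on v0 I'"
  proof (rule smooth_on_derivI)
    show "open I'" using open_intervalD[OF oI] by blast
    show "(v0 has_derivative (\<lambda>h. h * \<omega> u)) (at u)" if "u \<in> I'" for u
      using dv[OF that] by (simp add: has_vector_derivative_def)
    show "smooth_on (\<lambda>u. w * \<omega> u) I'" for w
      using open_intervalD[OF oI] by (intro smooth_on_mult smooth_on_const smooth_on_subset[OF assms(3) II])
  qed
  then show ?thesis using that[OF oI _ II _ _ dv] d(1) by (simp add: v0_def I'_def)
qed

text \<open>
  In the parabolic case the focal curve is null. The curve \<open>\<delta>\<^sub>+\<close> has to be an orthogonal trajectory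
  of the fibres; as the fibres are parabolas, it is reached from \<open>D = F(\<cdot>, t\<^sub>0)\<close> by a null rotation
  about \<open>\<Gamma>\<close> whose parameter \<open>v\<^sub>0\<close> solves a differential equation that is a mere quadrature.
\<close>

locale parabolic_tube_chart = signed_tube_chart +
  assumes r1: "r = 1" and eps_nonzero: "\<epsilon> \<noteq> 0" and eps'_eq: "\<epsilon>' = - \<epsilon>"
begin

lemma sign_relations: "\<epsilon> * \<epsilon> = 1" "\<epsilon>'' * \<epsilon>'' = 1"
  using eps eps_nonzero eps'' by auto

lemma \<nu>_eq_F: "\<nu> q = F q"
  using eps_nonzero by (simp add: Q3_normal_def)

lemma n_eq: "u \<in> I \<Longrightarrow> t \<in> J \<Longrightarrow> n (u, t) = \<Gamma> u - F (u, t)"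
  using focal[of u t] r1 by (simp add: algebra_simps eq_diff_eq)

lemma F_norm: "q \<in> I \<times> J \<Longrightarrow> pnorm2 p (F q) = \<epsilon>"
  using F_in eps_nonzero by (auto simp: Q3_def)

text \<open>This is \<open>F \<bottom> n\<close> with \<open>n = \<Gamma> - F\<close>. It places the
  fibre in the section of the quadric by an affine hyperplane attached to the null vector
  \<open>\<Gamma> u\<close>; within the orthogonal complement of \<open>\<Gamma>' u\<close> that
  section is a parabola.\<close>

lemma F_\<Gamma>: "u \<in> I \<Longrightarrow> t \<in> J \<Longrightarrow> pinner p (F (u, t)) (\<Gamma> u) = \<epsilon>"
  using \<nu>_n[of "(u, t)"] F_norm[of "(u, t)"] by (simp add: \<nu>_eq_F n_eq pinner_simps)

lemma \<Gamma>_null: "u \<in> I \<Longrightarrow> t \<in> J \<Longrightarrow> pnorm2 p (\<Gamma> u) = 0"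
  using n_norm[of "(u, t)"] F_\<Gamma>[of u t] F_norm[of "(u, t)"] eps'_eq
  by (simp add: n_eq pinner_simps pinner_commute[of p "\<Gamma> u" "F (u, t)"])

lemma F_\<Gamma>': "u \<in> I \<Longrightarrow> t \<in> J \<Longrightarrow> pinner p (F (u, t)) (\<Gamma>' u) = 0"
  using \<nu>_\<Gamma>' by (simp add: \<nu>_eq_F)

lemma \<Gamma>_\<Gamma>': "u \<in> I \<Longrightarrow> t \<in> J \<Longrightarrow> pinner p (\<Gamma> u) (\<Gamma>' u) = 0"
  using n_orth_\<Gamma>'[of u t] F_\<Gamma>'[of u t] by (simp add: n_eq pinner_simps)

lemma F_Dif: "u \<in> I \<Longrightarrow> t \<in> J \<Longrightarrow> pinner p (F (u, t)) (Dif F (u, t) w) = 0"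
  using \<nu>_Dif_F[of "(u, t)"] by (simp add: \<nu>_eq_F)

lemma \<Gamma>_Dif: "u \<in> I \<Longrightarrow> t \<in> J \<Longrightarrow> pinner p (\<Gamma> u) (Dif F (u, t) w) = 0"
  using n_normal[of "(u, t)" w] F_Dif[of u t w] by (simp add: n_eq pinner_simps)

text \<open>The section \<open>D\<close> and the unit fibre field \<open>E\<close> along it are a
  first choice, since \<open>D\<close> need not cross the fibres orthogonally. For every parameter
  \<open>v0\<close> the null rotation gives \<open>\<delta>p\<close>, \<open>\<delta>m\<close> and
  \<open>e1\<close> the required norms and products, up to one condition: \<open>e1\<close> must be
  orthogonal to \<open>\<delta>p'\<close>, and thereby to \<open>\<delta>m'\<close>. That condition
  determines the derivative of \<open>v0\<close>.\<close>

lemma parabolic_parametrization: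
  fixes M :: "'m::topological_space set"
  assumes ch: "surface_chart M f (I \<times> J) \<psi>" and q0: "(u0, t0) \<in> I \<times> J"
  obtains I' J' \<Phi> \<delta>p \<delta>m e1 where "open_interval I'" "open_interval J'" "I' \<subseteq> I" "u0 \<in> I'" "0 \<in> J'"
    "\<Phi> (u0, 0) = (u0, t0)" "surface_chart M f (I' \<times> J') (\<psi> \<circ> \<Phi>)"
    "parabolic_data p \<epsilon> \<epsilon>'' I' \<delta>p \<delta>m e1"
    "regular_curve I' \<delta>p \<Longrightarrow> orthonormal_normal_frame p \<epsilon> I' \<delta>p \<delta>m e1"
    "regular_curve I' \<delta>m \<Longrightarrow> orthonormal_normal_frame p (- \<epsilon>) I' \<delta>m \<delta>p e1"
    "\<And>u v. u \<in> I' \<Longrightarrow> v \<in> J' \<Longrightarrow> F (\<Phi> (u, v)) = parabolic_map \<epsilon> \<epsilon>'' \<delta>p \<delta>m e1 (u, v)"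
    "\<And>u v. u \<in> I' \<Longrightarrow> v \<in> J' \<Longrightarrow> n (\<Phi> (u, v)) =
      parabolic_map (- \<epsilon>) \<epsilon>'' (\<lambda>t. - (\<epsilon> * \<epsilon>'') *\<^sub>R \<delta>m t) (\<lambda>t. (\<epsilon> * \<epsilon>'') *\<^sub>R \<delta>p t) e1 (u, - v)"
proof -
  have u0: "u0 \<in> I" "t0 \<in> J" using q0 by auto
  define a where "a = \<epsilon> * \<epsilon>''"
  have a: "a * a = 1" "a * \<epsilon> = \<epsilon>''" "a * \<epsilon>'' = \<epsilon>" using eps eps_nonzero eps'' by (auto simp: a_def)
  obtain E where E: "smooth_on E I" "\<And>u. u \<in> I \<Longrightarrow> pnorm2 p (E u) = \<epsilon>''"
    "\<And>u. u \<in> I \<Longrightarrow> \<exists>c>0. E u = c *\<^sub>R Ft (u, t0)"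
    using unit_fibre_field[OF u0(2)] by blast
  define D where "D u = F (u, t0)" for u
  define D' where "D' u = Dif F (u, t0) (1, 0)" for u
  define E' where "E' u = vector_derivative E (at u)" for u
  have sD: "smooth_on D I" unfolding D_def by (rule smooth_on_slice[OF smooth_F open_I open_J u0(2)])
  have sD': "smooth_on D' I" unfolding D'_def by (rule smooth_on_slice[OF smooth_on_Dif[OF smooth_F] open_I open_J u0(2)])
  have dD: "(D has_vector_derivative D' u) (at u)" if "u \<in> I" for u
    unfolding D_def[abs_def] D'_def using that u0(2) by (intro slice_has_vector_derivative dF) auto
  have dE: "(E has_vector_derivative E' u) (at u)" if "u \<in> I" for u
    unfolding E'_def using smooth_on_has_vector_derivative[OF E(1) that] .
  have d\<Gamma>: "(\<Gamma> has_vector_derivative \<Gamma>' u) (at u)" if "u \<in> I" for u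
    using smooth_on_has_vector_derivative[OF smooth_\<Gamma> that] .
  have EF: "pinner p (E u) (D u) = 0" "pinner p (E u) (\<Gamma> u) = 0" "pinner p (E u) (\<Gamma>' u) = 0" if uI: "u \<in> I" for u
  proof -
    obtain c where c: "E u = c *\<^sub>R Ft (u, t0)" using E(3)[OF uI] by blast
    show "pinner p (E u) (D u) = 0" "pinner p (E u) (\<Gamma> u) = 0" "pinner p (E u) (\<Gamma>' u) = 0"
      using F_Dif[OF uI u0(2), of "(0, 1)"] \<Gamma>_Dif[OF uI u0(2), of "(0, 1)"] Ft_orth_\<Gamma>'[OF uI u0(2)]
      by (simp_all add: c D_def pinner_simps pinner_commute[of p "Ft (u, t0)"])
  qed
  \<comment> \<open>Orthogonality of \<open>e1\<close> to the velocity of \<open>\<delta>p\<close>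
    will read \<open>\<epsilon>'' * v0' + \<omega> = 0\<close>, and \<open>\<omega>\<close> does not
    involve \<open>v0\<close>.\<close>
  define \<omega> where "\<omega> u = pinner p (E u) (D' u)" for u
  have s\<omega>: "smooth_on (\<lambda>u. - \<epsilon>'' * \<omega> u) I" unfolding \<omega>_def
    by (intro smooth_on_mult smooth_on_const smooth_on_pinner sD' E open_I)
  obtain I0 v0 where I0: "open_interval I0" "u0 \<in> I0" "I0 \<subseteq> I" and v0: "smooth_on v0 I0" "v0 u0 = 0"
    "\<And>u. u \<in> I0 \<Longrightarrow> (v0 has_vector_derivative - \<epsilon>'' * \<omega> u) (at u)"
    using smooth_antiderivative[OF open_I u0(1) s\<omega>] by metis
  have oI0: "open I0" using open_intervalD I0 by blast
  have in_I: "u \<in> I" if "u \<in> I0" for u using I0(3) that by blast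
  have prods: "pnorm2 p (D u) = \<epsilon>" "pnorm2 p (E u) = \<epsilon>''" "pnorm2 p (\<Gamma> u) = 0"
    "pinner p (D u) (E u) = 0" "pinner p (E u) (D u) = 0" "pinner p (D u) (\<Gamma> u) = \<epsilon>" "pinner p (\<Gamma> u) (D u) = \<epsilon>"
    "pinner p (E u) (\<Gamma> u) = 0" "pinner p (\<Gamma> u) (E u) = 0"
    "pinner p (D u) (\<Gamma>' u) = 0" "pinner p (E u) (\<Gamma>' u) = 0" "pinner p (\<Gamma> u) (\<Gamma>' u) = 0"
    "pinner p (D u) (D' u) = 0" "pinner p (E u) (D' u) = \<omega> u" "pinner p (\<Gamma> u) (D' u) = 0"
    "pinner p (D u) (E' u) = - \<omega> u" "pinner p (E u) (E' u) = 0" "pinner p (\<Gamma> u) (E' u) = 0"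
    if u: "u \<in> I" for u
  proof -
    show "pnorm2 p (D u) = \<epsilon>" "pnorm2 p (E u) = \<epsilon>''" "pnorm2 p (\<Gamma> u) = 0"
      "pinner p (D u) (E u) = 0" "pinner p (E u) (D u) = 0" "pinner p (D u) (\<Gamma> u) = \<epsilon>" "pinner p (\<Gamma> u) (D u) = \<epsilon>"
      "pinner p (E u) (\<Gamma> u) = 0" "pinner p (\<Gamma> u) (E u) = 0"
      "pinner p (D u) (\<Gamma>' u) = 0" "pinner p (E u) (\<Gamma>' u) = 0" "pinner p (\<Gamma> u) (\<Gamma>' u) = 0"
      "pinner p (D u) (D' u) = 0" "pinner p (E u) (D' u) = \<omega> u" "pinner p (\<Gamma> u) (D' u) = 0"
      using u u0(2) F_norm[of "(u, t0)"] F_\<Gamma>[of u t0] \<Gamma>_null[of u t0] F_\<Gamma>'[of u t0] \<Gamma>_\<Gamma>'[of u t0] F_Dif[of u t0] \<Gamma>_Dif[of u t0]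
        E(2)[OF u] EF[OF u]
      by (simp_all add: D_def D'_def \<omega>_def pinner_commute[of p "F (u, t0)" "E u"]
        pinner_commute[of p "\<Gamma> u" "E u"] pinner_commute[of p "\<Gamma> u" "F (u, t0)"])
    have "pinner p (D u) (E' u) + pinner p (D' u) (E u) = 0"
      by (rule pinner_const_vector_derivative[OF open_I u _ dD[OF u] dE[OF u], of p 0]) (simp add: EF pinner_commute[of p "D _"])
    then show "pinner p (D u) (E' u) = - \<omega> u" by (simp add: \<omega>_def pinner_commute[of p "D' u"])
    have "pinner p (E u) (E' u) + pinner p (E' u) (E u) = 0"
      by (rule pinner_const_vector_derivative[OF open_I u E(2) dE[OF u] dE[OF u]])
    then show "pinner p (E u) (E' u) = 0" by (simp add: pinner_commute[of p "E' u"])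
    have "pinner p (\<Gamma> u) (E' u) + pinner p (\<Gamma>' u) (E u) = 0"
      by (rule pinner_const_vector_derivative[OF open_I u _ d\<Gamma>[OF u] dE[OF u], of p 0]) (simp add: EF pinner_commute[of p "\<Gamma> _"])
    then show "pinner p (\<Gamma> u) (E' u) = 0" using EF(3)[OF u] by (simp add: pinner_commute[of p "\<Gamma>' u"])
  qed
  \<comment> \<open>The null rotation fixes \<open>\<Gamma>\<close> and preserves the norms and
    products of \<open>D\<close> and \<open>E\<close>; the coefficient of \<open>\<Gamma>\<close> in
    \<open>\<delta>p\<close> is forced by
    \<open>pnorm2 p (\<delta>p u) = \<epsilon>\<close>.\<close>
  define \<delta>p where "\<delta>p u = D u + v0 u *\<^sub>R E u - (a * (v0 u * v0 u) * (1 / 2)) *\<^sub>R \<Gamma> u" for u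
  define e1 where "e1 u = E u - (a * v0 u) *\<^sub>R \<Gamma> u" for u
  \<comment> \<open>This is \<open>- a\<close> times \<open>\<Gamma> - \<delta>p\<close>, the unit
    normal where \<open>F\<close> equals \<open>\<delta>p\<close>. With this sign,
    \<open>- (a * (v\<^sup>2 / 2))\<close> times \<open>\<Gamma>\<close> is the same multiple of
    \<open>\<delta>p\<close> plus \<open>v\<^sup>2 / 2\<close> times \<open>\<delta>m\<close>, which
    is the shape of \<open>parabolic_map\<close>.\<close>
  define \<delta>m where "\<delta>m u = a *\<^sub>R (\<delta>p u - \<Gamma> u)" for u
  have ss: "smooth_on \<delta>p I0" "smooth_on e1 I0"
    unfolding \<delta>p_def e1_def
    by (intro smooth_on_diff smooth_on_add smooth_on_scaleR smooth_on_mult smooth_on_const v0(1) oI0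
        smooth_on_subset[OF sD I0(3)] smooth_on_subset[OF E(1) I0(3)] smooth_on_subset[OF smooth_\<Gamma> I0(3)])+
  have sm: "smooth_on \<delta>m I0" unfolding \<delta>m_def
    by (intro smooth_on_diff smooth_on_scaleR smooth_on_const oI0 ss smooth_on_subset[OF smooth_\<Gamma> I0(3)])
  define v0' where "v0' u = - \<epsilon>'' * \<omega> u" for u
  define \<delta>p' where "\<delta>p' u = D' u + (v0 u *\<^sub>R E' u + v0' u *\<^sub>R E u) -
    ((a * (v0 u * v0 u) * (1 / 2)) *\<^sub>R \<Gamma>' u + (a * v0 u * v0' u) *\<^sub>R \<Gamma> u)" for u
  have d\<delta>p: "(\<delta>p has_vector_derivative \<delta>p' u) (at u)" if u: "u \<in> I0" for u
  proof -
    have v: "(v0 has_real_derivative v0' u) (at u)"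
      using v0(3)[OF u] by (simp add: has_real_derivative_iff_has_vector_derivative v0'_def)
    have "((\<lambda>u. a * (v0 u * v0 u) * (1 / 2)) has_real_derivative (a * v0 u * v0' u)) (at u)"
      by (auto intro!: derivative_eq_intros v simp: algebra_simps)
    then show ?thesis unfolding \<delta>p_def[abs_def] \<delta>p'_def
      by (intro has_vector_derivative_diff has_vector_derivative_add has_vector_derivative_scaleR v
          dD[OF in_I[OF u]] dE[OF in_I[OF u]] d\<Gamma>[OF in_I[OF u]])
  qed
  define \<delta>m' where "\<delta>m' u = a *\<^sub>R (\<delta>p' u - \<Gamma>' u)" for u
  have d\<delta>m: "(\<delta>m has_vector_derivative \<delta>m' u) (at u)" if u: "u \<in> I0" for u
    unfolding \<delta>m_def[abs_def] \<delta>m'_def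
    by (auto intro!: derivative_eq_intros d\<delta>p[OF u] d\<Gamma>[OF in_I[OF u]])
  have vp: "vector_derivative \<delta>p (at u) = \<delta>p' u" and vm: "vector_derivative \<delta>m (at u) = \<delta>m' u" if "u \<in> I0" for u
    using vector_derivative_at[OF d\<delta>p[OF that]] vector_derivative_at[OF d\<delta>m[OF that]] by auto
  have a\<epsilon>: "a * (x * \<epsilon>) = x * \<epsilon>''" "a * (x * \<epsilon>'') = x * \<epsilon>" "a * (a * x) = x" "\<epsilon>'' * (\<epsilon>'' * x) = x" for x
    using a sign_relations by (metis mult.commute mult.left_commute mult.right_neutral)+
  have P: "pnorm2 p (\<delta>p u) = \<epsilon>" "pinner p (\<delta>p u) (\<Gamma> u) = \<epsilon>" "pnorm2 p (e1 u) = \<epsilon>''"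
    "pinner p (e1 u) (\<delta>p u) = 0" "pinner p (e1 u) (\<Gamma> u) = 0"
    "pinner p (\<Gamma> u) (\<delta>p' u) = 0" "pinner p (e1 u) (\<delta>p' u) = 0"
    "pinner p (\<delta>p u) (\<Gamma>' u) = 0" "pinner p (e1 u) (\<Gamma>' u) = 0"
    if u: "u \<in> I0" for u
    using prods[OF in_I[OF u]] a a\<epsilon> sign_relations
    by (simp_all add: \<delta>p_def e1_def \<delta>p'_def v0'_def pinner_simps algebra_simps)
  have Pp: "pinner p (\<delta>p u) (\<delta>p' u) = 0" if u: "u \<in> I0" for u
    using pinner_const_vector_derivative[OF oI0 u P(1) d\<delta>p[OF u] d\<delta>p[OF u]]
    by (simp add: pinner_commute[of p "\<delta>p' u"])
  have Q: "pnorm2 p (\<delta>m u) = - \<epsilon>" "pinner p (\<delta>p u) (\<delta>m u) = 0" "pinner p (\<delta>p' u) (\<delta>m u) = 0"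
    "pinner p (\<delta>m' u) (\<delta>p u) = 0" "pinner p (e1 u) (\<delta>m u) = 0" "pinner p (e1 u) (\<delta>m' u) = 0"
    "pinner p (\<delta>m u) (\<Gamma>' u) = 0" "pinner p (\<delta>m u) (\<delta>m' u) = 0"
    if u: "u \<in> I0" for u
    using P[OF u] Pp[OF u] a a\<epsilon> prods(3,12)[OF in_I[OF u]]
    by (simp_all add: \<delta>m_def \<delta>m'_def pinner_simps pinner_commute[of p "\<Gamma> u" "\<delta>p u"] pinner_commute[of p "\<delta>p' u"]
      pinner_commute[of p "\<Gamma>' u"])
  have \<Gamma>_dec: "\<Gamma> u = \<delta>p u - a *\<^sub>R \<delta>m u" for u using a(1) by (simp add: \<delta>m_def)
  have nn: "pnorm2 p (\<delta>p u) \<noteq> 0" "pnorm2 p (e1 u) \<noteq> 0" "pnorm2 p (\<delta>m u) \<noteq> 0" "pnorm2 p (\<Gamma>' u) \<noteq> 0" if u: "u \<in> I0" for u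
    using P[OF u] Q[OF u] \<Gamma>'_nonnull[OF in_I[OF u] u0(2)] eps_nonzero eps'' by auto
  \<comment> \<open>\<open>\<delta>p\<close>, \<open>e1\<close>, \<open>\<delta>m\<close> and
    \<open>\<Gamma>'\<close> form an orthogonal basis of \<open>R^4\<close>. Since
    \<open>\<delta>p'\<close> and \<open>\<delta>m'\<close> are orthogonal to the first three, they
    are multiples of \<open>\<Gamma>'\<close>.\<close>
  have expand: "X = (pinner p X (\<delta>p u) / \<epsilon>) *\<^sub>R \<delta>p u + (pinner p X (e1 u) / \<epsilon>'') *\<^sub>R e1 u +
      (pinner p X (\<delta>m u) / - \<epsilon>) *\<^sub>R \<delta>m u + (pinner p X (\<Gamma>' u) / pnorm2 p (\<Gamma>' u)) *\<^sub>R \<Gamma>' u" if u: "u \<in> I0" for u X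
    using orthogonal_expansion[of p "\<delta>p u" "e1 u" "\<delta>m u" "\<Gamma>' u" X] nn[OF u] P[OF u] Q[OF u]
    by (simp add: pinner_commute[of p "\<delta>p u" "e1 u"])
  have para_p: "\<delta>p' u = (pinner p (\<delta>p' u) (\<Gamma>' u) / pnorm2 p (\<Gamma>' u)) *\<^sub>R \<Gamma>' u" if u: "u \<in> I0" for u
    using expand[OF u, of "\<delta>p' u"] Pp[OF u] P[OF u] Q[OF u]
    by (simp add: pinner_commute[of p "\<delta>p' u" "\<delta>p u"] pinner_commute[of p "\<delta>p' u" "e1 u"])
  have para_m: "\<delta>m' u = (pinner p (\<delta>m' u) (\<Gamma>' u) / pnorm2 p (\<Gamma>' u)) *\<^sub>R \<Gamma>' u" if u: "u \<in> I0" for u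
    using expand[OF u, of "\<delta>m' u"] Q[OF u]
    by (simp add: pinner_commute[of p "\<delta>m' u" "\<delta>m u"] pinner_commute[of p "\<delta>m' u" "e1 u"])
  define y where "y q = \<epsilon>'' * pinner p (F q) (e1 (fst q))" for q
  have formula: "F (u, t) = (1 - a * ((y (u, t))\<^sup>2 / 2)) *\<^sub>R \<delta>p u + y (u, t) *\<^sub>R e1 u + ((y (u, t))\<^sup>2 / 2) *\<^sub>R \<delta>m u"
    if u: "u \<in> I0" and t: "t \<in> J" for u t
  proof -
    define \<alpha> where "\<alpha> = pinner p (F (u, t)) (\<delta>p u) / \<epsilon>"
    define \<zeta> where "\<zeta> = pinner p (F (u, t)) (\<delta>m u) / - \<epsilon>"
    have y: "y (u, t) = pinner p (F (u, t)) (e1 u) / \<epsilon>''" using eps'' by (auto simp: y_def)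
    have F: "F (u, t) = \<alpha> *\<^sub>R \<delta>p u + y (u, t) *\<^sub>R e1 u + \<zeta> *\<^sub>R \<delta>m u"
      using expand[OF u, of "F (u, t)"] F_\<Gamma>'[OF in_I[OF u] t] by (simp add: \<alpha>_def \<zeta>_def y)
    \<comment> \<open>The product of \<open>F\<close> with
      \<open>\<Gamma> = \<delta>p - a \<delta>m\<close> is \<open>\<epsilon>\<close>, which ties the
      coordinates together by \<open>\<alpha> + a * \<zeta> = 1\<close>; the norm of
      \<open>F\<close> then leaves \<open>\<zeta> = y\<^sup>2 / 2\<close>.\<close>
    have "pinner p (F (u, t)) (\<delta>m u) = a * (pinner p (F (u, t)) (\<delta>p u) - \<epsilon>)"
      using F_\<Gamma>[OF in_I[OF u] t] by (simp add: \<delta>m_def pinner_simps)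
    then have \<zeta>: "\<zeta> = - a * (\<alpha> - 1)" using eps_nonzero by (simp add: \<alpha>_def \<zeta>_def field_simps)
    then have \<alpha>: "\<alpha> = 1 - a * \<zeta>" using a(1) by algebra
    have "\<epsilon> = pnorm2 p (\<alpha> *\<^sub>R \<delta>p u + y (u, t) *\<^sub>R e1 u + \<zeta> *\<^sub>R \<delta>m u)"
      using F_norm[of "(u, t)"] in_I[OF u] t F by simp
    also have "\<dots> = \<alpha>\<^sup>2 * \<epsilon> + (y (u, t))\<^sup>2 * \<epsilon>'' - \<zeta>\<^sup>2 * \<epsilon>"
      using P[OF u] Q[OF u]
      by (simp add: pinner_simps power2_eq_square pinner_commute[of p "\<delta>p u" "e1 u"] pinner_commute[of p "\<delta>m u" "e1 u"]
        pinner_commute[of p "\<delta>m u" "\<delta>p u"])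
    also have "\<alpha>\<^sup>2 = 1 - 2 * (a * \<zeta>) + \<zeta>\<^sup>2"
      using a(1) unfolding \<alpha> power2_eq_square by algebra
    finally have "(y (u, t))\<^sup>2 * \<epsilon>'' = 2 * \<zeta> * (a * \<epsilon>)" by (simp add: algebra_simps)
    then have "(y (u, t))\<^sup>2 = 2 * \<zeta>" using a(2) eps'' by auto
    then have z: "\<zeta> = (y (u, t))\<^sup>2 / 2" by simp
    show ?thesis using F unfolding \<alpha> z .
  qed
  have c0: "surface_chart M f (I0 \<times> J) \<psi>"
    using chart_subset[OF ch] open_Times[OF oI0 open_J] I0(3) by blast
  have sy: "smooth_on y (I0 \<times> J)" unfolding y_def
    by (intro smooth_on_mult smooth_on_const smooth_on_pinner smooth_on_comp_fst ss oI0 open_J open_Times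
        smooth_on_subset[OF smooth_F]) (use I0(3) in auto)
  \<comment> \<open>As \<open>v0\<close> vanishes at \<open>u0\<close>, the rotated field is there
    the fibre direction itself, so \<open>y\<close> has nonzero derivative along the fibre at the
    base point.\<close>
  have e10: "e1 u0 = E u0" using v0(2) by (simp add: e1_def)
  have y0: "y (u0, t0) = 0" using EF(1)[OF u0(1)] e10 by (simp add: y_def D_def pinner_commute[of p "F _"])
  define y' where "y' w = \<epsilon>'' * (pinner p (F (u0, t0)) (fst w *\<^sub>R vector_derivative e1 (at u0)) + pinner p (Dif F (u0, t0) w) (e1 u0))" for w
  have dy: "(y has_derivative y') (at (u0, t0))"
  proof -
    have "((\<lambda>q. pinner p (F q) (e1 (fst q))) has_derivative
        (\<lambda>w. pinner p (F (u0, t0)) (fst w *\<^sub>R vector_derivative e1 (at u0)) + pinner p (Dif F (u0, t0) w) (e1 (fst (u0, t0))))) (at (u0, t0))"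
      by (rule bounded_bilinear.FDERIV[OF bounded_bilinear_pinner dF[OF q0] has_derivative_comp_fst[OF ss(2) I0(2)]])
    then show ?thesis unfolding y_def[abs_def] y'_def[abs_def]
      using has_derivative_mult_right by fastforce
  qed
  obtain c where c: "c > 0" "E u0 = c *\<^sub>R Ft (u0, t0)" using E(3)[OF u0(1)] by blast
  have "y' (0, 1) = \<epsilon>'' * (c * pnorm2 p (Ft (u0, t0)))"
    by (simp add: y'_def e10 c(2) pinner_simps pinner.zero_right)
  then have y'0: "y' (0, 1) \<noteq> 0" using eps'' c(1) Ft_nonnull[OF u0] by auto
  have S: "smooth_on (\<lambda>v::real. v) UNIV" "((\<lambda>v. v) has_real_derivative 1) (at (0::real))"
    by (auto intro: smooth_on_id derivative_eq_intros)
  obtain I' J' \<Phi> where IJ: "open_interval I'" "open_interval J'" "u0 \<in> I'" "0 \<in> J'" "J' \<subseteq> {-1<..<1}"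
    "\<Phi> (u0, 0) = (u0, t0)"
    "\<And>u v. u \<in> I' \<Longrightarrow> v \<in> J' \<Longrightarrow> \<Phi> (u, v) \<in> I0 \<times> J \<and> fst (\<Phi> (u, v)) = u \<and> y (\<Phi> (u, v)) = v"
    "surface_chart M f (I' \<times> J') (\<psi> \<circ> \<Phi>)"
    by (rule fibre_coordinate[OF c0 open_Times[OF oI0 open_J] order.refl _ sy y0 dy y'0 S(1) refl S(2)])
      (use I0(2) u0(2) in auto)
  have II: "I' \<subseteq> I0"
  proof
    fix u assume "u \<in> I'"
    then have "\<Phi> (u, 0) \<in> I0 \<times> J" "fst (\<Phi> (u, 0)) = u" using IJ(7)[of u 0] IJ(4) by auto
    then show "u \<in> I0" by auto
  qed
  have \<Phi>: "\<exists>t\<in>J. \<Phi> (u, v) = (u, t) \<and> y (u, t) = v" if uv: "u \<in> I'" "v \<in> J'" for u v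
    using IJ(7)[OF uv] by (cases "\<Phi> (u, v)") auto
  have FF: "F (\<Phi> (u, v)) = parabolic_map \<epsilon> \<epsilon>'' \<delta>p \<delta>m e1 (u, v)"
    "n (\<Phi> (u, v)) = parabolic_map (- \<epsilon>) \<epsilon>'' (\<lambda>t. - (\<epsilon> * \<epsilon>'') *\<^sub>R \<delta>m t) (\<lambda>t. (\<epsilon> * \<epsilon>'') *\<^sub>R \<delta>p t) e1 (u, - v)"
    if uv: "u \<in> I'" "v \<in> J'" for u v
  proof -
    obtain t where t: "t \<in> J" "\<Phi> (u, v) = (u, t)" "y (u, t) = v" using \<Phi>[OF uv] by blast
    have u: "u \<in> I0" using uv II by blast
    have F: "F (u, t) = (1 - a * (v\<^sup>2 / 2)) *\<^sub>R \<delta>p u + v *\<^sub>R e1 u + (v\<^sup>2 / 2) *\<^sub>R \<delta>m u"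
      using formula[OF u t(1)] t(3) by simp
    show "F (\<Phi> (u, v)) = parabolic_map \<epsilon> \<epsilon>'' \<delta>p \<delta>m e1 (u, v)"
      by (simp add: t(2) F parabolic_map_def a_def)
    have "n (u, t) = \<delta>p u - a *\<^sub>R \<delta>m u - ((1 - a * (v\<^sup>2 / 2)) *\<^sub>R \<delta>p u + v *\<^sub>R e1 u + (v\<^sup>2 / 2) *\<^sub>R \<delta>m u)"
      using n_eq[OF in_I[OF u] t(1)] F \<Gamma>_dec[of u] by simp
    \<comment> \<open>The factor \<open>a * a = 1\<close> is inserted so that \<open>- a\<close> can
      be extracted from the coefficient of \<open>\<delta>m\<close>, as the parabolic map for
      \<open>- \<epsilon>\<close> demands.\<close>
    also have "\<dots> = (a * (v\<^sup>2 / 2)) *\<^sub>R \<delta>p u - v *\<^sub>R e1 u - (a + a * a * (v\<^sup>2 / 2)) *\<^sub>R \<delta>m u"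
      unfolding a(1) by (simp add: algebra_simps)
    also have "\<dots> = (1 - (- \<epsilon>) * \<epsilon>'' * ((- v)\<^sup>2 / 2)) *\<^sub>R (- (\<epsilon> * \<epsilon>'') *\<^sub>R \<delta>m u) + (- v) *\<^sub>R e1 u + ((- v)\<^sup>2 / 2) *\<^sub>R ((\<epsilon> * \<epsilon>'') *\<^sub>R \<delta>p u)"
      by (simp add: a_def algebra_simps)
    finally show "n (\<Phi> (u, v)) = parabolic_map (- \<epsilon>) \<epsilon>'' (\<lambda>t. - (\<epsilon> * \<epsilon>'') *\<^sub>R \<delta>m t) (\<lambda>t. (\<epsilon> * \<epsilon>'') *\<^sub>R \<delta>p t) e1 (u, - v)"
      by (simp add: t(2) parabolic_map_def)
  qed
  note sub = smooth_on_subset[OF ss(1) II] smooth_on_subset[OF ss(2) II] smooth_on_subset[OF sm II]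
  have data: "parabolic_data p \<epsilon> \<epsilon>'' I' \<delta>p \<delta>m e1"
    unfolding parabolic_data_def
  proof (intro conjI ballI sub)
    show "\<delta>p ` I' \<subseteq> Q3 p \<epsilon>" "\<delta>m ` I' \<subseteq> Q3 p (- \<epsilon>)" using P(1) Q(1) II eps_nonzero by (auto simp: Q3_def)
    fix u assume "u \<in> I'"
    then have u: "u \<in> I0" using II by blast
    \<comment> \<open>\<open>\<Gamma>'\<close> never vanishes, so \<open>\<delta>p'\<close> and
      \<open>\<delta>m'\<close> cannot vanish together.\<close>
    have "\<Gamma>' u = \<delta>p' u - a *\<^sub>R \<delta>m' u" using a(1) by (simp add: \<delta>m'_def)
    then show "vector_derivative \<delta>p (at u) \<noteq> 0 \<or> vector_derivative \<delta>m (at u) \<noteq> 0"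
      using \<Gamma>'_nonzero[OF in_I[OF u]] by (auto simp: vp[OF u] vm[OF u])
    show "pinner p (\<delta>p u) (\<delta>m u) = 0" "pinner p (vector_derivative \<delta>p (at u)) (\<delta>m u) = 0"
      "pinner p (vector_derivative \<delta>m (at u)) (\<delta>p u) = 0" "pnorm2 p (e1 u) = \<epsilon>''"
      "pinner p (e1 u) (\<delta>p u) = 0" "pinner p (e1 u) (\<delta>m u) = 0"
      "pinner p (e1 u) (vector_derivative \<delta>p (at u)) = 0" "pinner p (e1 u) (vector_derivative \<delta>m (at u)) = 0"
      using P[OF u] Q[OF u] by (simp_all add: vp[OF u] vm[OF u])
  qed
  have abs1: "\<bar>\<epsilon>\<bar> = 1" "\<bar>\<epsilon>''\<bar> = 1" using eps eps_nonzero eps'' by auto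
  have frame_p: "orthonormal_normal_frame p \<epsilon> I' \<delta>p \<delta>m e1" if reg: "regular_curve I' \<delta>p"
    unfolding orthonormal_normal_frame_def
  proof (intro conjI ballI sub)
    fix u assume uI: "u \<in> I'"
    then have u: "u \<in> I0" using II by blast
    have "\<delta>p' u \<noteq> 0" using reg uI vp[OF u] by (auto simp: regular_curve_def)
    then obtain c where c: "c \<noteq> 0" "vector_derivative \<delta>p (at u) = c *\<^sub>R \<Gamma>' u"
      using para_p[OF u] vp[OF u] by (metis scaleR_zero_left)
    have "curve_normal_space p \<epsilon> \<delta>p u = span {\<delta>m u, e1 u}"
      by (rule curve_normal_space_eq_span[OF _ nn(4)[OF u] nn(3)[OF u] nn(2)[OF u] _ _ _ _ _ _ c(2,1)])
        (use eps_nonzero P[OF u] Q[OF u] in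
          \<open>simp_all add: Q3_def Q3_normal_def pinner_commute[of p "\<delta>m u" "e1 u"] pinner_commute[of p "\<delta>p u" "e1 u"]
            pinner_commute[of p "\<Gamma>' u"]\<close>)
    then show "span {\<delta>m u, e1 u} = curve_normal_space p \<epsilon> \<delta>p u" by simp
    show "\<bar>pnorm2 p (\<delta>m u)\<bar> = 1" "\<bar>pnorm2 p (e1 u)\<bar> = 1" "pinner p (\<delta>m u) (e1 u) = 0"
      using P[OF u] Q[OF u] abs1 by (simp_all add: pinner_commute[of p "\<delta>m u" "e1 u"])
  qed
  have frame_m: "orthonormal_normal_frame p (- \<epsilon>) I' \<delta>m \<delta>p e1" if reg: "regular_curve I' \<delta>m"
    unfolding orthonormal_normal_frame_def
  proof (intro conjI ballI sub)
    fix u assume uI: "u \<in> I'"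
    then have u: "u \<in> I0" using II by blast
    have "\<delta>m' u \<noteq> 0" using reg uI vm[OF u] by (auto simp: regular_curve_def)
    then obtain c where c: "c \<noteq> 0" "vector_derivative \<delta>m (at u) = c *\<^sub>R \<Gamma>' u"
      using para_m[OF u] vm[OF u] by (metis scaleR_zero_left)
    have "curve_normal_space p (- \<epsilon>) \<delta>m u = span {\<delta>p u, e1 u}"
      by (rule curve_normal_space_eq_span[OF _ nn(4)[OF u] nn(1)[OF u] nn(2)[OF u] _ _ _ _ _ _ c(2,1)])
        (use eps_nonzero P[OF u] Q[OF u] in
          \<open>simp_all add: Q3_def Q3_normal_def pinner_commute[of p "\<delta>m u" "e1 u"] pinner_commute[of p "\<delta>p u" "e1 u"]
            pinner_commute[of p "\<Gamma>' u"] pinner_commute[of p "\<delta>m u" "\<delta>p u"]\<close>)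
    then show "span {\<delta>p u, e1 u} = curve_normal_space p (- \<epsilon>) \<delta>m u" by simp
    show "\<bar>pnorm2 p (\<delta>p u)\<bar> = 1" "\<bar>pnorm2 p (e1 u)\<bar> = 1" "pinner p (\<delta>p u) (e1 u) = 0"
      using P[OF u] Q[OF u] abs1 by (simp_all add: pinner_commute[of p "\<delta>p u" "e1 u"])
  qed
  show ?thesis
    by (rule that[OF IJ(1,2) subset_trans[OF II I0(3)] IJ(3,4,6,8) data frame_p frame_m FF])
qed

end

section \<open>The polar surface\<close>

lemma chart_change_domain:
  assumes "surface_chart M f U \<psi>" "\<psi> ` U \<subseteq> P" "P \<subseteq> M"
  shows "surface_chart P f U \<psi>"
  using assms openin_subset_trans[OF chart_openin[OF assms(1)] assms(2,3)] by (auto simp: surface_chart_def)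

text \<open>Zero is not a principal curvature exactly where the derivative of \<open>N\<close> in a
  chart is injective. Composing \<open>N\<close> with a left inverse of this derivative at one point
  shows that injectivity persists nearby, so one shrunken chart serves both \<open>f\<close> and
  \<open>N\<close>.\<close>

lemma polar_chart:
  fixes M :: "'m::topological_space set"
  assumes "smooth_on_surface M f N" "x \<in> polar_domain M f N"
  obtains U \<psi> q where "surface_chart (polar_domain M f N) f U \<psi>" "surface_chart (polar_domain M f N) N U \<psi>"
    "surface_chart M f U \<psi>" "q \<in> U" "\<psi> q = x"
proof -
  let ?P = "polar_domain M f N"
  have x: "x \<in> M" "\<not> principal_curvature M f N x 0" using assms(2) by (auto simp: polar_domain_def)
  obtain U \<psi> where U: "surface_chart M f U \<psi>" "x \<in> \<psi> ` U" "smooth_on (N \<circ> \<psi>) U"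
    using assms(1) x(1) unfolding smooth_on_surface_def by blast
  obtain q0 where q0: "q0 \<in> U" "\<psi> q0 = x" using U(2) by blast
  note diff = smooth_on_differentiable[OF U(3)]
  have inj_iff: "\<not> principal_curvature M f N (\<psi> q) 0 \<longleftrightarrow> inj (Dif (N \<circ> \<psi>) q)" if "q \<in> U" for q
    unfolding principal_curvature_chart[OF U(1) that diff[OF that]] linear_injective_0[OF linear_Dif[OF diff[OF that]]]
    by (metis minus_equation_iff minus_zero scaleR_zero_left)
  obtain \<pi> where \<pi>: "linear \<pi>" "\<pi> \<circ> Dif (N \<circ> \<psi>) q0 = id"
    using linear_injective_left_inverse[OF linear_Dif[OF diff[OF q0(1)]]] inj_iff[OF q0(1)] x(2) q0(2) by auto
  have b\<pi>: "bounded_linear \<pi>" using \<pi>(1) by (simp add: linear_conv_bounded_linear)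
  define k where "k z = \<pi> ((N \<circ> \<psi>) z)" for z
  have sk: "smooth_on k U" unfolding k_def by (intro smooth_on_linear[OF b\<pi>] chart_open[OF U(1)] U(3))
  have dk: "Dif k q = (\<lambda>w. \<pi> (Dif (N \<circ> \<psi>) q w))" if "q \<in> U" for q
    unfolding k_def[abs_def]
    by (intro Dif_eqI bounded_linear.has_derivative[OF b\<pi>] smooth_on_has_derivative[OF U(3) that])
  have "Dif k q0 = id" using dk[OF q0(1)] \<pi>(2) by (simp add: comp_def)
  then obtain W where W: "open W" "q0 \<in> W" "W \<subseteq> U" "\<And>q. q \<in> W \<Longrightarrow> inj (Dif k q)"
    using inverse_of_inj_derivative[OF chart_open[OF U(1)] sk q0(1)] by (metis inj_on_id)
  have inj: "inj (Dif (N \<circ> \<psi>) q)" if "q \<in> W" for q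
  proof -
    have "inj (\<pi> \<circ> Dif (N \<circ> \<psi>) q)" using W(4)[OF that] dk[of q] that W(3) by (auto simp: comp_def)
    then show ?thesis by (rule inj_on_imageI2)
  qed
  have c: "surface_chart M f W \<psi>" using chart_subset[OF U(1) W(1,3)] .
  have "\<psi> q \<in> ?P" if "q \<in> W" for q
    using inj[OF that] inj_iff[of q] chart_in[OF U(1), of q] that W(3) unfolding polar_domain_def by blast
  then have "\<psi> ` W \<subseteq> ?P" by blast
  then have 1: "surface_chart ?P f W \<psi>" by (rule chart_change_domain[OF c]) (auto simp: polar_domain_def)
  then have "surface_chart ?P N W \<psi>" using inj smooth_on_subset[OF U(3) W(3)] by (auto simp: surface_chart_def)
  then show ?thesis using that 1 c W(2) q0(2) by blast
qed

text \<open>\<open>f\<close> and \<open>N\<close> play symmetric roles: differentiating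
  \<open>pinner p (f x) (N x) = 0\<close> moves the derivative from \<open>f\<close> to
  \<open>N\<close>, so that \<open>f\<close> is a unit normal of the surface
  \<open>N\<close>.\<close>

lemma polar_surfaces:
  fixes M :: "'m::topological_space set"
  assumes or: "oriented_surface p \<epsilon> M f N" and \<epsilon>: "\<epsilon> = 1 \<or> \<epsilon> = - 1"
    and N: "\<And>x. x \<in> M \<Longrightarrow> pnorm2 p (N x) = - \<epsilon>"
  defines "P \<equiv> polar_domain M f N"
  shows "oriented_surface p (- \<epsilon>) P N f" "polar_surface p \<epsilon> P N f f" "polar_surface p (- \<epsilon>) P f N N"
proof -
  have sm: "smooth_on_surface M f N" using or by (simp add: oriented_surface_def)
  have PM: "P \<subseteq> M" by (auto simp: P_def polar_domain_def)
  have e: "\<epsilon> \<noteq> 0" using \<epsilon> by auto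
  have fx: "pnorm2 p (f x) = \<epsilon>" "pinner p (f x) (N x) = 0" if "x \<in> M" for x
    using or that e by (auto simp: oriented_surface_def Q3_def tangent_Q3_def)
  have tang: "pinner p (N (\<psi> q)) (Dif (f \<circ> \<psi>) q w) = 0" if "surface_chart M f U \<psi>" "q \<in> U" for U \<psi> q w
  proof -
    have "Dif (f \<circ> \<psi>) q w \<in> tangent_plane M f (\<psi> q)" unfolding tangent_plane_chart[OF that] by blast
    then show ?thesis using or chart_in[OF that] by (auto simp: oriented_surface_def)
  qed
  have ex: "\<exists>U \<psi> q. surface_chart P f U \<psi> \<and> surface_chart P N U \<psi> \<and> surface_chart M f U \<psi> \<and> q \<in> U \<and> \<psi> q = x"
    if "x \<in> P" for x
    using polar_chart[OF sm that[unfolded P_def]] unfolding P_def by metis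
  have immersed: "immersed_surface P f" "immersed_surface P N"
    unfolding immersed_surface_def using ex by (metis image_eqI)+
  have smf: "smooth_on_surface P N f"
    unfolding smooth_on_surface_def using ex chart_smooth by (metis image_eqI)
  have fQ: "f ` P \<subseteq> Q3 p \<epsilon>" and NQ: "N ` P \<subseteq> Q3 p (- \<epsilon>)" using PM fx N e by (auto simp: Q3_def)
  have orth: "pinner p (f x) X = 0" if x: "x \<in> P" and X: "X \<in> tangent_plane P N x" for x X
  proof -
    obtain U \<psi> q where c: "surface_chart P f U \<psi>" "surface_chart P N U \<psi>" "surface_chart M f U \<psi>" "q \<in> U" "\<psi> q = x"
      using ex[OF x] by blast
    obtain w where w: "X = Dif (N \<circ> \<psi>) q w" using X unfolding c(5)[symmetric] tangent_plane_chart[OF c(2,4)] by blast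
    have "pinner p ((f \<circ> \<psi>) q) (Dif (N \<circ> \<psi>) q w) + pinner p (Dif (f \<circ> \<psi>) q w) ((N \<circ> \<psi>) q) = 0"
      by (rule pinner_const_Dif[OF chart_open[OF c(3)] c(4) _ smooth_on_has_derivative[OF chart_smooth[OF c(3)] c(4)]
            smooth_on_has_derivative[OF chart_smooth[OF c(2)] c(4)], of p 0]) (simp add: fx chart_in[OF c(3)])
    then show ?thesis using tang[OF c(3,4), of w] c(5) by (simp add: w pinner_commute[of p "Dif (f \<circ> \<psi>) q w"])
  qed
  show "oriented_surface p (- \<epsilon>) P N f"
    unfolding oriented_surface_def using immersed NQ smf orth e fx PM \<epsilon>
    by (auto simp: tangent_Q3_def pinner_commute[of p "N _"] subset_iff)
  \<comment> \<open>For each of the two surfaces a zero principal curvature would be a kernel vector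
    of the differential of the other one, which is an immersion on \<open>P\<close>.\<close>
  have nz: "\<not> principal_curvature P N f x 0" "\<not> principal_curvature P f N x 0" if x: "x \<in> P" for x
  proof -
    obtain U \<psi> q where c: "surface_chart P f U \<psi>" "surface_chart P N U \<psi>" "surface_chart M f U \<psi>" "q \<in> U" "\<psi> q = x"
      using ex[OF x] by blast
    show "\<not> principal_curvature P N f x 0"
      unfolding c(5)[symmetric] principal_curvature_chart[OF c(2,4) smooth_on_differentiable[OF chart_smooth[OF c(1)] c(4)]]
      using chart_Dif_nonzero[OF c(1,4)] by auto
    show "\<not> principal_curvature P f N x 0"
      unfolding c(5)[symmetric] principal_curvature_chart[OF c(1,4) smooth_on_differentiable[OF chart_smooth[OF c(2)] c(4)]]
      using chart_Dif_nonzero[OF c(2,4)] by auto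
  qed
  show "polar_surface p \<epsilon> P N f f" "polar_surface p (- \<epsilon>) P f N N"
    unfolding polar_surface_def using nz immersed fQ NQ by auto
qed

section \<open>The sign of the fibre direction\<close>

lemma adapted_tube_chart:
  fixes M :: "'m::topological_space set"
  assumes sf: "space_form p \<epsilon>" and or: "oriented_surface p \<epsilon> M f N" and x: "x \<in> M" and r: "r > 0"
    and nu: "\<And>x. x \<in> M \<Longrightarrow> \<not> umbilic M f N x" and pc: "\<And>x. x \<in> M \<Longrightarrow> principal_curvature M f N x (1 / r)"
    and \<epsilon>': "\<epsilon>' = 1 \<or> \<epsilon>' = - 1" and N: "\<And>x. x \<in> M \<Longrightarrow> pnorm2 p (N x) = \<epsilon>'"
  obtains I J \<psi> \<Gamma> where "surface_chart M f (I \<times> J) \<psi>" "x \<in> \<psi> ` (I \<times> J)"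
    "tube_chart p \<epsilon> r \<epsilon>' I J (f \<circ> \<psi>) (N \<circ> \<psi>) \<Gamma>"
proof -
  have sm: "smooth_on_surface M f N" using or by (simp add: oriented_surface_def)
  obtain I J \<psi> \<Gamma> where c: "open_interval I" "open_interval J" "surface_chart M f (I \<times> J) \<psi>"
    "x \<in> \<psi> ` (I \<times> J)" "smooth_on (N \<circ> \<psi>) (I \<times> J)" "smooth_on \<Gamma> I"
    "\<And>u t. u \<in> I \<Longrightarrow> t \<in> J \<Longrightarrow> f (\<psi> (u, t)) + r *\<^sub>R N (\<psi> (u, t)) = \<Gamma> u"
    "\<And>u. u \<in> I \<Longrightarrow> vector_derivative \<Gamma> (at u) \<noteq> 0"
    by (rule adapted_chart_exists[OF sm x r nu[OF x] pc]) blast+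
  have M: "\<psi> q \<in> M" if "q \<in> I \<times> J" for q using chart_in[OF c(3) that] .
  have sec: "\<exists>w \<kappa>. w \<noteq> 0 \<and> \<kappa> \<noteq> 1 / r \<and> - Dif (N \<circ> \<psi>) q w = \<kappa> *\<^sub>R Dif (f \<circ> \<psi>) q w" if q: "q \<in> I \<times> J" for q
  proof -
    obtain \<kappa> where \<kappa>: "principal_curvature M f N (\<psi> q) \<kappa>" "\<kappa> \<noteq> 1 / r"
      using nu[OF M[OF q]] pc[OF M[OF q]] unfolding umbilic_def by blast
    then show ?thesis
      using principal_curvature_chart[OF c(3) q smooth_on_differentiable[OF c(5) q]] by blast
  qed
  have tan: "pinner p (N (\<psi> q)) (Dif (f \<circ> \<psi>) q w) = 0" if q: "q \<in> I \<times> J" for q w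
  proof -
    have "Dif (f \<circ> \<psi>) q w \<in> tangent_plane M f (\<psi> q)" unfolding tangent_plane_chart[OF c(3) q] by blast
    then show ?thesis using or M[OF q] by (auto simp: oriented_surface_def)
  qed
  have "tube_chart p \<epsilon> r \<epsilon>' I J (f \<circ> \<psi>) (N \<circ> \<psi>) \<Gamma>"
  proof (rule tube_chart.intro[OF sf r \<epsilon>' c(1,2) chart_smooth[OF c(3)] c(5,6) _ c(8) chart_inj[OF c(3)]])
    fix q assume q: "q \<in> I \<times> J"
    show "(f \<circ> \<psi>) q \<in> Q3 p \<epsilon>" "(N \<circ> \<psi>) q \<in> tangent_Q3 p \<epsilon> ((f \<circ> \<psi>) q)"
      using or M[OF q] by (auto simp: oriented_surface_def)
    show "pnorm2 p ((N \<circ> \<psi>) q) = \<epsilon>'" using N[OF M[OF q]] by simp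
    show "pinner p ((N \<circ> \<psi>) q) (Dif (f \<circ> \<psi>) q w) = 0" for w using tan[OF q] by simp
    show "\<exists>w \<kappa>. w \<noteq> 0 \<and> \<kappa> \<noteq> 1 / r \<and> - Dif (N \<circ> \<psi>) q w = \<kappa> *\<^sub>R Dif (f \<circ> \<psi>) q w" by (rule sec[OF q])
  next
    show "(f \<circ> \<psi>) (u, t) + r *\<^sub>R (N \<circ> \<psi>) (u, t) = \<Gamma> u" if "u \<in> I" "t \<in> J" for u t
      using c(7)[OF that] by simp
  qed
  then show ?thesis by (rule that[OF c(3,4)])
qed

text \<open>A principal direction for \<open>1 / r\<close> is killed by the derivative of
  \<open>f + r N\<close>, so it is a nonzero real multiple of the fibre vector.\<close>

lemma (in tube_chart) principal_direction_sign:
  fixes M :: "'m::topological_space set"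
  assumes ch: "surface_chart M f (I \<times> J) \<psi>" and F: "F = f \<circ> \<psi>" and n: "n = N \<circ> \<psi>" and q: "q \<in> I \<times> J"
    and X: "principal_direction M f N (\<psi> q) (1 / r) X"
  shows "sgn (pnorm2 p X) = sgn (pnorm2 p (Ft q))"
proof -
  obtain u t where ut: "q = (u, t)" "u \<in> I" "t \<in> J" using q by auto
  have diff: "(N \<circ> \<psi>) differentiable (at q)" using smooth_on_differentiable[OF smooth_n q] by (simp add: n)
  obtain w where w: "w \<noteq> 0" "X = Dif F q w" "- Dif n q w = (1 / r) *\<^sub>R Dif F q w"
    using X unfolding principal_direction_chart[OF ch q diff] F n by blast
  have "Dif F q w + r *\<^sub>R Dif n q w = 0" unfolding eigen_combination[OF w(3)] using r_pos by simp
  then have "fst w *\<^sub>R \<Gamma>' u = 0" using Dif_n[OF ut(2,3), of w] by (simp add: ut(1))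
  then have w1: "fst w = 0" using \<Gamma>'_nonzero[OF ut(2)] by simp
  then have "X = snd w *\<^sub>R Ft q"
    using linear_plane_expand[OF has_derivative_linear[OF dF[OF q]], of w] w(2) by simp
  moreover have "snd w \<noteq> 0" using w(1) w1 by (auto simp: prod_eq_iff)
  ultimately show ?thesis by (simp add: pinner_simps sgn_mult)
qed

lemma fibre_sign_constant:
  fixes M :: "'m::topological_space set"
  assumes sf: "space_form p \<epsilon>" and or: "oriented_surface p \<epsilon> M f N" and "connected M" and r: "r > 0"
    and nu: "\<And>x. x \<in> M \<Longrightarrow> \<not> umbilic M f N x" and pc: "\<And>x. x \<in> M \<Longrightarrow> principal_curvature M f N x (1 / r)"
    and \<epsilon>': "\<epsilon>' = 1 \<or> \<epsilon>' = - 1" and N: "\<And>x. x \<in> M \<Longrightarrow> pnorm2 p (N x) = \<epsilon>'"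
  obtains \<epsilon>'' where "\<epsilon>'' = 1 \<or> \<epsilon>'' = - 1"
    "\<And>x X. x \<in> M \<Longrightarrow> principal_direction M f N x (1 / r) X \<Longrightarrow> sgn (pnorm2 p X) = \<epsilon>''"
proof -
  let ?pd = "\<lambda>x. principal_direction M f N x (1 / r)"
  \<comment> \<open>The choice of \<open>X\<close> is harmless: all principal directions for
    \<open>1 / r\<close> at a point are multiples of one fibre vector, so their square norms have
    the same sign.\<close>
  define g where "g x = sgn (pnorm2 p (SOME X. ?pd x X))" for x
  have some: "?pd x (SOME X. ?pd x X)" if "x \<in> M" for x
    using pc[OF that] unfolding principal_curvature_def by (rule someI_ex)
  have loc: "\<exists>T. openin (top_of_set M) T \<and> x \<in> T \<and> (\<forall>y\<in>T. \<forall>X. ?pd y X \<longrightarrow> sgn (pnorm2 p X) = g x)" and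
    nz: "?pd x X \<Longrightarrow> sgn (pnorm2 p X) \<noteq> 0" if x: "x \<in> M" for x X
  proof -
    obtain I J \<psi> \<Gamma> where c: "surface_chart M f (I \<times> J) \<psi>" "x \<in> \<psi> ` (I \<times> J)"
      "tube_chart p \<epsilon> r \<epsilon>' I J (f \<circ> \<psi>) (N \<circ> \<psi>) \<Gamma>"
      by (rule adapted_tube_chart[OF sf or x r nu pc \<epsilon>' N]) blast+
    interpret tube_chart p \<epsilon> r \<epsilon>' I J "f \<circ> \<psi>" "N \<circ> \<psi>" \<Gamma> by (rule c(3))
    obtain q0 where q0: "q0 \<in> I \<times> J" "\<psi> q0 = x" using c(2) by blast
    note sg = principal_direction_sign[OF c(1) refl refl]
    have gx: "g x = sgn (pnorm2 p (Ft q0))" using sg[OF q0(1)] some[OF x] q0(2) by (simp add: g_def)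
    have "sgn (pnorm2 p X) = g x" if y: "y \<in> \<psi> ` (I \<times> J)" "?pd y X" for y X
    proof -
      obtain q where q: "q \<in> I \<times> J" "\<psi> q = y" using y(1) by blast
      have "?pd (\<psi> q) X" using y(2) q(2) by simp
      from sg[OF q(1) this] show ?thesis using sgn_Ft[OF q(1) q0(1)] gx by simp
    qed
    then show "\<exists>T. openin (top_of_set M) T \<and> x \<in> T \<and> (\<forall>y\<in>T. \<forall>X. ?pd y X \<longrightarrow> sgn (pnorm2 p X) = g x)"
      using chart_openin[OF c(1)] c(2) by blast
    show "sgn (pnorm2 p X) \<noteq> 0" if "?pd x X"
      using sg[OF q0(1)] that q0 Ft_nonnull by (metis mem_Times_iff prod.collapse sgn_zero_iff)
  qed
  have "g constant_on M"
  proof (rule locally_constant_imp_constant[OF assms(3)])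
    fix x assume "x \<in> M"
    from loc[OF this] obtain T where T: "openin (top_of_set M) T" "x \<in> T"
      "\<And>y X. y \<in> T \<Longrightarrow> ?pd y X \<Longrightarrow> sgn (pnorm2 p X) = g x" by blast
    have "g y = g x" if "y \<in> T" for y
    proof -
      have "y \<in> M" using openin_imp_subset[OF T(1)] that by blast
      from T(3)[OF that some[OF this]] show ?thesis unfolding g_def[of y] .
    qed
    then show "\<exists>T. openin (top_of_set M) T \<and> x \<in> T \<and> (\<forall>y\<in>T. g y = g x)" using T by blast
  qed
  then obtain e where e: "\<And>x. x \<in> M \<Longrightarrow> g x = e" unfolding constant_on_def by blast
  have all: "sgn (pnorm2 p X) = e" if "x \<in> M" "?pd x X" for x X using loc[OF that(1)] e[OF that(1)] that by blast
  show ?thesis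
  proof (cases "M = {}")
    case False
    then obtain x where x: "x \<in> M" by blast
    have "e \<noteq> 0" using nz[OF x some[OF x]] all[OF x some[OF x]] by simp
    then have "e = 1 \<or> e = - 1" using e[OF x] by (auto simp: g_def sgn_if split: if_splits)
    then show ?thesis using that all by blast
  qed (use that in blast)
qed

section \<open>Classification\<close>

lemma regular_curve_subset: "regular_curve I \<gamma> \<Longrightarrow> I' \<subseteq> I \<Longrightarrow> regular_curve I' \<gamma>"
  unfolding regular_curve_def using smooth_on_subset by blast

text \<open>Prepares the polar of a tube, whose central curve is \<open>- \<gamma>\<close>.\<close>

lemma curve_normal_space_uminus:
  assumes "(\<gamma> has_vector_derivative \<gamma>') (at u)"
  shows "curve_normal_space p \<eta> (\<lambda>u. - \<gamma> u) u = curve_normal_space p \<eta> \<gamma> u"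
proof -
  have "vector_derivative (\<lambda>u. - \<gamma> u) (at u) = - \<gamma>'" "vector_derivative \<gamma> (at u) = \<gamma>'"
    using assms by (auto intro!: vector_derivative_at derivative_eq_intros)
  then show ?thesis
    by (auto simp: curve_normal_space_def tangent_Q3_def pinner.minus_left pinner.minus_right)
qed

lemma span_pair_uminus: "span {- a, - b} = span {a, b :: 'a::real_vector}"
proof -
  have "X \<in> span {- a, - b} \<longleftrightarrow> X \<in> span {a, b}" for X
    unfolding span_pair by (metis add.inverse_inverse scaleR_minus_left scaleR_minus_right)
  then show ?thesis by blast
qed

text \<open>The sign \<open>\<epsilon>'\<close> can be taken out because its square is
  \<open>1\<close>. If \<open>\<epsilon>''\<close> is a sign too, the critical constant is positive
  exactly when \<open>1 + \<epsilon> * \<epsilon>' * r\<^sup>2\<close> has the sign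
  \<open>\<epsilon>' * \<epsilon>''\<close>.\<close>

lemma critical_constant_eq:
  assumes "r > 0" "\<epsilon>' = 1 \<or> \<epsilon>' = - 1"
  shows "critical_constant \<epsilon> \<epsilon>' \<epsilon>'' r = \<epsilon>'' * \<epsilon>' * (1 + \<epsilon> * \<epsilon>' * r\<^sup>2) / r\<^sup>2"
  using assms by (auto simp: critical_constant_def field_simps)

lemma signed_tube_chart_exists:
  fixes M :: "'m::topological_space set"
  assumes sf: "space_form p \<epsilon>" and or: "oriented_surface p \<epsilon> M f N" and x: "x \<in> M" and r: "r > 0"
    and nu: "\<And>x. x \<in> M \<Longrightarrow> \<not> umbilic M f N x" and pc: "\<And>x. x \<in> M \<Longrightarrow> principal_curvature M f N x (1 / r)"
    and \<epsilon>': "\<epsilon>' = 1 \<or> \<epsilon>' = - 1" and N: "\<And>x. x \<in> M \<Longrightarrow> pnorm2 p (N x) = \<epsilon>'"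
    and \<epsilon>'': "\<epsilon>'' = 1 \<or> \<epsilon>'' = - 1"
    and sg: "\<And>x X. x \<in> M \<Longrightarrow> principal_direction M f N x (1 / r) X \<Longrightarrow> sgn (pnorm2 p X) = \<epsilon>''"
  obtains I J \<psi> \<Gamma> where "surface_chart M f (I \<times> J) \<psi>" "x \<in> \<psi> ` (I \<times> J)"
    "signed_tube_chart p \<epsilon> r \<epsilon>' I J (f \<circ> \<psi>) (N \<circ> \<psi>) \<Gamma> \<epsilon>''"
proof -
  obtain I J \<psi> \<Gamma> where c: "surface_chart M f (I \<times> J) \<psi>" "x \<in> \<psi> ` (I \<times> J)"
    "tube_chart p \<epsilon> r \<epsilon>' I J (f \<circ> \<psi>) (N \<circ> \<psi>) \<Gamma>"
    by (rule adapted_tube_chart[OF sf or x r nu pc \<epsilon>' N]) blast+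
  interpret tube_chart p \<epsilon> r \<epsilon>' I J "f \<circ> \<psi>" "N \<circ> \<psi>" \<Gamma> by (rule c(3))
  have "signed_tube_chart p \<epsilon> r \<epsilon>' I J (f \<circ> \<psi>) (N \<circ> \<psi>) \<Gamma> \<epsilon>''"
  proof (intro signed_tube_chart.intro c(3) signed_tube_chart_axioms.intro \<epsilon>'')
    fix q assume q: "q \<in> I \<times> J"
    obtain X where X: "principal_direction M f N (\<psi> q) (1 / r) X"
      using pc[OF chart_in[OF c(1) q]] unfolding principal_curvature_def by blast
    show "sgn (pnorm2 p (Ft q)) = \<epsilon>''"
      using principal_direction_sign[OF c(1) refl refl q X] sg[OF chart_in[OF c(1) q] X] by simp
  qed
  then show ?thesis by (rule that[OF c(1,2)])
qed

context nonparabolic_tube_chart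
begin

text \<open>Since \<open>\<sigma> = \<epsilon>' * \<epsilon>''\<close>, both frame vectors have
  square norm \<open>\<epsilon>''\<close>, so the normal planes are definite. If
  \<open>\<epsilon>'' = \<epsilon>'\<close>, then \<open>k0 > 0\<close> and the surface follows the
  normal geodesics of \<open>\<gamma>\<close>. If \<open>\<epsilon>'' = - \<epsilon>'\<close>, then
  \<open>k0 < 0\<close>, and it is the normal field that traces a tube, around
  \<open>- \<gamma>\<close> and with \<open>1 / r\<close> in place of \<open>r\<close>.\<close>

lemma elliptic_tube_near:
  fixes M :: "'m::topological_space set"
  assumes ch: "surface_chart M f (I \<times> J) \<psi>" and F: "F = f \<circ> \<psi>" and n: "n = N \<circ> \<psi>"
    and x: "x \<in> \<psi> ` (I \<times> J)" and c: "\<sigma> = \<epsilon>' * \<epsilon>''"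
  shows "\<exists>I J \<gamma> e1 e2 \<psi>.
          regular_curve I \<gamma> \<and> \<gamma> ` I \<subseteq> Q3 p (\<epsilon> * \<epsilon>' * \<epsilon>'') \<and>
          orthonormal_normal_frame p (\<epsilon> * \<epsilon>' * \<epsilon>'') I \<gamma> e1 e2 \<and>
          (\<forall>u\<in>I. definite_metric p (curve_normal_space p (\<epsilon> * \<epsilon>' * \<epsilon>'') \<gamma> u)) \<and>
          parametrized_near M f x I J \<psi> (elliptic_map \<epsilon> \<epsilon>' r \<gamma> e1 e2) \<and>
          (\<epsilon>'' = \<epsilon>' \<longrightarrow>
             elliptic_map \<epsilon> \<epsilon>' r \<gamma> e1 e2 ` (I \<times> UNIV)
               = elliptic_tube p \<epsilon> I \<gamma> (tube_radius \<epsilon> \<epsilon>' r)) \<and>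
          (\<epsilon>'' = - \<epsilon>' \<longrightarrow>
             (\<exists>\<beta> a1 a2.
                regular_curve I \<beta> \<and> \<beta> ` I \<subseteq> Q3 p (- \<epsilon>) \<and>
                orthonormal_normal_frame p (- \<epsilon>) I \<beta> a1 a2 \<and>
                (\<forall>u\<in>I. definite_metric p (curve_normal_space p (- \<epsilon>) \<beta> u)) \<and>
                (\<forall>q\<in>I \<times> J. N (\<psi> q) = elliptic_map (- \<epsilon>) \<epsilon> (1 / r) \<beta> a1 a2 q) \<and>
                elliptic_map (- \<epsilon>) \<epsilon> (1 / r) \<beta> a1 a2 ` (I \<times> UNIV)
                  = elliptic_tube p (- \<epsilon>) I \<beta> (tube_radius (- \<epsilon>) \<epsilon> (1 / r))))"
proof -
  obtain u0 t0 where q0: "(u0, t0) \<in> I \<times> J" "\<psi> (u0, t0) = x" using x by auto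
  have t0: "t0 \<in> J" using q0 by simp
  have \<sigma>\<epsilon>: "\<sigma> * \<epsilon>' = \<epsilon>''" "\<epsilon> * \<epsilon>' * \<epsilon>'' = \<epsilon> * \<sigma>" using eps' by (auto simp: c)
  have CS: "(cos v)\<^sup>2 + \<sigma> * \<epsilon>' * \<epsilon>'' * (sin v)\<^sup>2 = 1" for v
    using eps'' by (auto simp: \<sigma>\<epsilon>)
  have C: "cos v > 0" if "v \<in> {-1<..<1}" for v :: real
    using that pi_gt3 by (intro cos_gt_zero_pi) auto
  have S: "smooth_on (sin :: real \<Rightarrow> real) UNIV" "sin (0 :: real) = 0" "(sin has_real_derivative 1) (at (0::real))"
    using smooth_on_sin_cos DERIV_sin[of "0::real"] by auto
  obtain I' J' \<Phi> e1 e2 where IJ: "open_interval I'" "open_interval J'" "I' \<subseteq> I" "u0 \<in> I'" "0 \<in> J'"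
    "\<Phi> (u0, 0) = (u0, t0)" "surface_chart M f (I' \<times> J') (\<psi> \<circ> \<Phi>)" and
    se: "smooth_on e1 I'" "smooth_on e2 I'"
    "\<And>u. u \<in> I' \<Longrightarrow> pnorm2 p (e1 u) = \<sigma> * \<epsilon>'" "\<And>u. u \<in> I' \<Longrightarrow> pnorm2 p (e2 u) = \<epsilon>''"
    "\<And>u. u \<in> I' \<Longrightarrow> pinner p (e1 u) (e2 u) = 0"
    "\<And>u. u \<in> I' \<Longrightarrow> curve_normal_space p (\<epsilon> * \<sigma>) \<gamma> u = span {e1 u, e2 u}" and
    par: "\<And>u v. u \<in> I' \<Longrightarrow> v \<in> J' \<Longrightarrow> F (\<Phi> (u, v)) = s *\<^sub>R (\<gamma> u + r *\<^sub>R (cos v *\<^sub>R e1 u + sin v *\<^sub>R e2 u))"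
    "\<And>u v. u \<in> I' \<Longrightarrow> v \<in> J' \<Longrightarrow>
      n (\<Phi> (u, v)) = s *\<^sub>R ((\<epsilon> * \<epsilon>' * r) *\<^sub>R \<gamma> u - (cos v *\<^sub>R e1 u + sin v *\<^sub>R e2 u))"
    using tube_parametrization[OF ch q0(1) S CS C] by blast
  note e = se(3)[unfolded \<sigma>\<epsilon>(1)] se(4)
  have oI: "open I'" using IJ(1) open_intervalD by blast
  have xin: "x \<in> (\<psi> \<circ> \<Phi>) ` (I' \<times> J')" using IJ(4-6) q0(2) by force
  have reg: "regular_curve I' \<gamma>" using regular_curve_subset[OF regular_\<gamma> IJ(3)] .
  have \<gamma>Q: "\<gamma> u \<in> Q3 p (\<epsilon> * \<sigma>)" if "u \<in> I'" for u using \<gamma>_in[of u t0] that IJ(3) t0 by blast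
  have d\<gamma>: "(\<gamma> has_vector_derivative vector_derivative \<gamma> (at u)) (at u)" if "u \<in> I'" for u
    using smooth_on_has_vector_derivative reg that by (auto simp: regular_curve_def)
  have abs1: "\<bar>\<epsilon>''\<bar> = 1" using eps'' by auto
  have onf: "orthonormal_normal_frame p (\<epsilon> * \<sigma>) I' \<gamma> e1 e2"
    unfolding orthonormal_normal_frame_def using se(1,2,5,6) e abs1 by simp
  have def: "definite_metric p (curve_normal_space p (\<epsilon> * \<sigma>) \<gamma> u)" if "u \<in> I'" for u
    unfolding se(6)[OF that] by (rule definite_metric_span[OF se(5)[OF that] e(1)[OF that] e(2)[OF that] eps''])
  have emap: "elliptic_map \<epsilon> \<epsilon>' r \<gamma> e1 e2 (u, v) = s *\<^sub>R (\<gamma> u + r *\<^sub>R (cos v *\<^sub>R e1 u + sin v *\<^sub>R e2 u))" for u v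
    by (simp only: elliptic_map_def prod.case s k0(1))
  have pn: "parametrized_near M f x I' J' (\<psi> \<circ> \<Phi>) (elliptic_map \<epsilon> \<epsilon>' r \<gamma> e1 e2)"
    unfolding parametrized_near_def using IJ xin par(1) by (auto simp: emap F)
  have tube: "elliptic_map \<epsilon> \<epsilon>' r \<gamma> e1 e2 ` (I' \<times> UNIV) = elliptic_tube p \<epsilon> I' \<gamma> (tube_radius \<epsilon> \<epsilon>' r)"
    if eq: "\<epsilon>'' = \<epsilon>'"
  proof -
    have \<sigma>1: "\<sigma> = 1" using eq eps' by (auto simp: c)
    then have "k0 > 0" using k0(2) \<sigma> by (auto simp: sgn_if split: if_splits)
    then show ?thesis using eps eps' r_pos \<gamma>Q se e eq
      by (intro elliptic_tube_eq) (auto simp: k0(1) \<sigma>1)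
  qed
  have polar: "\<exists>\<beta> a1 a2. regular_curve I' \<beta> \<and> \<beta> ` I' \<subseteq> Q3 p (- \<epsilon>) \<and>
      orthonormal_normal_frame p (- \<epsilon>) I' \<beta> a1 a2 \<and>
      (\<forall>u\<in>I'. definite_metric p (curve_normal_space p (- \<epsilon>) \<beta> u)) \<and>
      (\<forall>q\<in>I' \<times> J'. N ((\<psi> \<circ> \<Phi>) q) = elliptic_map (- \<epsilon>) \<epsilon> (1 / r) \<beta> a1 a2 q) \<and>
      elliptic_map (- \<epsilon>) \<epsilon> (1 / r) \<beta> a1 a2 ` (I' \<times> UNIV) = elliptic_tube p (- \<epsilon>) I' \<beta> (tube_radius (- \<epsilon>) \<epsilon> (1 / r))"
    if eq: "\<epsilon>'' = - \<epsilon>'"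
  proof -
    have \<sigma>m: "\<sigma> = - 1" using eq eps' by (auto simp: c)
    then have k0n: "k0 < 0" using k0(2) \<sigma> by (auto simp: sgn_if split: if_splits)
    have "\<epsilon> * \<epsilon>' < 0"
    proof (rule ccontr)
      assume "\<not> \<epsilon> * \<epsilon>' < 0"
      then have "0 \<le> \<epsilon> * \<epsilon>' * r\<^sup>2" by simp
      then show False using k0n k0(1) by linarith
    qed
    then have \<epsilon>: "\<epsilon> = \<epsilon>''" "\<epsilon> * \<epsilon>' = - 1" "\<epsilon> * \<epsilon> = 1" using eps eps' eq by auto
    have r2: "r\<^sup>2 > 1" "k0 = 1 - r\<^sup>2" using k0n k0(1) \<epsilon> by auto
    have k: "1 + - \<epsilon> * \<epsilon> * (1 / r)\<^sup>2 = (- k0) / r\<^sup>2" using r_pos \<epsilon>(3) by (simp add: r2(2) power_divide diff_divide_distrib)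
    \<comment> \<open>Replacing \<open>r\<close> by \<open>1 / r\<close> multiplies the normalizing
      factor by \<open>r\<close>, which is the factor that has to be pulled out of \<open>n\<close>
      to make the coefficient of the curve equal to \<open>- 1\<close>.\<close>
    have fac: "\<bar>1 + - \<epsilon> * \<epsilon> * (1 / r)\<^sup>2\<bar> powr (- 1 / 2) = r * s"
    proof -
      have "\<bar>1 + - \<epsilon> * \<epsilon> * (1 / r)\<^sup>2\<bar> powr (- 1 / 2) = (\<bar>k0\<bar> / r\<^sup>2) powr (- 1 / 2)"
        unfolding k using k0n by simp
      also have "\<dots> = \<bar>k0\<bar> powr (- 1 / 2) / (r powr 2) powr (- 1 / 2)"
        using r_pos by (simp add: powr_divide powr_numeral)
      also have "(r powr 2) powr (- 1 / 2) = 1 / r" using r_pos by (simp add: powr_powr powr_minus_divide)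
      finally show ?thesis by (simp add: s)
    qed
    \<comment> \<open>As \<open>\<epsilon> * \<epsilon>' = - 1\<close>, both terms of
      \<open>n\<close> carry a minus sign, which is absorbed into the curve and its frame.\<close>
    define \<beta> where "\<beta> u = - \<gamma> u" for u
    define a1 where "a1 u = - e1 u" for u
    define a2 where "a2 u = - e2 u" for u
    have emap': "elliptic_map (- \<epsilon>) \<epsilon> (1 / r) \<beta> a1 a2 (u, v) =
        (r * s) *\<^sub>R (\<beta> u + (1 / r) *\<^sub>R (cos v *\<^sub>R a1 u + sin v *\<^sub>R a2 u))" for u v
      by (simp only: elliptic_map_def prod.case fac)
    have ns: "curve_normal_space p (- \<epsilon>) \<beta> u = span {a1 u, a2 u}" if "u \<in> I'" for u
      using curve_normal_space_uminus[OF d\<gamma>[OF that], of p "- \<epsilon>"] se(6)[OF that] \<sigma>m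
      by (simp add: \<beta>_def[abs_def] a1_def a2_def span_pair_uminus)
    have an: "pnorm2 p (a1 u) = \<epsilon>" "pnorm2 p (a2 u) = \<epsilon>" "pinner p (a1 u) (a2 u) = 0" if "u \<in> I'" for u
      using e(1,2)[OF that] se(5)[OF that] \<epsilon>(1) by (simp_all add: a1_def a2_def pinner.minus_left pinner.minus_right)
    have \<beta>Q: "\<beta> u \<in> Q3 p (- \<epsilon>)" if "u \<in> I'" for u
      using \<gamma>Q[OF that] \<epsilon>(2) \<sigma>m by (auto simp: \<beta>_def Q3_def pinner.minus_left pinner.minus_right)
    have "vector_derivative \<beta> (at u) \<noteq> 0" if "u \<in> I'" for u
    proof -
      have "vector_derivative \<beta> (at u) = - vector_derivative \<gamma> (at u)" unfolding \<beta>_def[abs_def]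
        using d\<gamma>[OF that] by (auto intro!: vector_derivative_at derivative_eq_intros)
      then show ?thesis using reg that by (simp add: regular_curve_def)
    qed
    then have r\<beta>: "regular_curve I' \<beta>"
      using reg smooth_on_minus[OF oI, of \<gamma>] by (auto simp: regular_curve_def \<beta>_def[abs_def])
    have of': "orthonormal_normal_frame p (- \<epsilon>) I' \<beta> a1 a2"
      unfolding orthonormal_normal_frame_def using ns an abs1 \<epsilon>(1) smooth_on_minus[OF oI se(1)] smooth_on_minus[OF oI se(2)]
      by (simp add: a1_def[abs_def] a2_def[abs_def])
    have df: "definite_metric p (curve_normal_space p (- \<epsilon>) \<beta> u)" if "u \<in> I'" for u
      unfolding ns[OF that] using definite_metric_span[OF an(3)[OF that] an(1)[OF that] an(2)[OF that]] eps'' \<epsilon>(1) by simp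
    have NN: "N ((\<psi> \<circ> \<Phi>) (u, v)) = elliptic_map (- \<epsilon>) \<epsilon> (1 / r) \<beta> a1 a2 (u, v)" if "u \<in> I'" "v \<in> J'" for u v
    proof -
      have "N ((\<psi> \<circ> \<Phi>) (u, v)) = n (\<Phi> (u, v))" by (simp add: n)
      also have "\<dots> = s *\<^sub>R ((- r) *\<^sub>R \<gamma> u - (cos v *\<^sub>R e1 u + sin v *\<^sub>R e2 u))" using par(2)[OF that] \<epsilon>(2) by simp
      also have "\<dots> = (r * s) *\<^sub>R (\<beta> u + (1 / r) *\<^sub>R (cos v *\<^sub>R a1 u + sin v *\<^sub>R a2 u))"
        using r_pos by (simp add: \<beta>_def a1_def a2_def algebra_simps)
      finally show ?thesis by (simp add: emap')
    qed
    have tb: "elliptic_map (- \<epsilon>) \<epsilon> (1 / r) \<beta> a1 a2 ` (I' \<times> UNIV) = elliptic_tube p (- \<epsilon>) I' \<beta> (tube_radius (- \<epsilon>) \<epsilon> (1 / r))"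
    proof (rule elliptic_tube_eq[OF _ _ _ _ \<beta>Q ns an])
      show "- \<epsilon> \<in> {- 1, 0, 1}" "\<epsilon> = 1 \<or> \<epsilon> = - 1" "1 / r > 0" using eps \<epsilon>(2) r_pos by auto
      show "1 + - \<epsilon> * \<epsilon> * (1 / r)\<^sup>2 > 0" unfolding k using k0n r_pos by (simp add: divide_neg_pos)
    qed
    have im: "\<beta> ` I' \<subseteq> Q3 p (- \<epsilon>)" "\<forall>q\<in>I' \<times> J'. N ((\<psi> \<circ> \<Phi>) q) = elliptic_map (- \<epsilon>) \<epsilon> (1 / r) \<beta> a1 a2 q"
      using \<beta>Q NN by auto
    show ?thesis
      by (rule exI[of _ \<beta>], rule exI[of _ a1], rule exI[of _ a2], intro conjI im r\<beta> of' tb) (use df in blast)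
  qed
  show ?thesis unfolding \<sigma>\<epsilon>(2)
    by (rule exI[of _ I'], rule exI[of _ J'], rule exI[of _ \<gamma>], rule exI[of _ e1], rule exI[of _ e2], rule exI[of _ "\<psi> \<circ> \<Phi>"],
        intro conjI ballI impI
        reg onf def pn tube polar image_subsetI \<gamma>Q)
qed

text \<open>Now \<open>\<sigma> * \<epsilon>' = - \<epsilon>''\<close>: the two frame vectors have
  opposite signs, the normal planes are indefinite, and the conic cut out by the norm of
  \<open>W\<close> is a hyperbola, of which \<open>cosh\<close> parametrizes the branch through
  \<open>e1\<close>.\<close>

lemma hyperbolic_tube_near:
  fixes M :: "'m::topological_space set"
  assumes ch: "surface_chart M f (I \<times> J) \<psi>" and F: "F = f \<circ> \<psi>"
    and x: "x \<in> \<psi> ` (I \<times> J)" and c: "\<sigma> = - (\<epsilon>' * \<epsilon>'')"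
  shows "\<exists>I J \<gamma> e1 e2 \<psi>.
          regular_curve I \<gamma> \<and> \<gamma> ` I \<subseteq> Q3 p (- (\<epsilon> * \<epsilon>' * \<epsilon>'')) \<and>
          orthonormal_normal_frame p (- (\<epsilon> * \<epsilon>' * \<epsilon>'')) I \<gamma> e1 e2 \<and>
          (\<forall>u\<in>I. indefinite_metric p (curve_normal_space p (- (\<epsilon> * \<epsilon>' * \<epsilon>'')) \<gamma> u) \<and>
                 - pnorm2 p (e1 u) = \<epsilon>'' \<and> pnorm2 p (e2 u) = \<epsilon>'') \<and>
          parametrized_near M f x I J \<psi> (hyperbolic_map \<epsilon> \<epsilon>' r \<gamma> e1 e2)"
proof -
  obtain u0 t0 where q0: "(u0, t0) \<in> I \<times> J" "\<psi> (u0, t0) = x" using x by auto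
  have t0: "t0 \<in> J" using q0 by simp
  have \<sigma>\<epsilon>: "\<sigma> * \<epsilon>' = - \<epsilon>''" "- (\<epsilon> * \<epsilon>' * \<epsilon>'') = \<epsilon> * \<sigma>" using eps' by (auto simp: c)
  have CS: "(cosh v)\<^sup>2 + \<sigma> * \<epsilon>' * \<epsilon>'' * (sinh v)\<^sup>2 = 1" for v :: real
    using eps'' by (auto simp: \<sigma>\<epsilon> cosh_square_eq)
  have C: "cosh v > 0" if "v \<in> {-1<..<1}" for v :: real by simp
  have S: "smooth_on (sinh :: real \<Rightarrow> real) UNIV" "sinh (0 :: real) = 0" "(sinh has_real_derivative 1) (at (0::real))"
    using smooth_on_sinh_cosh by (auto intro!: derivative_eq_intros)
  obtain I' J' \<Phi> e1 e2 where IJ: "open_interval I'" "open_interval J'" "I' \<subseteq> I" "u0 \<in> I'" "0 \<in> J'"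
    "\<Phi> (u0, 0) = (u0, t0)" "surface_chart M f (I' \<times> J') (\<psi> \<circ> \<Phi>)" and
    se: "smooth_on e1 I'" "smooth_on e2 I'"
    "\<And>u. u \<in> I' \<Longrightarrow> pnorm2 p (e1 u) = \<sigma> * \<epsilon>'" "\<And>u. u \<in> I' \<Longrightarrow> pnorm2 p (e2 u) = \<epsilon>''"
    "\<And>u. u \<in> I' \<Longrightarrow> pinner p (e1 u) (e2 u) = 0"
    "\<And>u. u \<in> I' \<Longrightarrow> curve_normal_space p (\<epsilon> * \<sigma>) \<gamma> u = span {e1 u, e2 u}" and
    par: "\<And>u v. u \<in> I' \<Longrightarrow> v \<in> J' \<Longrightarrow> F (\<Phi> (u, v)) = s *\<^sub>R (\<gamma> u + r *\<^sub>R (cosh v *\<^sub>R e1 u + sinh v *\<^sub>R e2 u))"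
    "\<And>u v. u \<in> I' \<Longrightarrow> v \<in> J' \<Longrightarrow>
      n (\<Phi> (u, v)) = s *\<^sub>R ((\<epsilon> * \<epsilon>' * r) *\<^sub>R \<gamma> u - (cosh v *\<^sub>R e1 u + sinh v *\<^sub>R e2 u))"
    by (rule tube_parametrization[OF ch q0(1) S CS C]) blast+
  have xin: "x \<in> (\<psi> \<circ> \<Phi>) ` (I' \<times> J')" using IJ(4-6) q0(2) by force
  have reg: "regular_curve I' \<gamma>" using regular_curve_subset[OF regular_\<gamma> IJ(3)] .
  have \<gamma>Q: "\<gamma> u \<in> Q3 p (\<epsilon> * \<sigma>)" if "u \<in> I'" for u using \<gamma>_in[of u t0] that IJ(3) t0 by blast
  have abs1: "\<bar>\<epsilon>''\<bar> = 1" using eps'' by auto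
  have onf: "orthonormal_normal_frame p (\<epsilon> * \<sigma>) I' \<gamma> e1 e2"
    unfolding orthonormal_normal_frame_def using se abs1 \<sigma>\<epsilon>(1) by simp
  have indef: "indefinite_metric p (curve_normal_space p (\<epsilon> * \<sigma>) \<gamma> u)" if u: "u \<in> I'" for u
  proof -
    have "e1 u \<in> span {e1 u, e2 u}" "e2 u \<in> span {e1 u, e2 u}" by (auto intro: span_base)
    moreover have "pnorm2 p (e1 u) = - \<epsilon>''" using se(3)[OF u] \<sigma>\<epsilon>(1) by simp
    ultimately show ?thesis unfolding se(6)[OF u] indefinite_metric_def spacelike_def timelike_def
      using se(4)[OF u] eps'' by (metis neg_0_less_iff_less neg_less_0_iff_less zero_less_one)
  qed
  have hmap: "hyperbolic_map \<epsilon> \<epsilon>' r \<gamma> e1 e2 (u, v) = s *\<^sub>R (\<gamma> u + r *\<^sub>R (cosh v *\<^sub>R e1 u + sinh v *\<^sub>R e2 u))" for u v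
    by (simp only: hyperbolic_map_def prod.case s k0(1))
  have pn: "parametrized_near M f x I' J' (\<psi> \<circ> \<Phi>) (hyperbolic_map \<epsilon> \<epsilon>' r \<gamma> e1 e2)"
    unfolding parametrized_near_def using IJ xin par(1) by (auto simp: hmap F)
  show ?thesis unfolding \<sigma>\<epsilon>(2)
    by (rule exI[of _ I'], rule exI[of _ J'], rule exI[of _ \<gamma>], rule exI[of _ e1], rule exI[of _ e2], rule exI[of _ "\<psi> \<circ> \<Phi>"],
        intro conjI ballI
        reg onf indef pn image_subsetI \<gamma>Q) (simp_all add: se(3,4) \<sigma>\<epsilon>(1))
qed

end

lemma (in parabolic_tube_chart) parabolic_tube_near:
  fixes M :: "'m::topological_space set"
  assumes ch: "surface_chart M f (I \<times> J) \<psi>" and F: "F = f \<circ> \<psi>" and n: "n = N \<circ> \<psi>"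
    and x: "x \<in> \<psi> ` (I \<times> J)"
  shows "\<exists>I J \<delta>p \<delta>m e1 \<psi>.
          parabolic_data p \<epsilon> \<epsilon>'' I \<delta>p \<delta>m e1 \<and>
          parametrized_near M f x I J \<psi> (parabolic_map \<epsilon> \<epsilon>'' \<delta>p \<delta>m e1) \<and>
          (regular_curve I \<delta>p \<longrightarrow> orthonormal_normal_frame p \<epsilon> I \<delta>p \<delta>m e1) \<and>
          (regular_curve I \<delta>m \<longrightarrow> orthonormal_normal_frame p (- \<epsilon>) I \<delta>m \<delta>p e1) \<and>
          (\<forall>(u, v)\<in>I \<times> J. N (\<psi> (u, v)) =
             parabolic_map (- \<epsilon>) \<epsilon>'' (\<lambda>t. - (\<epsilon> * \<epsilon>'') *\<^sub>R \<delta>m t) (\<lambda>t. (\<epsilon> * \<epsilon>'') *\<^sub>R \<delta>p t) e1 (u, - v))"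
proof -
  obtain u0 t0 where q0: "(u0, t0) \<in> I \<times> J" "\<psi> (u0, t0) = x" using x by auto
  obtain I' J' \<Phi> \<delta>p \<delta>m e1 where IJ: "open_interval I'" "open_interval J'" "I' \<subseteq> I" "u0 \<in> I'" "0 \<in> J'"
    "\<Phi> (u0, 0) = (u0, t0)" "surface_chart M f (I' \<times> J') (\<psi> \<circ> \<Phi>)" and
    data: "parabolic_data p \<epsilon> \<epsilon>'' I' \<delta>p \<delta>m e1"
    "regular_curve I' \<delta>p \<Longrightarrow> orthonormal_normal_frame p \<epsilon> I' \<delta>p \<delta>m e1"
    "regular_curve I' \<delta>m \<Longrightarrow> orthonormal_normal_frame p (- \<epsilon>) I' \<delta>m \<delta>p e1" and
    par: "\<And>u v. u \<in> I' \<Longrightarrow> v \<in> J' \<Longrightarrow> F (\<Phi> (u, v)) = parabolic_map \<epsilon> \<epsilon>'' \<delta>p \<delta>m e1 (u, v)"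
    "\<And>u v. u \<in> I' \<Longrightarrow> v \<in> J' \<Longrightarrow> n (\<Phi> (u, v)) =
      parabolic_map (- \<epsilon>) \<epsilon>'' (\<lambda>t. - (\<epsilon> * \<epsilon>'') *\<^sub>R \<delta>m t) (\<lambda>t. (\<epsilon> * \<epsilon>'') *\<^sub>R \<delta>p t) e1 (u, - v)"
    using parabolic_parametrization[OF ch q0(1)] by blast
  have xin: "x \<in> (\<psi> \<circ> \<Phi>) ` (I' \<times> J')" using IJ(4-6) q0(2) by force
  have pn: "parametrized_near M f x I' J' (\<psi> \<circ> \<Phi>) (parabolic_map \<epsilon> \<epsilon>'' \<delta>p \<delta>m e1)"
    unfolding parametrized_near_def using IJ xin par(1) by (auto simp: F)
  have NN: "\<forall>(u, v)\<in>I' \<times> J'. N ((\<psi> \<circ> \<Phi>) (u, v)) =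
      parabolic_map (- \<epsilon>) \<epsilon>'' (\<lambda>t. - (\<epsilon> * \<epsilon>'') *\<^sub>R \<delta>m t) (\<lambda>t. (\<epsilon> * \<epsilon>'') *\<^sub>R \<delta>p t) e1 (u, - v)"
    using par(2) by (simp add: n)
  show ?thesis
    by (rule exI[of _ I'], rule exI[of _ J'], rule exI[of _ \<delta>p], rule exI[of _ \<delta>m], rule exI[of _ e1], rule exI[of _ "\<psi> \<circ> \<Phi>"],
        intro conjI impI
        data pn NN)
qed

theorem mainTheorem1:
  fixes p :: nat and \<epsilon> r :: real
    and M :: "'m::{t2_space, second_countable_topology} set"
    and f N :: "'m \<Rightarrow> real^4"
  assumes "space_form p \<epsilon>"
    and "oriented_surface p \<epsilon> M f N"
    and "M \<noteq> {}" and "connected M"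
    and "\<forall>x\<in>M. diagonalizable_shape M f N x"
    and "\<forall>x\<in>M. \<not> umbilic M f N x"
    and "r > 0"
    and "\<forall>x\<in>M. principal_curvature M f N x (1 / r)"
  shows "\<exists>\<epsilon>' \<epsilon>'' :: real.
    (\<forall>x\<in>M. pnorm2 p (N x) = \<epsilon>') \<and>
    ((\<epsilon>'' = 1 \<and> (\<forall>x\<in>M. \<forall>X. principal_direction M f N x (1 / r) X \<longrightarrow> spacelike p X)) \<or>
     (\<epsilon>'' = - 1 \<and> (\<forall>x\<in>M. \<forall>X. principal_direction M f N x (1 / r) X \<longrightarrow> timelike p X))) \<and>
    (critical_constant \<epsilon> \<epsilon>' \<epsilon>'' r > 0 \<longrightarrow>
       (\<epsilon>'' = - \<epsilon>' \<longrightarrow> \<epsilon>'' = \<epsilon> \<and> r > 1 \<and>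
          oriented_surface p (- \<epsilon>) (polar_domain M f N) N f \<and>
          polar_surface p \<epsilon> (polar_domain M f N) N f f) \<and>
       (\<forall>x\<in>M. \<exists>I J \<gamma> e1 e2 \<psi>.
          regular_curve I \<gamma> \<and> \<gamma> ` I \<subseteq> Q3 p (\<epsilon> * \<epsilon>' * \<epsilon>'') \<and>
          orthonormal_normal_frame p (\<epsilon> * \<epsilon>' * \<epsilon>'') I \<gamma> e1 e2 \<and>
          (\<forall>u\<in>I. definite_metric p (curve_normal_space p (\<epsilon> * \<epsilon>' * \<epsilon>'') \<gamma> u)) \<and>
          parametrized_near M f x I J \<psi> (elliptic_map \<epsilon> \<epsilon>' r \<gamma> e1 e2) \<and>
          (\<epsilon>'' = \<epsilon>' \<longrightarrow>
             elliptic_map \<epsilon> \<epsilon>' r \<gamma> e1 e2 ` (I \<times> UNIV)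
               = elliptic_tube p \<epsilon> I \<gamma> (tube_radius \<epsilon> \<epsilon>' r)) \<and>
          (\<epsilon>'' = - \<epsilon>' \<longrightarrow>
             (\<exists>\<beta> a1 a2.
                regular_curve I \<beta> \<and> \<beta> ` I \<subseteq> Q3 p (- \<epsilon>) \<and>
                orthonormal_normal_frame p (- \<epsilon>) I \<beta> a1 a2 \<and>
                (\<forall>u\<in>I. definite_metric p (curve_normal_space p (- \<epsilon>) \<beta> u)) \<and>
                (\<forall>q\<in>I \<times> J. N (\<psi> q) = elliptic_map (- \<epsilon>) \<epsilon> (1 / r) \<beta> a1 a2 q) \<and>
                elliptic_map (- \<epsilon>) \<epsilon> (1 / r) \<beta> a1 a2 ` (I \<times> UNIV)
                  = elliptic_tube p (- \<epsilon>) I \<beta> (tube_radius (- \<epsilon>) \<epsilon> (1 / r)))))) \<and>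
    (critical_constant \<epsilon> \<epsilon>' \<epsilon>'' r < 0 \<longrightarrow>
       (\<forall>x\<in>M. \<exists>I J \<gamma> e1 e2 \<psi>.
          regular_curve I \<gamma> \<and> \<gamma> ` I \<subseteq> Q3 p (- (\<epsilon> * \<epsilon>' * \<epsilon>'')) \<and>
          orthonormal_normal_frame p (- (\<epsilon> * \<epsilon>' * \<epsilon>'')) I \<gamma> e1 e2 \<and>
          (\<forall>u\<in>I. indefinite_metric p (curve_normal_space p (- (\<epsilon> * \<epsilon>' * \<epsilon>'')) \<gamma> u) \<and>
                 - pnorm2 p (e1 u) = \<epsilon>'' \<and> pnorm2 p (e2 u) = \<epsilon>'') \<and>
          parametrized_near M f x I J \<psi> (hyperbolic_map \<epsilon> \<epsilon>' r \<gamma> e1 e2))) \<and>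
    (critical_constant \<epsilon> \<epsilon>' \<epsilon>'' r = 0 \<longrightarrow>
       \<epsilon> = - \<epsilon>' \<and> r = 1 \<and>
       polar_surface p (- \<epsilon>) (polar_domain M f N) f N N \<and>
       (\<forall>x\<in>M. \<exists>I J \<delta>p \<delta>m e1 \<psi>.
          parabolic_data p \<epsilon> \<epsilon>'' I \<delta>p \<delta>m e1 \<and>
          parametrized_near M f x I J \<psi> (parabolic_map \<epsilon> \<epsilon>'' \<delta>p \<delta>m e1) \<and>
          (regular_curve I \<delta>p \<longrightarrow> orthonormal_normal_frame p \<epsilon> I \<delta>p \<delta>m e1) \<and>
          (regular_curve I \<delta>m \<longrightarrow> orthonormal_normal_frame p (- \<epsilon>) I \<delta>m \<delta>p e1) \<and>
          (\<forall>(u, v)\<in>I \<times> J. N (\<psi> (u, v)) =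
             parabolic_map (- \<epsilon>) \<epsilon>'' (\<lambda>t. - (\<epsilon> * \<epsilon>'') *\<^sub>R \<delta>m t) (\<lambda>t. (\<epsilon> * \<epsilon>'') *\<^sub>R \<delta>p t) e1 (u, - v))))"
proof -
  note sf = assms(1) and or = assms(2) and r = assms(7)
  have nu: "\<not> umbilic M f N x" and pc: "principal_curvature M f N x (1 / r)" if "x \<in> M" for x
    using assms(6,8) that by auto
  have "smooth_on_surface M f N" "\<And>x. x \<in> M \<Longrightarrow> \<bar>pnorm2 p (N x)\<bar> = 1" using or by (auto simp: oriented_surface_def)
  then obtain \<epsilon>' where \<epsilon>': "\<epsilon>' = 1 \<or> \<epsilon>' = - 1" and N: "\<And>x. x \<in> M \<Longrightarrow> pnorm2 p (N x) = \<epsilon>'"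
    using normal_norm_constant[OF assms(4)] by metis
  obtain \<epsilon>'' where \<epsilon>'': "\<epsilon>'' = 1 \<or> \<epsilon>'' = - 1"
    and sg: "\<And>x X. x \<in> M \<Longrightarrow> principal_direction M f N x (1 / r) X \<Longrightarrow> sgn (pnorm2 p X) = \<epsilon>''"
    by (rule fibre_sign_constant[OF sf or assms(4) r nu pc \<epsilon>' N]) blast+
  have \<epsilon>: "\<epsilon> = 0 \<or> \<epsilon> = 1 \<or> \<epsilon> = - 1" using sf by (auto simp: space_form_def)
  define k0 where "k0 = 1 + \<epsilon> * \<epsilon>' * r\<^sup>2"
  have cc: "critical_constant \<epsilon> \<epsilon>' \<epsilon>'' r = \<epsilon>'' * \<epsilon>' * k0 / r\<^sup>2"
    using critical_constant_eq[OF r \<epsilon>'] by (simp add: k0_def)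
  define s where "s = \<bar>k0\<bar> powr (- 1 / 2)"
  have signs: "(\<epsilon>'' = 1 \<and> (\<forall>x\<in>M. \<forall>X. principal_direction M f N x (1 / r) X \<longrightarrow> spacelike p X)) \<or>
      (\<epsilon>'' = - 1 \<and> (\<forall>x\<in>M. \<forall>X. principal_direction M f N x (1 / r) X \<longrightarrow> timelike p X))"
    using \<epsilon>''
  proof (elim disjE)
    assume "\<epsilon>'' = 1"
    then show ?thesis using sg by (auto simp: spacelike_def sgn_1_pos)
  next
    assume "\<epsilon>'' = - 1"
    then show ?thesis using sg by (auto simp: timelike_def sgn_1_neg)
  qed
  have chart: "\<exists>I J \<psi> \<Gamma>. surface_chart M f (I \<times> J) \<psi> \<and> x \<in> \<psi> ` (I \<times> J) \<and>
      signed_tube_chart p \<epsilon> r \<epsilon>' I J (f \<circ> \<psi>) (N \<circ> \<psi>) \<Gamma> \<epsilon>''" if x: "x \<in> M" for x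
    by (rule signed_tube_chart_exists[OF sf or x r nu pc \<epsilon>' N \<epsilon>'' sg]) blast+
  have nonpar: "\<exists>I J \<psi> \<Gamma>. surface_chart M f (I \<times> J) \<psi> \<and> x \<in> \<psi> ` (I \<times> J) \<and>
      nonparabolic_tube_chart p \<epsilon> r \<epsilon>' I J (f \<circ> \<psi>) (N \<circ> \<psi>) \<Gamma> \<epsilon>'' k0 (sgn k0) s
        (\<lambda>u. (sgn k0 * s) *\<^sub>R \<Gamma> u) (\<lambda>q. (sgn k0 * s) *\<^sub>R ((\<epsilon> * \<epsilon>' * r) *\<^sub>R (f \<circ> \<psi>) q - (N \<circ> \<psi>) q))"
    if "x \<in> M" "k0 \<noteq> 0" for x
    using chart[OF that(1)] that(2)
    by (auto simp: nonparabolic_tube_chart_def nonparabolic_tube_chart_axioms_def k0_def s_def)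
  have r2: "r\<^sup>2 > 0" using r by simp
  \<comment> \<open>The positive factor \<open>1 / r\<^sup>2\<close> does not affect signs, so the
    sign of the critical constant is that of \<open>k0\<close> times
    \<open>\<epsilon>' * \<epsilon>''\<close>.\<close>
  have pos: "k0 \<noteq> 0 \<and> sgn k0 = \<epsilon>' * \<epsilon>''" if "critical_constant \<epsilon> \<epsilon>' \<epsilon>'' r > 0"
    using that \<epsilon>' \<epsilon>'' r2 unfolding cc by (auto simp: sgn_if zero_less_divide_iff)
  have neg: "k0 \<noteq> 0 \<and> sgn k0 = - (\<epsilon>' * \<epsilon>'')" if "critical_constant \<epsilon> \<epsilon>' \<epsilon>'' r < 0"
    using that \<epsilon>' \<epsilon>'' r2 unfolding cc by (auto simp: sgn_if divide_less_0_iff)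
  \<comment> \<open>Neither \<open>1\<close> nor \<open>1 + r\<^sup>2\<close> vanishes, which leaves
    \<open>\<epsilon> * \<epsilon>' = - 1\<close> and \<open>r\<^sup>2 = 1\<close>.\<close>
  have zero: "\<epsilon> = - \<epsilon>' \<and> r = 1" if "critical_constant \<epsilon> \<epsilon>' \<epsilon>'' r = 0"
  proof -
    have k: "1 + \<epsilon> * \<epsilon>' * r\<^sup>2 = 0" using that \<epsilon>' \<epsilon>'' r2 unfolding cc k0_def by auto
    moreover have "1 + r\<^sup>2 \<noteq> 0" using r2 by linarith
    ultimately have "\<epsilon> * \<epsilon>' = - 1" using \<epsilon> \<epsilon>' by auto
    then show ?thesis using k \<epsilon> \<epsilon>' r by (auto simp: power2_eq_1_iff)
  qed
  {
    fix x assume x: "x \<in> M" and c: "critical_constant \<epsilon> \<epsilon>' \<epsilon>'' r > 0"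
    obtain I J \<psi> \<Gamma> where *: "surface_chart M f (I \<times> J) \<psi>" "x \<in> \<psi> ` (I \<times> J)"
      "nonparabolic_tube_chart p \<epsilon> r \<epsilon>' I J (f \<circ> \<psi>) (N \<circ> \<psi>) \<Gamma> \<epsilon>'' k0 (sgn k0) s
        (\<lambda>u. (sgn k0 * s) *\<^sub>R \<Gamma> u) (\<lambda>q. (sgn k0 * s) *\<^sub>R ((\<epsilon> * \<epsilon>' * r) *\<^sub>R (f \<circ> \<psi>) q - (N \<circ> \<psi>) q))"
      using nonpar[OF x] pos[OF c] by blast
    have "sgn k0 = \<epsilon>' * \<epsilon>''" using pos[OF c] by simp
    note nonparabolic_tube_chart.elliptic_tube_near[OF *(3,1) refl refl *(2) this]
  } note elliptic = this
  {
    fix x assume x: "x \<in> M" and c: "critical_constant \<epsilon> \<epsilon>' \<epsilon>'' r < 0"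
    obtain I J \<psi> \<Gamma> where *: "surface_chart M f (I \<times> J) \<psi>" "x \<in> \<psi> ` (I \<times> J)"
      "nonparabolic_tube_chart p \<epsilon> r \<epsilon>' I J (f \<circ> \<psi>) (N \<circ> \<psi>) \<Gamma> \<epsilon>'' k0 (sgn k0) s
        (\<lambda>u. (sgn k0 * s) *\<^sub>R \<Gamma> u) (\<lambda>q. (sgn k0 * s) *\<^sub>R ((\<epsilon> * \<epsilon>' * r) *\<^sub>R (f \<circ> \<psi>) q - (N \<circ> \<psi>) q))"
      using nonpar[OF x] neg[OF c] by blast
    have "sgn k0 = - (\<epsilon>' * \<epsilon>'')" using neg[OF c] by simp
    note nonparabolic_tube_chart.hyperbolic_tube_near[OF *(3,1) refl *(2) this]
  } note hyperbolic = this
  {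
    fix x assume x: "x \<in> M" and c: "critical_constant \<epsilon> \<epsilon>' \<epsilon>'' r = 0"
    obtain I J \<psi> \<Gamma> where *: "surface_chart M f (I \<times> J) \<psi>" "x \<in> \<psi> ` (I \<times> J)"
      "signed_tube_chart p \<epsilon> r \<epsilon>' I J (f \<circ> \<psi>) (N \<circ> \<psi>) \<Gamma> \<epsilon>''"
      using chart[OF x] by blast
    have "parabolic_tube_chart p \<epsilon> r \<epsilon>' I J (f \<circ> \<psi>) (N \<circ> \<psi>) \<Gamma> \<epsilon>''"
      using *(3) zero[OF c] \<epsilon>' by (auto simp: parabolic_tube_chart_def parabolic_tube_chart_axioms_def)
    note parabolic_tube_chart.parabolic_tube_near[OF this *(1) refl refl *(2)]
  } note parabolic = this
  \<comment> \<open>Here \<open>k0\<close> is negative, which again excludes the values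
    \<open>0\<close> and \<open>1\<close> for \<open>\<epsilon> * \<epsilon>'\<close>; then
    \<open>1 - r\<^sup>2 < 0\<close>.\<close>
  have polar_sign: "\<epsilon>'' = \<epsilon> \<and> r > 1" if "critical_constant \<epsilon> \<epsilon>' \<epsilon>'' r > 0" "\<epsilon>'' = - \<epsilon>'"
  proof -
    have "sgn k0 = - 1" using pos[OF that(1)] that(2) \<epsilon>' by auto
    then have k: "1 + \<epsilon> * \<epsilon>' * r\<^sup>2 < 0" by (simp add: sgn_1_neg k0_def)
    moreover have "\<not> 1 + r\<^sup>2 < 0" using r2 by linarith
    ultimately have "\<epsilon> * \<epsilon>' = - 1" using \<epsilon> \<epsilon>' by auto
    then have "\<epsilon> = - \<epsilon>'" "1 < r\<^sup>2" using \<epsilon> \<epsilon>' k by auto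
    then show ?thesis using that(2) r power2_less_imp_less[of 1 r] by simp
  qed
  \<comment> \<open>Both in the polar elliptic case and in the parabolic case
    \<open>\<epsilon>' = - \<epsilon>\<close>, so \<open>N\<close> takes its values in the quadric
    of square norm \<open>- \<epsilon>\<close>.\<close>
  have polar: "oriented_surface p (- \<epsilon>) (polar_domain M f N) N f" "polar_surface p \<epsilon> (polar_domain M f N) N f f"
    "polar_surface p (- \<epsilon>) (polar_domain M f N) f N N" if "\<epsilon> = - \<epsilon>'"
    using polar_surfaces[OF or, of] N that \<epsilon>' by auto
  show ?thesis
    by (rule exI[of _ \<epsilon>'], rule exI[of _ \<epsilon>''],
        intro conjI impI ballI signs N elliptic hyperbolic parabolic polar; use polar_sign zero in simp)
qed

end
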